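(* There are a fixed dimension $d$, a real number $\epsilon>0$, and an infinite family $(P_k)_{k\in\mathbb{N}}$ of $d$-dimensional polytopes, where $P_k$ has $n_k$ facets with $n_1<n_2<n_3<\cdots$, such that for every $k$ the combinatorial diameter of $P_k$ is bigger than $(1+\epsilon)n_k$.
   Context: Polytopes are convex and bounded. The combinatorial diameter of a polytope is the diameter of its graph (formed by vertices and edges): the maximum over pairs of vertices of the minimum number of edges in an edge path connecting them. *)

theory Defs
  imports "HOL-Analysis.Analysis" "HOL-Analysis.Finite_Function_Topology"
begin

text \<open>
  The dimension of a polytope has to be an existentially quantified number, so the ambient space
  cannot be a type such as \<open>real ^ 'n\<close>.  We use the space of finitely supported real sequences,
  i.e. the union of all \<open>\<real>^m\<close>: every polytope in it lies in some \<open>\<real>^m\<close>, and every polytope in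
  every \<open>\<real>^m\<close> occurs in it.  The library notions \<^const>\<open>polytope\<close>, \<^const>\<open>face_of\<close> and
  \<^const>\<open>extreme_point_of\<close> make sense in any real vector space, but \<^const>\<open>aff_dim\<close>,
  \<^const>\<open>facet_of\<close> and \<^const>\<open>edge_of\<close> are restricted to the class \<^class>\<open>euclidean_space\<close>.
  Below they are restated for real vector spaces, and shown to agree with the library versions
  on that class.
\<close>

type_synonym point = "(nat, real) poly_mapping"

text \<open>
  The dimension of the direction space of the affine hull.  It is meant for sets whose affine
  hull has finite dimension, such as polytopes.
\<close>

definition affine_dim :: "'a::real_vector set \<Rightarrow> int" where
  "affine_dim S = (if S = {} then - 1 else int (dim {x - y |x y. x \<in> S \<and> y \<in> S}))"

definition is_facet_of :: "'a::real_vector set \<Rightarrow> 'a set \<Rightarrow> bool" where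
  "is_facet_of F P \<longleftrightarrow> F face_of P \<and> F \<noteq> {} \<and> affine_dim F = affine_dim P - 1"

definition is_edge_of :: "'a::real_vector set \<Rightarrow> 'a set \<Rightarrow> bool" where
  "is_edge_of e P \<longleftrightarrow> e face_of P \<and> affine_dim e = 1"

lemma affine_dim_eq_aff_dim:
  fixes S :: "'a::euclidean_space set"
  shows "affine_dim S = aff_dim S"
proof (cases "S = {}")
  case False
  then obtain a where a: "a \<in> S" by blast
  let ?D = "{x - y |x y. x \<in> S \<and> y \<in> S}" and ?T = "(+) (- a) ` S"
  have "?D \<subseteq> span ?T"
  proof safe
    fix x y assume "x \<in> S" "y \<in> S"
    then have "(- a + x) - (- a + y) \<in> span ?T"
      by (intro span_diff span_base imageI)
    then show "x - y \<in> span ?T" by simp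
  qed
  moreover have "?T \<subseteq> ?D" 
  proof safe
    fix x assume "x \<in> S"
    then show "\<exists>x' y. - a + x = x' - y \<and> x' \<in> S \<and> y \<in> S"
      using a by (intro exI[of _ x] exI[of _ a]) simp
  qed
  ultimately have "span ?D = span ?T"
    using span_eq[of ?D ?T] span_superset[of ?D] by (meson subset_trans)
  then have "dim ?D = dim ?T" using dim_span[of ?D] dim_span[of ?T] by simp
  moreover have "aff_dim S = int (dim ?T)"
    by (rule aff_dim_eq_dim[OF hull_inc[OF a]])
  ultimately show ?thesis using False by (simp add: affine_dim_def)
qed (simp add: affine_dim_def)

lemma is_facet_of_eq_facet_of:
  fixes P :: "'a::euclidean_space set"
  shows "is_facet_of F P \<longleftrightarrow> F facet_of P"
  by (simp add: is_facet_of_def facet_of_def affine_dim_eq_aff_dim)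

lemma is_edge_of_eq_edge_of:
  fixes P :: "'a::euclidean_space set"
  shows "is_edge_of e P \<longleftrightarrow> e edge_of P"
  by (simp add: is_edge_of_def edge_of_def affine_dim_eq_aff_dim)

definition polytope_vertices :: "'a::real_vector set \<Rightarrow> 'a set" where
  "polytope_vertices P = {v. v extreme_point_of P}"

definition polytope_adj :: "'a::real_vector set \<Rightarrow> ('a \<times> 'a) set" where
  "polytope_adj P = {(u, v). u \<in> polytope_vertices P \<and> v \<in> polytope_vertices P \<and> u \<noteq> v \<and>
     (\<exists>e. is_edge_of e P \<and> u \<in> e \<and> v \<in> e)}"

text \<open>
  Membership in \<open>polytope_adj P ^^ n\<close> means being joined by an edge path with \<open>n\<close> edges.
  The value is in \<^typ>\<open>enat\<close> only to avoid an unspecified minimum over an empty set of paths; the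
  graph of a polytope is connected and finite, so for nonempty polytopes infimum and supremum are a
  minimum and a maximum.
\<close>

definition graph_dist :: "'a::real_vector set \<Rightarrow> 'a \<Rightarrow> 'a \<Rightarrow> enat" where
  "graph_dist P u v = (INF n\<in>{n. (u, v) \<in> polytope_adj P ^^ n}. enat n)"

definition combinatorial_diameter :: "'a::real_vector set \<Rightarrow> enat" where
  "combinatorial_diameter P =
     (SUP u\<in>polytope_vertices P. SUP v\<in>polytope_vertices P. graph_dist P u v)"

end

theory Submission
  imports Defs
begin

text \<open>
  The starting point is a pair of centrally symmetric polytopes in \<open>\<real>\<^sup>4\<close>, a variant of Santos's
  example, such that no facet normal of the first and facet normal of the second are extreme at
  vertices of each other's facets.  Homogeneously, the polar of the prismatoid over the pair is a cone
  \<open>a \<bullet> z \<le> p, b \<bullet> z \<le> q\<close> with 20 + 20 facets and two apexes, \<open>p = 0\<close> and \<open>q = 0\<close>; every chain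
  of edges joining the apexes has more than 5 edges.

  The strong d-step construction is done at one stroke.  Take the iterated wedge over \<open>b\<^sub>0\<close> (new
  coordinates \<open>y \<ge> 0\<close>, \<open>\<Sum> y \<le> q - b\<^sub>0 \<bullet> z\<close>) and over \<open>a\<^sub>0\<close> (coordinates \<open>y'\<close>), tilt the
  surplus facets at the apexes by \<open>\<epsilon> (y - \<theta> q)\<close> and \<open>\<epsilon> (y' - \<theta> p)\<close> so that both apexes become
  simple, and shift all facets generically.  The result is a simple polytope of dimension 35 with 70
  facets, each containing exactly one of the two apexes.  An edge path of length 35 between the apexes would
  leave one facet and enter one facet in each step; letting \<open>\<epsilon>\<close> tend to 0, two of its vertices
  converge to a forbidden pair.  Hence the apexes have distance at least 36.

  The product of two copies has dimension 70, 140 facets and apexes at distance at least 72.  Gluing a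
  further copy at a simple vertex adds 70 facets and at least 71 to the distance, and 71 > 70.

  Only tight sets matter throughout: in a simple polytope of dimension \<open>D\<close> the vertices are the points
  with \<open>D\<close> tight facets, adjacent ones share \<open>D - 1\<close> of them, and distances are bounded below
  by functions of the tight set that change by at most one along edges.  Polytopes are handled as
  cones \<open>l i X \<ge> 0\<close>, which makes projective transformations linear.
\<close>

section \<open>Two polytopes in dimension four\<close>

text \<open>A spindle of dimension D with 2D facets and length D + 1 is not enough for gluing: a
  copy adds D facets and, one edge being lost at the seam, only D to the distance. The product
  doubles the surplus over the dimension, so that one unit per copy survives the loss.

  The dimension 35 is a count. Each apex of the 5-dimensional polytope lies on 20 facets, 15 more
  than a simple vertex allows. The wedge over \<open>b\<^sub>0\<close> blows the apex
  \<open>p = 0\<close> up to a 15-dimensional simplex in the coordinates \<open>y\<close>; the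
  tilted facets then cut out one interior point of it. Both sides together give 5 + 15 + 15.

  The perturbed vertices are never computed. There are only finitely many tight sets, and tightness
  survives limits, so it suffices to read two tight sets at \<open>\<epsilon> = 0\<close>. There a
  vertex with 16 tight facets on one side and 19 on the other has \<open>z \<noteq> 0\<close>, and
  the bound of five ties forces exactly one and four ties of \<open>z\<close>. Monotonicity of the
  path carries the single ties from one vertex to the other, which is the forbidden
  configuration.\<close>

text \<open>\<open>Ai\<close> and \<open>Bj\<close> stand for: the \<open>i\<close>-th pattern of the first polytope, the \<open>j\<close>-th of the second,
  is maximal in a given direction.  The assumptions are the minimal sets of patterns that are never
  maximal together.\<close>

locale tie_pattern =
  fixes A0 A1 A2 A3 A4 A5 A6 B0 B1 B2 B3 B4 B5 B6 :: bool
  assumes excluded: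
    "\<not> (A0 \<and> A3)" "\<not> (A0 \<and> A4)" "\<not> (A0 \<and> B0)" "\<not> (A0 \<and> B1)" "\<not> (A0 \<and> B3)"
    "\<not> (A0 \<and> B5)" "\<not> (A0 \<and> B6)" "\<not> (A1 \<and> A2)" "\<not> (A1 \<and> A4)" "\<not> (A1 \<and> B0)"
    "\<not> (A1 \<and> B1)" "\<not> (A1 \<and> B2)" "\<not> (A1 \<and> B5)" "\<not> (A1 \<and> B6)" "\<not> (A2 \<and> A3)"
    "\<not> (A2 \<and> B0)" "\<not> (A3 \<and> B1)" "\<not> (A5 \<and> B0)" "\<not> (A5 \<and> B1)" "\<not> (A5 \<and> B5)"
    "\<not> (A5 \<and> B6)" "\<not> (A6 \<and> B0)" "\<not> (A6 \<and> B1)" "\<not> (A6 \<and> B5)" "\<not> (A6 \<and> B6)"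
    "\<not> (B0 \<and> B3)" "\<not> (B0 \<and> B4)" "\<not> (B1 \<and> B2)" "\<not> (B1 \<and> B4)" "\<not> (B2 \<and> B3)"
    "\<not> (A0 \<and> A2 \<and> B4)" "\<not> (A1 \<and> A3 \<and> B4)" "\<not> (A2 \<and> A6 \<and> B3)" "\<not> (A2 \<and> A6 \<and> B4)" "\<not> (A2 \<and> B2 \<and> B6)"
    "\<not> (A3 \<and> A5 \<and> B2)" "\<not> (A3 \<and> A5 \<and> B4)" "\<not> (A3 \<and> B3 \<and> B5)" "\<not> (A4 \<and> B0 \<and> B2)" "\<not> (A4 \<and> B1 \<and> B3)"
    "\<not> (A4 \<and> B2 \<and> B6)" "\<not> (A4 \<and> B3 \<and> B5)"
begin

text \<open>Among \<open>A0\<close>, ..., \<open>A4\<close> the excluded pairs form a 5-cycle, so at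
  most two hold; likewise among \<open>B0\<close>, ..., \<open>B4\<close>. Each of
  \<open>A5\<close>, \<open>A6\<close> excludes both \<open>B5\<close> and \<open>B6\<close>, so
  only one of these two pairs contributes. With one contribution the total is at most 2 + 2 + 1; if
  a whole pair holds, it excludes enough of the other side to leave three.\<close>

lemma tie_sum: "of_bool A0 + of_bool A1 + of_bool A2 + of_bool A3 + of_bool A4 + of_bool A5 + of_bool A6 + of_bool B0 + of_bool B1 + of_bool B2 + of_bool B3 + of_bool B4 + of_bool B5 + of_bool B6 \<le> (5::nat)"
proof -
  have a: "of_bool A0 + of_bool A1 + of_bool A2 + of_bool A3 + of_bool A4 \<le> (2::nat)" using excluded(1,2,8,9,15)
    by (cases A0; cases A1; cases A2; cases A3; cases A4; simp)
  have b: "of_bool B0 + of_bool B1 + of_bool B2 + of_bool B3 + of_bool B4 \<le> (2::nat)" using excluded(26,27,28,29,30)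
    by (cases B0; cases B1; cases B2; cases B3; cases B4; simp)
  consider "A5 \<and> A6" | "B5 \<and> B6" | "\<not> (A5 \<and> A6)" "\<not> (B5 \<and> B6)" by blast
  then show ?thesis
  proof cases
    case 1
    have n: "\<not> B0" "\<not> B1" "\<not> B5" "\<not> B6" "\<not> (A3 \<and> B4)" "\<not> (A2 \<and> B4)" "\<not> (A2 \<and> B3)" "\<not> (A3 \<and> B2)"
      using 1 excluded by simp_all
    have "of_bool A0 + of_bool A1 + of_bool A2 + of_bool A3 + of_bool A4 + of_bool B2 + of_bool B3 + of_bool B4 \<le> (3::nat)"
      using n(5-8) excluded(1,2,5,8,9,12,15,30,31,32)
      by (cases B4; cases B2; cases B3; simp; cases A0; cases A1; cases A2; cases A3; cases A4; simp)
    then show ?thesis using 1 n by simp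
  next
    case 2
    have n: "\<not> A0" "\<not> A1" "\<not> A5" "\<not> A6" "\<not> (A2 \<and> B2)" "\<not> (A3 \<and> B3)" "\<not> (A4 \<and> B2)" "\<not> (A4 \<and> B3)"
      using 2 excluded by simp_all
    have "of_bool A2 + of_bool A3 + of_bool A4 + of_bool B0 + of_bool B1 + of_bool B2 + of_bool B3 + of_bool B4 \<le> (3::nat)"
      using n(5-8) excluded(15,16,17,26,27,28,29,30,39,40)
      by (cases A4; cases A2; cases A3; simp; cases B0; cases B1; cases B2; cases B3; cases B4; simp)
    then show ?thesis using 2 n by simp
  next
    case 3
    have "of_bool A5 + of_bool A6 + of_bool B5 + of_bool B6 \<le> (1::nat)"
      using 3 excluded(20,21,24,25)
      by (cases A5; cases A6; cases B5; cases B6; simp)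
    then show ?thesis using a b by linarith
  qed
qed

text \<open>The 5-cycle allows only two of \<open>A0\<close>, ..., \<open>A4\<close>, so four
  patterns include \<open>A5\<close> and \<open>A6\<close>, which exclude most of the
  \<open>B\<close> side. The last claim uses the count once more: \<open>B4\<close> already removes
  \<open>A2\<close> and \<open>A3\<close>, and \<open>A4\<close> would remove \<open>A0\<close> and
  \<open>A1\<close>, leaving one instead of two.\<close>

lemma four_A:
  assumes "of_bool A0 + of_bool A1 + of_bool A2 + of_bool A3 + of_bool A4 + of_bool A5 + of_bool A6 \<ge> (4::nat)"
  shows "\<not> B0" "\<not> B1" "\<not> B5" "\<not> B6" "B2 \<Longrightarrow> \<not> A3" "B3 \<Longrightarrow> \<not> A2"
    "B4 \<Longrightarrow> \<not> A2 \<and> \<not> A3 \<and> \<not> A4"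
proof -
  have a: "of_bool A0 + of_bool A1 + of_bool A2 + of_bool A3 + of_bool A4 \<le> (2::nat)" using excluded(1,2,8,9,15)
    by (cases A0; cases A1; cases A2; cases A3; cases A4; simp)
  then have b: A5 A6 "of_bool A0 + of_bool A1 + of_bool A2 + of_bool A3 + of_bool A4 \<ge> (2::nat)" using assms
    by (cases A5; cases A6; simp)+
  show "\<not> B0" "\<not> B1" "\<not> B5" "\<not> B6" "B2 \<Longrightarrow> \<not> A3" "B3 \<Longrightarrow> \<not> A2"
    using excluded b(1,2) by simp_all
  assume B4
  then have "\<not> A2" "\<not> A3" using excluded b(1,2) by simp_all
  moreover have "\<not> A4"
  proof
    assume A4
    then have "\<not> A0" "\<not> A1" using excluded by simp_all
    then show False using b(3) \<open>A4\<close> \<open>\<not> A2\<close> \<open>\<not> A3\<close> by simp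
  qed
  ultimately show "\<not> A2 \<and> \<not> A3 \<and> \<not> A4" by blast
qed

lemma four_B:
  assumes "of_bool B0 + of_bool B1 + of_bool B2 + of_bool B3 + of_bool B4 + of_bool B5 + of_bool B6 \<ge> (4::nat)"
  shows "\<not> A0" "\<not> A1" "\<not> A5" "\<not> A6" "B2 \<Longrightarrow> \<not> A2 \<and> \<not> A4" "B3 \<Longrightarrow> \<not> A3 \<and> \<not> A4"
proof -
  have a: "of_bool B0 + of_bool B1 + of_bool B2 + of_bool B3 + of_bool B4 \<le> (2::nat)" using excluded(26,27,28,29,30)
    by (cases B0; cases B1; cases B2; cases B3; cases B4; simp)
  then have b: B5 B6 "of_bool B0 + of_bool B1 + of_bool B2 + of_bool B3 + of_bool B4 \<ge> (2::nat)" using assms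
    by (cases B5; cases B6; simp)+
  show "\<not> A0" "\<not> A1" "\<not> A5" "\<not> A6" "B2 \<Longrightarrow> \<not> A2 \<and> \<not> A4" "B3 \<Longrightarrow> \<not> A3 \<and> \<not> A4"
    using excluded b(1,2) by simp_all
qed

end

text \<open>Every excluded set violates one of the other inequalities; for instance
  \<open>2*w1 = p\<close> and \<open>9*w4 = p\<close> give
  \<open>w1 + 8*w4 = p/2 + 8*p/9 > p\<close>.\<close>

lemma tie_pattern_weights:
  fixes w1 w2 w3 w4 p q :: real
  assumes "w1 \<ge> 0" "w2 \<ge> 0" "w3 \<ge> 0" "w4 \<ge> 0" "p > 0" "q > 0"
    "2*w1 \<le> p" "2*w2 \<le> p" "9*w3 \<le> p" "9*w4 \<le> p" "5*w3+5*w4 \<le> p" "w2+8*w3 \<le> p" "w1+8*w4 \<le> p"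
    "2*w4 \<le> q" "2*w3 \<le> q" "9*w1 \<le> q" "9*w2 \<le> q" "5*w1+5*w2 \<le> q" "8*w1+w3 \<le> q" "8*w2+w4 \<le> q"
  shows "tie_pattern (2*w1 = p) (2*w2 = p) (9*w3 = p) (9*w4 = p) (5*w3+5*w4 = p) (w2+8*w3 = p) (w1+8*w4 = p) (2*w4 = q) (2*w3 = q) (9*w1 = q) (9*w2 = q) (5*w1+5*w2 = q) (8*w1+w3 = q) (8*w2+w4 = q)"
  by (rule tie_pattern.intro) (use assms in linarith)+

section \<open>Sign-symmetric sets of normals and their ties\<close>

type_synonym R4 = "real \<times> real \<times> real \<times> real"

definition absv :: "R4 \<Rightarrow> R4" where
  "absv = (\<lambda>(a, b, c, d). (\<bar>a\<bar>, \<bar>b\<bar>, \<bar>c\<bar>, \<bar>d\<bar>))"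

text \<open>Sign patterns modulo signs: seven patterns stand for 2 + 2 + 2 + 2 + 4 + 4 + 4 = 20
  normals. \<open>PB\<close> is the image of \<open>PA\<close> under the coordinate permutation
  sending \<open>(c1, c2, c3, c4)\<close> to \<open>(c3, c4, c2, c1)\<close>, so the two polytopes
  are congruent.\<close>

definition PA :: "R4 set" where
  "PA = {(2,0,0,0), (0,2,0,0), (0,0,9,0), (0,0,0,9), (0,0,5,5), (0,1,8,0), (1,0,0,8)}"

definition PB :: "R4 set" where
  "PB = {(0,0,0,2), (0,0,2,0), (9,0,0,0), (0,9,0,0), (5,5,0,0), (8,0,1,0), (0,8,0,1)}"

definition QA :: "R4 set" where "QA = absv -` PA"
definition QB :: "R4 set" where "QB = absv -` PB"

definition tie :: "'a::real_inner set \<Rightarrow> 'a \<Rightarrow> real \<Rightarrow> 'a set" where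
  "tie Q z p = {a \<in> Q. a \<bullet> z = p}"

lemma absv_Pair [simp]: "absv (a, b, c, d) = (\<bar>a\<bar>, \<bar>b\<bar>, \<bar>c\<bar>, \<bar>d\<bar>)"
  by (simp add: absv_def)

lemma absv_vimage:
  assumes "c1 \<ge> 0" "c2 \<ge> 0" "c3 \<ge> 0" "c4 \<ge> 0"
  shows "absv -` {(c1, c2, c3, c4)} = {c1, -c1} \<times> {c2, -c2} \<times> {c3, -c3} \<times> {c4, -c4}"
    (is "_ = ?S")
proof (rule set_eqI)
  fix x :: R4
  have *: "(\<bar>x\<bar> = c) = (x \<in> {c, - c})" if "c \<ge> 0" for x c :: real using that by auto
  obtain x1 x2 x3 x4 where x: "x = (x1, x2, x3, x4)" by (metis prod_cases4)
  show "x \<in> absv -` {(c1, c2, c3, c4)} \<longleftrightarrow> x \<in> ?S"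
    unfolding x vimage_eq absv_Pair singleton_iff prod.inject mem_Sigma_iff
      assms[THEN *] ..
qed

lemma finite_absv_vimage:
  assumes "finite P"
  shows "finite (absv -` P)"
proof -
  have "finite (absv -` {x} \<inter> UNIV)" for x
  proof -
    obtain x1 x2 x3 x4 where x: "x = (x1, x2, x3, x4)" by (metis prod_cases4)
    have "absv -` {x} \<subseteq> {x1, -x1} \<times> {x2, -x2} \<times> {x3, -x3} \<times> {x4, -x4}"
    proof
      fix y assume "y \<in> absv -` {x}"
      moreover obtain y1 y2 y3 y4 where y: "y = (y1, y2, y3, y4)" by (metis prod_cases4)
      ultimately have "y1 \<in> {x1, -x1}" "y2 \<in> {x2, -x2}" "y3 \<in> {x3, -x3}" "y4 \<in> {x4, -x4}"
        unfolding x y by auto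
      then show "y \<in> {x1, -x1} \<times> {x2, -x2} \<times> {x3, -x3} \<times> {x4, -x4}"
        unfolding y mem_Sigma_iff by blast
    qed
    then show ?thesis by (meson finite.intros finite_Int finite_SigmaI finite_subset)
  qed
  then show ?thesis using finite_finite_vimage_IntI[OF assms, of absv UNIV] by simp
qed

lemma card_absv_vimage_sum:
  assumes "finite P"
  shows "card (absv -` P) = (\<Sum>x\<in>P. card (absv -` {x}))"
proof -
  have "absv -` P = (\<Union>x\<in>P. absv -` {x})" by blast
  then show ?thesis
    using assms by (simp only:) (intro card_UN_disjoint, auto intro: finite_absv_vimage)
qed

lemma card_absv_vimage:
  assumes "c1 \<ge> 0" "c2 \<ge> 0" "c3 \<ge> 0" "c4 \<ge> 0"
  shows "card (absv -` {(c1, c2, c3, c4)}) =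
    (if c1 = 0 then 1 else 2) * (if c2 = 0 then 1 else 2) * (if c3 = 0 then 1 else 2) * (if c4 = 0 then 1 else 2)"
proof -
  have "card {c, - c} = (if c = 0 then 1 else 2)" for c :: real by auto
  then show ?thesis using assms by (simp only: absv_vimage card_cartesian_product mult.assoc)
qed

lemma card_QA: "card QA = 20" and finite_QA: "finite QA"
proof -
  show "card QA = 20"
    unfolding QA_def PA_def
    by (subst card_absv_vimage_sum, simp) (simp add: card_absv_vimage)
  show "finite QA" unfolding QA_def PA_def by (intro finite_absv_vimage) simp
qed

lemma card_QB: "card QB = 20" and finite_QB: "finite QB"
proof -
  show "card QB = 20"
    unfolding QB_def PB_def
    by (subst card_absv_vimage_sum, simp) (simp add: card_absv_vimage)
  show "finite QB" unfolding QB_def PB_def by (intro finite_absv_vimage) simp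
qed

lemma sgn_abs_eqI:
  fixes x y z :: real
  assumes "\<bar>x\<bar> = \<bar>y\<bar>" "x * z = \<bar>x\<bar> * \<bar>z\<bar>" "y * z = \<bar>y\<bar> * \<bar>z\<bar>" "x = 0 \<or> z \<noteq> 0"
  shows "x = y"
proof (cases "z = 0")
  case False
  then show ?thesis using assms by (metis mult_right_cancel)
qed (use assms in auto)

lemma mult_le_abs: "x * y \<le> \<bar>x\<bar> * \<bar>y :: real\<bar>"
  by (metis abs_ge_self abs_mult)

lemma inner_absv_le: "a \<bullet> z \<le> absv a \<bullet> absv z"
proof -
  obtain a1 a2 a3 a4 z1 z2 z3 z4 where "a = (a1, a2, a3, a4)" "z = (z1, z2, z3, z4)"
    by (metis prod_cases4)
  then show ?thesis
    using mult_le_abs[of a1 z1] mult_le_abs[of a2 z2] mult_le_abs[of a3 z3] mult_le_abs[of a4 z4]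
    by simp
qed

lemma inner_absv_eqD:
  assumes "(a1, a2, a3, a4) \<bullet> (z1, z2, z3, z4) = absv (a1, a2, a3, a4) \<bullet> absv (z1, z2, z3, z4)"
  shows "a1 * z1 = \<bar>a1\<bar> * \<bar>z1\<bar>" "a2 * z2 = \<bar>a2\<bar> * \<bar>z2\<bar>" "a3 * z3 = \<bar>a3\<bar> * \<bar>z3\<bar>" "a4 * z4 = \<bar>a4\<bar> * \<bar>z4\<bar>"
  using mult_le_abs[of a1 z1] mult_le_abs[of a2 z2] mult_le_abs[of a3 z3] mult_le_abs[of a4 z4] assms
  unfolding absv_Pair inner_Pair inner_real_def by linarith+

text \<open>All sign changes of \<open>\<pi>\<close> satisfy the hypothesis; the one whose signs
  agree with those of \<open>z\<close> turns every product into a product of absolute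
  values.\<close>

lemma le_inner_absv:
  assumes "\<And>a. absv a = \<pi> \<Longrightarrow> a \<bullet> z \<le> p" and "absv \<pi> = \<pi>"
  shows "\<pi> \<bullet> absv z \<le> p"
proof -
  obtain c1 c2 c3 c4 z1 z2 z3 z4 where c: "\<pi> = (c1, c2, c3, c4)" and z: "z = (z1, z2, z3, z4)"
    by (metis prod_cases4)
  define s :: "real \<Rightarrow> real" where "s x = (if x < 0 then - 1 else 1)" for x
  have s: "\<bar>s x\<bar> = 1" "s x * x = \<bar>x\<bar>" for x by (auto simp: s_def)
  have "(s z1 * c1, s z2 * c2, s z3 * c3, s z4 * c4) \<bullet> z \<le> p"
    using assms(2) by (intro assms(1)) (simp add: c abs_mult s)
  moreover have "s x * y * x = y * \<bar>x\<bar>" for x y by (metis s(2) mult.assoc mult.commute)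
  ultimately show ?thesis by (simp add: c z)
qed

text \<open>If every pattern attaining \<open>p\<close> avoids the zero coordinates of \<open>z\<close>, the signs of a vector
  attaining \<open>p\<close> are forced by those of \<open>z\<close>.\<close>

lemma absv_tie:
  assumes fin: "finite P" and P: "\<And>\<pi>. \<pi> \<in> P \<Longrightarrow> absv \<pi> = \<pi>"
    and le: "\<And>a. absv a \<in> P \<Longrightarrow> a \<bullet> z \<le> p"
    and supp: "\<And>c1 c2 c3 c4. (c1, c2, c3, c4) \<in> tie P (absv z) p \<Longrightarrow>
      (c1 = 0 \<or> fst z \<noteq> 0) \<and> (c2 = 0 \<or> fst (snd z) \<noteq> 0) \<and> (c3 = 0 \<or> fst (snd (snd z)) \<noteq> 0) \<and>
      (c4 = 0 \<or> snd (snd (snd z)) \<noteq> 0)"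
  shows "absv ` tie (absv -` P) z p \<subseteq> tie P (absv z) p" "inj_on absv (tie (absv -` P) z p)"
    "card (tie (absv -` P) z p) \<le> card (tie P (absv z) p)"
proof -
  have eq: "a \<bullet> z = absv a \<bullet> absv z" "absv a \<in> tie P (absv z) p" if "a \<in> tie (absv -` P) z p" for a
  proof -
    have "absv a \<in> P" "a \<bullet> z = p" using that by (auto simp: tie_def)
    moreover from this have "absv a \<bullet> absv z \<le> p"
      using P le by (intro le_inner_absv) auto
    ultimately show "a \<bullet> z = absv a \<bullet> absv z" "absv a \<in> tie P (absv z) p"
      using inner_absv_le[of a z] by (auto simp: tie_def)
  qed
  show sub: "absv ` tie (absv -` P) z p \<subseteq> tie P (absv z) p" using eq(2) by auto
  show inj: "inj_on absv (tie (absv -` P) z p)"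
  proof
    fix a b assume a: "a \<in> tie (absv -` P) z p" and b: "b \<in> tie (absv -` P) z p" and ab: "absv a = absv b"
    obtain a1 a2 a3 a4 b1 b2 b3 b4 z1 z2 z3 z4
      where v: "a = (a1, a2, a3, a4)" "b = (b1, b2, b3, b4)" "z = (z1, z2, z3, z4)"
      by (metis prod_cases4)
    note A = inner_absv_eqD[OF eq(1)[OF a, unfolded v]] and B = inner_absv_eqD[OF eq(1)[OF b, unfolded v]]
    have "(a1 = 0 \<or> z1 \<noteq> 0) \<and> (a2 = 0 \<or> z2 \<noteq> 0) \<and> (a3 = 0 \<or> z3 \<noteq> 0) \<and> (a4 = 0 \<or> z4 \<noteq> 0)"
      using supp[of "\<bar>a1\<bar>" "\<bar>a2\<bar>" "\<bar>a3\<bar>" "\<bar>a4\<bar>"] eq(2)[OF a] by (simp add: v)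
    then show "a = b"
      using ab sgn_abs_eqI[OF _ A(1) B(1)] sgn_abs_eqI[OF _ A(2) B(2)] sgn_abs_eqI[OF _ A(3) B(3)]
        sgn_abs_eqI[OF _ A(4) B(4)]
      by (simp add: v)
  qed
  have "finite (tie P (absv z) p)" using fin by (simp add: tie_def)
  then show "card (tie (absv -` P) z p) \<le> card (tie P (absv z) p)"
    by (metis card_image card_mono inj sub)
qed

lemma QA_leD:
  assumes "\<forall>a\<in>QA. a \<bullet> z \<le> p" "absv z = (w1, w2, w3, w4)" "z \<noteq> 0"
  shows "p > 0" "2*w1 \<le> p" "2*w2 \<le> p" "9*w3 \<le> p" "9*w4 \<le> p" "5*w3+5*w4 \<le> p" "w2+8*w3 \<le> p" "w1+8*w4 \<le> p"
proof -
  have "\<forall>\<pi>\<in>PA. \<pi> \<bullet> absv z \<le> p"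
    by (intro ballI le_inner_absv assms(1)[rule_format]) (auto simp: QA_def PA_def)
  then show *: "2*w1 \<le> p" "2*w2 \<le> p" "9*w3 \<le> p" "9*w4 \<le> p" "5*w3+5*w4 \<le> p" "w2+8*w3 \<le> p" "w1+8*w4 \<le> p"
    by (auto simp: PA_def assms(2))
  have "w1 \<ge> 0" "w2 \<ge> 0" "w3 \<ge> 0" "w4 \<ge> 0" "w1 \<noteq> 0 \<or> w2 \<noteq> 0 \<or> w3 \<noteq> 0 \<or> w4 \<noteq> 0"
    using assms(2,3) by (cases z; auto simp: zero_prod_def)+
  then show "p > 0" using * by linarith
qed

lemma QB_leD:
  assumes "\<forall>a\<in>QB. a \<bullet> z \<le> q" "absv z = (w1, w2, w3, w4)" "z \<noteq> 0"
  shows "q > 0" "2*w4 \<le> q" "2*w3 \<le> q" "9*w1 \<le> q" "9*w2 \<le> q" "5*w1+5*w2 \<le> q" "8*w1+w3 \<le> q" "8*w2+w4 \<le> q"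
proof -
  have "\<forall>\<pi>\<in>PB. \<pi> \<bullet> absv z \<le> q"
    by (intro ballI le_inner_absv assms(1)[rule_format]) (auto simp: QB_def PB_def)
  then show *: "2*w4 \<le> q" "2*w3 \<le> q" "9*w1 \<le> q" "9*w2 \<le> q" "5*w1+5*w2 \<le> q" "8*w1+w3 \<le> q" "8*w2+w4 \<le> q"
    by (auto simp: PB_def assms(2))
  have "w1 \<ge> 0" "w2 \<ge> 0" "w3 \<ge> 0" "w4 \<ge> 0" "w1 \<noteq> 0 \<or> w2 \<noteq> 0 \<or> w3 \<noteq> 0 \<or> w4 \<noteq> 0"
    using assms(2,3) by (cases z; auto simp: zero_prod_def)+
  then show "q > 0" using * by linarith
qed

text \<open>A pattern with two nonzero coordinates is dominated by a one-coordinate pattern as soon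
  as one of its weights vanishes: \<open>w1 + 8*w4 = p\<close> with \<open>w1 = 0\<close> would make
  \<open>9*w4\<close> exceed \<open>p\<close>, and with \<open>w4 = 0\<close> it would make
  \<open>2*w1\<close> exceed \<open>p\<close>. This is what makes the signs of an attaining normal
  determined by \<open>z\<close>.\<close>

lemma PA_support:
  assumes "(c1, c2, c3, c4) \<in> PA" "c1 * w1 + (c2 * w2 + (c3 * w3 + c4 * w4)) = p" "p > 0"
    "2*w1 \<le> p" "2*w2 \<le> p" "9*w3 \<le> p" "9*w4 \<le> p" "5*w3+5*w4 \<le> p" "w2+8*w3 \<le> p" "w1+8*w4 \<le> p"
  shows "(c1 = 0 \<or> w1 \<noteq> 0) \<and> (c2 = 0 \<or> w2 \<noteq> 0) \<and> (c3 = 0 \<or> w3 \<noteq> 0) \<and> (c4 = 0 \<or> w4 \<noteq> 0)"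
proof -
  have "\<forall>(c1, c2, c3, c4)\<in>PA. c1 * w1 + (c2 * w2 + (c3 * w3 + c4 * w4)) = p \<longrightarrow>
    (c1 = 0 \<or> w1 \<noteq> 0) \<and> (c2 = 0 \<or> w2 \<noteq> 0) \<and> (c3 = 0 \<or> w3 \<noteq> 0) \<and> (c4 = 0 \<or> w4 \<noteq> 0)"
    unfolding PA_def
    by (simp, intro conjI impI notI; use assms(3-) in linarith)
  then show ?thesis using assms(1,2) by blast
qed

lemma PB_support:
  assumes "(c1, c2, c3, c4) \<in> PB" "c1 * w1 + (c2 * w2 + (c3 * w3 + c4 * w4)) = p" "p > 0"
    "2*w4 \<le> p" "2*w3 \<le> p" "9*w1 \<le> p" "9*w2 \<le> p" "5*w1+5*w2 \<le> p" "8*w1+w3 \<le> p" "8*w2+w4 \<le> p"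
  shows "(c1 = 0 \<or> w1 \<noteq> 0) \<and> (c2 = 0 \<or> w2 \<noteq> 0) \<and> (c3 = 0 \<or> w3 \<noteq> 0) \<and> (c4 = 0 \<or> w4 \<noteq> 0)"
proof -
  have "\<forall>(c1, c2, c3, c4)\<in>PB. c1 * w1 + (c2 * w2 + (c3 * w3 + c4 * w4)) = p \<longrightarrow>
    (c1 = 0 \<or> w1 \<noteq> 0) \<and> (c2 = 0 \<or> w2 \<noteq> 0) \<and> (c3 = 0 \<or> w3 \<noteq> 0) \<and> (c4 = 0 \<or> w4 \<noteq> 0)"
    unfolding PB_def
    by (simp, intro conjI impI notI; use assms(3-) in linarith)
  then show ?thesis using assms(1,2) by blast
qed

lemma tie_QA:
  assumes "\<forall>a\<in>QA. a \<bullet> z \<le> p" "z \<noteq> 0"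
  shows "absv ` tie QA z p \<subseteq> tie PA (absv z) p" "card (tie QA z p) \<le> card (tie PA (absv z) p)"
proof -
  obtain z1 z2 z3 z4 where z: "z = (z1, z2, z3, z4)" by (metis prod_cases4)
  note le = QA_leD[OF assms(1) _ assms(2), unfolded z absv_Pair, OF refl]
  have "(c1 = 0 \<or> z1 \<noteq> 0) \<and> (c2 = 0 \<or> z2 \<noteq> 0) \<and> (c3 = 0 \<or> z3 \<noteq> 0) \<and> (c4 = 0 \<or> z4 \<noteq> 0)"
    if "(c1, c2, c3, c4) \<in> tie PA (absv z) p" for c1 c2 c3 c4
  proof -
    have "(c1, c2, c3, c4) \<in> PA" and eq: "c1 * \<bar>z1\<bar> + (c2 * \<bar>z2\<bar> + (c3 * \<bar>z3\<bar> + c4 * \<bar>z4\<bar>)) = p"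
      using that by (simp_all add: tie_def z)
    have "(c1 = 0 \<or> \<bar>z1\<bar> \<noteq> 0) \<and> (c2 = 0 \<or> \<bar>z2\<bar> \<noteq> 0) \<and> (c3 = 0 \<or> \<bar>z3\<bar> \<noteq> 0) \<and> (c4 = 0 \<or> \<bar>z4\<bar> \<noteq> 0)"
      using PA_support[OF \<open>(c1, c2, c3, c4) \<in> PA\<close> eq] le by simp
    then show ?thesis by simp
  qed
  then have supp: "(c1 = 0 \<or> fst z \<noteq> 0) \<and> (c2 = 0 \<or> fst (snd z) \<noteq> 0) \<and>
      (c3 = 0 \<or> fst (snd (snd z)) \<noteq> 0) \<and> (c4 = 0 \<or> snd (snd (snd z)) \<noteq> 0)"
    if "(c1, c2, c3, c4) \<in> tie PA (absv z) p" for c1 c2 c3 c4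
    using that by (simp only: z fst_conv snd_conv)
  have abs: "absv \<pi> = \<pi>" if "\<pi> \<in> PA" for \<pi>
    using that by (auto simp: PA_def)
  have le': "a \<bullet> z \<le> p" if "absv a \<in> PA" for a using that assms(1) by (simp add: QA_def)
  have "finite PA" by (simp add: PA_def)
  from absv_tie(1,3)[OF this abs le' supp]
  show "absv ` tie QA z p \<subseteq> tie PA (absv z) p" "card (tie QA z p) \<le> card (tie PA (absv z) p)"
    by (simp_all only: QA_def)
qed

lemma tie_QB:
  assumes "\<forall>a\<in>QB. a \<bullet> z \<le> p" "z \<noteq> 0"
  shows "absv ` tie QB z p \<subseteq> tie PB (absv z) p" "card (tie QB z p) \<le> card (tie PB (absv z) p)"
proof -
  obtain z1 z2 z3 z4 where z: "z = (z1, z2, z3, z4)" by (metis prod_cases4)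
  note le = QB_leD[OF assms(1) _ assms(2), unfolded z absv_Pair, OF refl]
  have "(c1 = 0 \<or> z1 \<noteq> 0) \<and> (c2 = 0 \<or> z2 \<noteq> 0) \<and> (c3 = 0 \<or> z3 \<noteq> 0) \<and> (c4 = 0 \<or> z4 \<noteq> 0)"
    if "(c1, c2, c3, c4) \<in> tie PB (absv z) p" for c1 c2 c3 c4
  proof -
    have "(c1, c2, c3, c4) \<in> PB" and eq: "c1 * \<bar>z1\<bar> + (c2 * \<bar>z2\<bar> + (c3 * \<bar>z3\<bar> + c4 * \<bar>z4\<bar>)) = p"
      using that by (simp_all add: tie_def z)
    have "(c1 = 0 \<or> \<bar>z1\<bar> \<noteq> 0) \<and> (c2 = 0 \<or> \<bar>z2\<bar> \<noteq> 0) \<and> (c3 = 0 \<or> \<bar>z3\<bar> \<noteq> 0) \<and> (c4 = 0 \<or> \<bar>z4\<bar> \<noteq> 0)"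
      using PB_support[OF \<open>(c1, c2, c3, c4) \<in> PB\<close> eq] le by simp
    then show ?thesis by simp
  qed
  then have supp: "(c1 = 0 \<or> fst z \<noteq> 0) \<and> (c2 = 0 \<or> fst (snd z) \<noteq> 0) \<and>
      (c3 = 0 \<or> fst (snd (snd z)) \<noteq> 0) \<and> (c4 = 0 \<or> snd (snd (snd z)) \<noteq> 0)"
    if "(c1, c2, c3, c4) \<in> tie PB (absv z) p" for c1 c2 c3 c4
    using that by (simp only: z fst_conv snd_conv)
  have abs: "absv \<pi> = \<pi>" if "\<pi> \<in> PB" for \<pi>
    using that by (auto simp: PB_def)
  have le': "a \<bullet> z \<le> p" if "absv a \<in> PB" for a using that assms(1) by (simp add: QB_def)
  have "finite PB" by (simp add: PB_def)
  from absv_tie(1,3)[OF this abs le' supp]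
  show "absv ` tie QB z p \<subseteq> tie PB (absv z) p" "card (tie QB z p) \<le> card (tie PB (absv z) p)"
    by (simp_all only: QB_def)
qed

lemma tie_insert:
  "tie {} w p = {}" "tie (insert a Q) w p = (if a \<bullet> w = p then insert a (tie Q w p) else tie Q w p)"
  by (auto simp: tie_def)

lemma card_tie_insert:
  assumes "finite Q" "a \<notin> Q"
  shows "card (tie (insert a Q) w p) = of_bool (a \<bullet> w = p) + card (tie Q w p)"
  using assms by (simp add: tie_insert) (simp add: tie_def)

lemma card_tie_PA:
  "card (tie PA (w1, w2, w3, w4) p) = of_bool (2*w1 = p) + of_bool (2*w2 = p) + of_bool (9*w3 = p) + of_bool (9*w4 = p) + of_bool (5*w3+5*w4 = p) + of_bool (w2+8*w3 = p) + of_bool (w1+8*w4 = p)"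
  unfolding PA_def by (simp add: card_tie_insert tie_insert(1) add_ac)

lemma card_tie_PB:
  "card (tie PB (w1, w2, w3, w4) p) = of_bool (2*w4 = p) + of_bool (2*w3 = p) + of_bool (9*w1 = p) + of_bool (9*w2 = p) + of_bool (5*w1+5*w2 = p) + of_bool (8*w1+w3 = p) + of_bool (8*w2+w4 = p)"
  unfolding PB_def by (simp add: card_tie_insert tie_insert(1) add_ac)

lemma tie_pattern_direction:
  assumes A: "\<forall>a\<in>QA. a \<bullet> z \<le> p" and B: "\<forall>b\<in>QB. b \<bullet> z \<le> q"
    and z: "z \<noteq> 0" and w: "absv z = (w1, w2, w3, w4)"
  shows "tie_pattern (2*w1 = p) (2*w2 = p) (9*w3 = p) (9*w4 = p) (5*w3+5*w4 = p) (w2+8*w3 = p) (w1+8*w4 = p) (2*w4 = q) (2*w3 = q) (9*w1 = q) (9*w2 = q) (5*w1+5*w2 = q) (8*w1+w3 = q) (8*w2+w4 = q)"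
proof -
  have "w1 \<ge> 0" "w2 \<ge> 0" "w3 \<ge> 0" "w4 \<ge> 0" using w by (cases z; auto)+
  then show ?thesis
    by (rule tie_pattern_weights) (rule QA_leD[OF A w z] QB_leD[OF B w z])+
qed

text \<open>A genericity property: off the two apexes, where \<open>z = 0\<close>, no point of the
  5-dimensional polytope lies on more than five facets, so all other vertices are simple.\<close>

lemma card_tie_le:
  assumes A: "\<forall>a\<in>QA. a \<bullet> z \<le> p" and B: "\<forall>b\<in>QB. b \<bullet> z \<le> q" and z: "z \<noteq> 0"
  shows "card (tie QA z p) + card (tie QB z q) \<le> 5"
proof -
  obtain w1 w2 w3 w4 where w: "absv z = (w1, w2, w3, w4)" by (metis prod_cases4)
  have "card (tie PA (absv z) p) + card (tie PB (absv z) q) \<le> 5"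
    unfolding w card_tie_PA card_tie_PB
    using tie_pattern.tie_sum[OF tie_pattern_direction[OF A B z w]] by (simp add: add_ac)
  then show ?thesis using tie_QA(2)[OF A z] tie_QB(2)[OF B z] by linarith
qed

text \<open>Four \<open>A\<close>-ties at \<open>z\<close> leave only the patterns
  \<open>B2\<close>, \<open>B3\<close>, \<open>B4\<close> for \<open>b\<close>, and four
  \<open>B\<close>-ties at \<open>z'\<close> leave only \<open>A2\<close>, \<open>A3\<close>,
  \<open>A4\<close> for \<open>a\<close>. Each of the nine remaining combinations is impossible at
  \<open>z\<close> or at \<open>z'\<close>; neither point alone rules out all of them.\<close>

lemma no_short_chain:
  assumes A: "\<forall>a\<in>QA. a \<bullet> z \<le> p" and B: "\<forall>b\<in>QB. b \<bullet> z \<le> q" and z: "z \<noteq> 0"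
    and A': "\<forall>a\<in>QA. a \<bullet> z' \<le> p'" and B': "\<forall>b\<in>QB. b \<bullet> z' \<le> q'" and z': "z' \<noteq> 0"
    and four: "card (tie QA z p) \<ge> 4" "card (tie QB z' q') \<ge> 4"
    and a: "a \<in> tie QA z p" "a \<in> tie QA z' p'" and b: "b \<in> tie QB z q" "b \<in> tie QB z' q'"
  shows False
proof -
  obtain w1 w2 w3 w4 where w: "absv z = (w1, w2, w3, w4)" by (metis prod_cases4)
  obtain v1 v2 v3 v4 where v: "absv z' = (v1, v2, v3, v4)" by (metis prod_cases4)
  have "card (tie PA (absv z) p) \<ge> 4" "card (tie PB (absv z') q') \<ge> 4"
    using four tie_QA(2)[OF A z] tie_QB(2)[OF B' z'] by linarith+
  note F = tie_pattern.four_A[OF tie_pattern_direction[OF A B z w] this(1)[unfolded w card_tie_PA]]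
    and G = tie_pattern.four_B[OF tie_pattern_direction[OF A' B' z' v] this(2)[unfolded v card_tie_PB]]
  have "absv a \<in> tie PA (absv z) p" "absv a \<in> tie PA (absv z') p'"
      "absv b \<in> tie PB (absv z) q" "absv b \<in> tie PB (absv z') q'"
    using a b tie_QA(1)[OF A z] tie_QA(1)[OF A' z'] tie_QB(1)[OF B z] tie_QB(1)[OF B' z'] by blast+
  moreover have "absv b \<in> {(9,0,0,0), (0,9,0,0), (5,5,0,0)}"
    using calculation(3) F(1-4) by (auto simp: tie_def PB_def w)
  moreover have "absv a \<in> {(0,0,9,0), (0,0,0,9), (0,0,5,5)}"
    using calculation(2) G(1-4) by (auto simp: tie_def PA_def v)
  ultimately show False
    using F(5-7) G(5-6) by (auto simp: tie_def w v)
qed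

section \<open>Chains of cones\<close>

lemma linear_inj_imp_surj:
  fixes f :: "'a::euclidean_space \<Rightarrow> 'b::euclidean_space"
  assumes f: "linear f" "\<And>x. f x = 0 \<Longrightarrow> x = 0" and dim: "DIM('a) = DIM('b)"
  shows "surj f"
proof -
  have "inj f" using f linear_injective_0 by blast
  then have "dim (range f) = DIM('b)"
    using dim_image_eq[OF f(1), of UNIV] dim by simp
  then show ?thesis
    using dim_eq_full[of "range f"] linear_subspace_image[OF f(1) subspace_UNIV] by (metis span_eq_iff)
qed

definition hcone :: "(nat \<times> 'i \<Rightarrow> 'v \<Rightarrow> real) \<Rightarrow> nat \<Rightarrow> 'v set" where
  "hcone l K = {X. \<forall>\<kappa>\<le>K. \<forall>i. 0 \<le> l (\<kappa>, i) X}"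

definition tight :: "(nat \<times> 'i \<Rightarrow> 'v \<Rightarrow> real) \<Rightarrow> nat \<Rightarrow> 'v \<Rightarrow> (nat \<times> 'i) set" where
  "tight l K X = {(\<kappa>, i). \<kappa> \<le> K \<and> l (\<kappa>, i) X = 0}"

definition layer :: "nat \<Rightarrow> (nat \<times> 'i) set" where
  "layer \<kappa> = {\<kappa>} \<times> UNIV"

text \<open>Vertices are recorded by their tight sets only. Linear changes of coordinates and
  regluing move the points but not these sets, so a potential defined on them survives both.\<close>

definition nodes :: "(nat \<times> 'i::finite \<Rightarrow> 'v::zero \<Rightarrow> real) \<Rightarrow> nat \<Rightarrow> (nat \<times> 'i) set set" where
  "nodes l K = {T. card T = CARD('i) \<and> (\<exists>X\<in>hcone l K. X \<noteq> 0 \<and> tight l K X = T)}"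

text \<open>The facets come in \<open>K + 1\<close> layers of \<open>CARD('i)\<close> each; the
  simple vertices \<open>u\<close> and \<open>v\<close> are cut out by the first and the last layer.
  The potential \<open>f\<close> certifies that they are at distance at least \<open>L\<close>:
  \<open>lip\<close> is required for all nodes sharing all but one facet, which covers every edge
  without constructing any. The assumptions \<open>facet\<close> and \<open>interior\<close> make
  every inequality a genuine facet.\<close>

locale chain =
  fixes l :: "nat \<times> 'i::finite \<Rightarrow> 'v::euclidean_space \<Rightarrow> real" and K L :: nat
    and f :: "(nat \<times> 'i) set \<Rightarrow> nat" and u v :: 'v
  assumes lin: "\<And>j. linear (l j)"
    and dim: "DIM('v) = CARD('i) + 1"
    and K: "K \<ge> 1"
    and simple: "\<And>X. X \<in> hcone l K \<Longrightarrow> X \<noteq> 0 \<Longrightarrow> card (tight l K X) \<le> CARD('i)"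
    and facet: "\<And>\<kappa> i. \<kappa> \<le> K \<Longrightarrow> \<exists>X\<in>hcone l K. tight l K X = {(\<kappa>, i)}"
    and interior: "\<exists>X\<in>hcone l K. tight l K X = {}"
    and u: "u \<in> hcone l K" "tight l K u = layer 0"
    and v: "v \<in> hcone l K" "tight l K v = layer K"
    and ker: "\<And>X. (\<forall>i. l (K, i) X = 0) \<Longrightarrow> X \<in> span {v}"
    and ker_u: "\<And>X. (\<forall>i. l (0, i) X = 0) \<Longrightarrow> X \<in> span {u}"
    and lip: "\<And>T T'. T \<in> nodes l K \<Longrightarrow> T' \<in> nodes l K \<Longrightarrow> CARD('i) \<le> card (T \<inter> T') + 1 \<Longrightarrow> f T \<le> f T' + 1"
    and f_le: "\<And>T. T \<in> nodes l K \<Longrightarrow> f T \<le> L"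
    and f_ends: "f (layer 0) = 0" "f (layer K) = L"

lemma finite_tight: "finite (tight l K (X :: 'v) :: (nat \<times> 'i::finite) set)"
proof (rule finite_subset)
  show "tight l K X \<subseteq> {..K} \<times> UNIV" by (auto simp: tight_def)
qed simp

lemma card_layer [simp]: "card (layer \<kappa> :: (nat \<times> 'i::finite) set) = CARD('i)"
  by (simp add: layer_def card_cartesian_product)

section \<open>Coordinates at a simple apex\<close>

definition hgt :: "'v::real_inner \<Rightarrow> 'v \<Rightarrow> real" where
  "hgt v X = (X \<bullet> v) / (v \<bullet> v)"

lemma linear_hgt: "linear (hgt v)"
  by (auto simp: hgt_def[abs_def] intro!: linearI simp: inner_add_left add_divide_distrib)

lemma hgt_self: "v \<noteq> 0 \<Longrightarrow> hgt v v = 1"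
  by (simp add: hgt_def)

lemma chart:
  fixes l :: "'i::finite \<Rightarrow> 'v::euclidean_space \<Rightarrow> real"
  assumes lin: "\<And>i. linear (l i)" and dim: "DIM('v) = CARD('i) + 1"
    and v: "v \<noteq> 0" "\<And>i. l i v = 0" and ker: "\<And>X. (\<forall>i. l i X = 0) \<Longrightarrow> X \<in> span {v}"
  obtains \<Phi> :: "'v \<Rightarrow> (real^'i) \<times> real" and \<psi>
  where "linear \<Phi>" "linear \<psi>" "\<And>X. \<Phi> X = ((\<chi> i. l i X), hgt v X)" "\<And>X. \<psi> (\<Phi> X) = X" "\<And>y. \<Phi> (\<psi> y) = y"
proof -
  define \<Phi> :: "'v \<Rightarrow> (real^'i) \<times> real" where "\<Phi> X = ((\<chi> i. l i X), hgt v X)" for X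
  have lin\<Phi>: "linear \<Phi>"
    using lin linear_hgt[of v] unfolding \<Phi>_def[abs_def]
    by (intro linearI) (simp_all add: linear_add linear_scale vec_eq_iff)
  have inj: "inj \<Phi>"
  proof (subst linear_injective_0[OF lin\<Phi>], intro allI impI)
    fix X assume "\<Phi> X = 0"
    then have *: "\<forall>i. l i X = 0" "hgt v X = 0" by (auto simp: \<Phi>_def zero_prod_def vec_eq_iff)
    then obtain c where "X = c *\<^sub>R v" using ker[OF *(1)] by (auto simp: span_singleton)
    then show "X = 0" using *(2) v(1) linear_scale[OF linear_hgt, of v c v] by (simp add: hgt_self)
  qed
  have "dim (range \<Phi>) = DIM((real^'i) \<times> real)"
    using dim_image_eq[OF lin\<Phi>, of UNIV] inj dim by simp
  then have "surj \<Phi>"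
    using dim_eq_full[of "range \<Phi>"] linear_subspace_image[OF lin\<Phi> subspace_UNIV] by (metis span_eq_iff)
  obtain \<psi> where \<psi>: "linear \<psi>" "\<Phi> \<circ> \<psi> = id"
    using linear_surjective_right_inverse[OF lin\<Phi> \<open>surj \<Phi>\<close>] by blast
  have "\<psi> (\<Phi> X) = X" for X
    using \<psi>(2) inj by (metis comp_apply id_apply injD)
  with \<psi> lin\<Phi> show ?thesis by (intro that[of \<Phi> \<psi>]) (auto simp: \<Phi>_def fun_eq_iff)
qed

text \<open>Close to the apex \<open>v\<close> only its own facets matter. In the chart,
  \<open>X\<close> is \<open>hgt v X\<close> times \<open>v\<close> plus a vector whose size is
  controlled by the sum of the \<open>l i X\<close>; once the height dominates that sum, the
  positive value of \<open>h j\<close> at \<open>v\<close> decides its sign at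
  \<open>X\<close>.\<close>

lemma cap:
  fixes l :: "'i::finite \<Rightarrow> 'v::euclidean_space \<Rightarrow> real" and h :: "'j \<Rightarrow> 'v \<Rightarrow> real"
  assumes lin: "\<And>i. linear (l i)" and dim: "DIM('v) = CARD('i) + 1"
    and v: "v \<noteq> 0" "\<And>i. l i v = 0" and ker: "\<And>X. (\<forall>i. l i X = 0) \<Longrightarrow> X \<in> span {v}"
    and fin: "finite J" and h: "\<And>j. j \<in> J \<Longrightarrow> linear (h j)" "\<And>j. j \<in> J \<Longrightarrow> h j v > 0"
  obtains C where "C \<ge> 0"
    "\<And>X j. (\<And>i. 0 \<le> l i X) \<Longrightarrow> C * (\<Sum>i\<in>UNIV. l i X) < hgt v X \<Longrightarrow> j \<in> J \<Longrightarrow> h j X > 0"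
proof -
  obtain \<Phi> :: "'v \<Rightarrow> (real^'i) \<times> real" and \<psi> where \<Phi>: "linear \<Phi>" "linear \<psi>" "\<And>X. \<Phi> X = ((\<chi> i. l i X), hgt v X)"
      "\<And>X. \<psi> (\<Phi> X) = X" "\<And>y. \<Phi> (\<psi> y) = y"
    by (rule chart[of l v, OF lin dim v(1) v(2) ker]) auto
  have "\<Phi> v = (0, 1)" using v by (simp add: \<Phi>(3) hgt_self vec_eq_iff)
  then have \<psi>v: "\<psi> (0, 1) = v" using \<Phi>(4) by metis
  have "\<exists>B\<ge>0. \<forall>s. \<bar>h j (\<psi> (s, 0))\<bar> \<le> B * norm s" if "j \<in> J" for j
  proof -
    have "linear (\<lambda>s. h j (\<psi> (s, 0)))"
      using linear_compose[OF linear_compose[OF _ \<Phi>(2)] h(1)[OF that], of "\<lambda>s. (s, 0)"]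
      by (simp add: comp_def linearI)
    then obtain B where "B > 0" "\<And>s. norm (h j (\<psi> (s, 0))) \<le> B * norm s"
      using linear_bounded_pos by blast
    then show ?thesis by (intro exI[of _ B]) simp
  qed
  then obtain B where B: "\<And>j. j \<in> J \<Longrightarrow> B j \<ge> 0" "\<And>j s. j \<in> J \<Longrightarrow> \<bar>h j (\<psi> (s, 0))\<bar> \<le> B j * norm s"
    by metis
  define C where "C = (\<Sum>j\<in>J. B j / h j v)"
  have pos: "0 \<le> B j / h j v" if "j \<in> J" for j using B(1)[OF that] h(2)[OF that] by simp
  have "C \<ge> 0" unfolding C_def by (intro sum_nonneg pos)
  moreover have "h j X > 0" if l: "\<And>i. 0 \<le> l i X" and X: "C * (\<Sum>i\<in>UNIV. l i X) < hgt v X" and j: "j \<in> J" for X j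
  proof -
    define s :: "real^'i" where "s = (\<chi> i. l i X)"
    have "(s, hgt v X) = (s, 0) + hgt v X *\<^sub>R (0, 1)" by simp
    then have "X = \<psi> (s, 0) + hgt v X *\<^sub>R v"
      using \<Phi>(3,4)[of X] linear_add[OF \<Phi>(2)] linear_scale[OF \<Phi>(2)] \<psi>v by (metis s_def)
    then have hX: "h j X = h j (\<psi> (s, 0)) + hgt v X * h j v"
      using linear_add[OF h(1)[OF j]] linear_scale[OF h(1)[OF j]] by (metis real_scaleR_def)
    have "norm s \<le> (\<Sum>i\<in>UNIV. l i X)"
      using norm_le_l1_cart[of s] l by (simp add: s_def)
    then have "\<bar>h j (\<psi> (s, 0))\<bar> \<le> B j * (\<Sum>i\<in>UNIV. l i X)"
      using B[OF j] by (meson mult_left_mono order_trans)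
    also have "\<dots> = (B j / h j v) * (\<Sum>i\<in>UNIV. l i X) * h j v" using h(2)[OF j] by simp
    also have "\<dots> \<le> C * (\<Sum>i\<in>UNIV. l i X) * h j v"
      using pos h(2)[OF j] l j fin unfolding C_def
      by (intro mult_right_mono member_le_sum sum_nonneg) auto
    also have "\<dots> < hgt v X * h j v" using X h(2)[OF j] by simp
    finally show ?thesis using hX by linarith
  qed
  ultimately show ?thesis by (rule that)
qed

text \<open>In the coordinates \<open>(l, hgt)\<close> the apex \<open>v\<close> is the vertical direction; the transition map
  turns the apex \<open>a\<close> upside down and puts it at height \<open>M\<close> above \<open>v\<close>.\<close>

lemma transition:
  fixes l m :: "'i::finite \<Rightarrow> 'v::euclidean_space \<Rightarrow> real"
  assumes "\<And>i. linear (l i)" "\<And>i. linear (m i)" and dim: "DIM('v) = CARD('i) + 1"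
    and "v \<noteq> 0" "\<And>i. l i v = 0" "\<And>X. (\<forall>i. l i X = 0) \<Longrightarrow> X \<in> span {v}"
    and "a \<noteq> 0" "\<And>i. m i a = 0" "\<And>X. (\<forall>i. m i X = 0) \<Longrightarrow> X \<in> span {a}"
  obtains \<phi> where "linear \<phi>" "bij \<phi>" "\<And>X i. m i (\<phi> X) = l i X"
    "\<And>X. hgt a (\<phi> X) = M * (\<Sum>i\<in>UNIV. l i X) - hgt v X"
proof -
  obtain \<Phi> :: "'v \<Rightarrow> (real^'i) \<times> real" and \<psi> where \<Phi>: "linear \<Phi>" "linear \<psi>" "\<And>X. \<Phi> X = ((\<chi> i. l i X), hgt v X)"
      "\<And>X. \<psi> (\<Phi> X) = X" "\<And>y. \<Phi> (\<psi> y) = y"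
    by (rule chart[of l v, OF assms(1) dim assms(4,5,6)]) auto
  obtain \<Phi>' :: "'v \<Rightarrow> (real^'i) \<times> real" and \<psi>' where \<Phi>': "linear \<Phi>'" "linear \<psi>'" "\<And>X. \<Phi>' X = ((\<chi> i. m i X), hgt a X)"
      "\<And>X. \<psi>' (\<Phi>' X) = X" "\<And>y. \<Phi>' (\<psi>' y) = y"
    by (rule chart[of m a, OF assms(2) dim assms(7,8,9)]) auto
  define \<theta> :: "(real^'i) \<times> real \<Rightarrow> (real^'i) \<times> real" where "\<theta> = (\<lambda>(s, t). (s, M * (\<Sum>i\<in>UNIV. s $ i) - t))"
  have "linear \<theta>"
    by (auto simp: \<theta>_def intro!: linearI simp: sum.distrib algebra_simps sum_distrib_left)
  define \<phi> where "\<phi> = \<psi>' \<circ> (\<theta> \<circ> \<Phi>)"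
  have lin: "linear \<phi>"
    unfolding \<phi>_def by (intro linear_compose \<Phi> \<Phi>' \<open>linear \<theta>\<close>)
  have "\<Phi>' (\<phi> X) = \<theta> (\<Phi> X)" for X by (simp only: \<phi>_def comp_apply \<Phi>'(5))
  then have *: "m i (\<phi> X) = l i X" "hgt a (\<phi> X) = M * (\<Sum>i\<in>UNIV. l i X) - hgt v X" for X i
    unfolding \<Phi>'(3) \<Phi>(3) \<theta>_def by (auto simp: vec_eq_iff)
  have "inj \<phi>"
  proof (subst linear_injective_0[OF lin], intro allI impI)
    fix X assume "\<phi> X = 0"
    then have "l i X = 0" for i using *(1)[of i X] linear_0[OF assms(2)] by simp
    moreover from this have "hgt v X = 0"
      using *(2)[of X] \<open>\<phi> X = 0\<close> linear_0[OF linear_hgt, of a] by simp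
    ultimately have "\<Phi> X = 0" by (simp add: \<Phi>(3) zero_prod_def vec_eq_iff)
    then show "X = 0" using \<Phi>(4)[of X] linear_0[OF \<Phi>(2)] by simp
  qed
  then have "bij \<phi>" using linear_injective_imp_surjective[OF lin] by (simp add: bij_def)
  with lin * show ?thesis by (intro that[of \<phi>])
qed

context chain
begin

lemma tight_subset: "tight l K X \<subseteq> {..K} \<times> UNIV"
  by (auto simp: tight_def)

lemma layer_nonzero: "\<kappa> \<le> K \<Longrightarrow> tight l K w = layer \<kappa>' \<Longrightarrow> \<kappa> \<noteq> \<kappa>' \<Longrightarrow> l (\<kappa>, i) w \<noteq> 0"
  by (auto simp: tight_def layer_def set_eq_iff)

lemma v_zero: "l (K, i) v = 0" and v_pos: "\<kappa> < K \<Longrightarrow> l (\<kappa>, i) v > 0"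
  and u_zero: "l (0, i) u = 0" and u_pos: "0 < \<kappa> \<Longrightarrow> \<kappa> \<le> K \<Longrightarrow> l (\<kappa>, i) u > 0"
proof -
  show "l (K, i) v = 0" using v(2) by (auto simp: tight_def layer_def set_eq_iff)
  show "l (0, i) u = 0" using u(2) by (auto simp: tight_def layer_def set_eq_iff)
  show "l (\<kappa>, i) v > 0" if "\<kappa> < K"
    using layer_nonzero[OF _ v(2), of \<kappa> i] that v(1) less_imp_le[OF that]
    unfolding hcone_def by (metis (mono_tags, lifting) less_le mem_Collect_eq nat_less_le)
  show "l (\<kappa>, i) u > 0" if "0 < \<kappa>" "\<kappa> \<le> K"
    using layer_nonzero[OF that(2) u(2), of i] that u(1)
    unfolding hcone_def by (metis (mono_tags, lifting) less_le mem_Collect_eq)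
qed

lemma v_nonzero: "v \<noteq> 0"
  using v_pos[of 0] K linear_0[OF lin] by (metis less_irrefl less_le_trans zero_less_one)

lemma u_nonzero: "u \<noteq> 0"
  using u_pos[of K] K linear_0[OF lin] by (metis less_irrefl less_le_trans order_refl zero_less_one)

lemma u_node: "layer 0 \<in> nodes l K" and v_node: "layer K \<in> nodes l K"
  using u v u_nonzero v_nonzero by (auto simp: nodes_def)

end

section \<open>Gluing a chain and a spindle at simple apexes\<close>

definition shift_by :: "nat \<Rightarrow> nat \<times> 'i \<Rightarrow> nat \<times> 'i" where
  "shift_by K = (\<lambda>(\<kappa>, i). (K + \<kappa>, i))"

lemma inj_shift_by: "inj (shift_by K)"
  by (auto simp: shift_by_def inj_def)

text \<open>A connected sum at the simple vertices \<open>v\<close> and \<open>a\<close>. The map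
  \<open>\<phi>\<close> identifies the facets of \<open>R\<close> at \<open>v\<close> with those of
  \<open>P\<close> at \<open>a\<close>, so these merge into one layer and only the layer
  \<open>m (1, i)\<close> is new. Intersecting the two cones then cuts off both apexes.\<close>

locale glue = R: chain l K L f u v + P: chain m 1 M g a b
  for l m :: "nat \<times> 'i::finite \<Rightarrow> 'v::euclidean_space \<Rightarrow> real" and K L f u v M g a b +
  fixes C1 C2 :: real and \<phi> :: "'v \<Rightarrow> 'v"
  assumes LM: "L \<ge> 1" "M \<ge> 1" and two: "CARD('i) \<ge> 2"
    and C: "C1 \<ge> 0" "C2 \<ge> 0"
    and capR: "\<And>X \<kappa> i. (\<And>i. 0 \<le> l (K, i) X) \<Longrightarrow> C1 * (\<Sum>i\<in>UNIV. l (K, i) X) < hgt v X \<Longrightarrow> \<kappa> < K \<Longrightarrow> l (\<kappa>, i) X > 0"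
    and capP: "\<And>X i. (\<And>i. 0 \<le> m (0, i) X) \<Longrightarrow> C2 * (\<Sum>i\<in>UNIV. m (0, i) X) < hgt a X \<Longrightarrow> m (1, i) X > 0"
    and \<phi>: "linear \<phi>" "bij \<phi>" "\<And>X i. m (0, i) (\<phi> X) = l (K, i) X"
      "\<And>X. hgt a (\<phi> X) = (C1 + C2 + 1) * (\<Sum>i\<in>UNIV. l (K, i) X) - hgt v X"
begin

definition l' :: "nat \<times> 'i \<Rightarrow> 'v \<Rightarrow> real" where
  "l' = (\<lambda>(\<kappa>, i). if \<kappa> \<le> K then l (\<kappa>, i) else m (1, i) \<circ> \<phi>)"

text \<open>The offset is \<open>L - 1\<close> and not \<open>L\<close> because \<open>v\<close> and
  \<open>a\<close> disappear: neighbours of \<open>v\<close> have potential at least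
  \<open>L - 1\<close>, neighbours of \<open>a\<close> have \<open>g\<close> at most 1, and edges
  across the seam join such neighbours.\<close>

definition f' :: "(nat \<times> 'i) set \<Rightarrow> nat" where
  "f' T = (if \<exists>i. (Suc K, i) \<in> T then L - 1 + g (shift_by K -` T) else f T)"

definition \<sigma> :: "'v \<Rightarrow> real" where "\<sigma> X = (\<Sum>i\<in>UNIV. l (K, i) X)"

text \<open>The cut separating the two pieces. Above it, \<open>capR\<close> makes the old layers
  below \<open>K\<close> inactive. On or below it, the height over \<open>a\<close> is at least
  \<open>C2 + 1\<close> times \<open>\<sigma> X\<close>, so \<open>capP\<close> makes the new layer
  inactive; the summand 1 in \<open>C1 + C2 + 1\<close> provides the strictness.\<close>

definition low :: "'v \<Rightarrow> bool" where "low X \<longleftrightarrow> hgt v X \<le> C1 * \<sigma> X"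

lemma l'_simps: "\<kappa> \<le> K \<Longrightarrow> l' (\<kappa>, i) = l (\<kappa>, i)" "l' (Suc K, i) X = m (1, i) (\<phi> X)"
  by (simp_all add: l'_def)

lemma low_pos:
  assumes "\<And>i. 0 \<le> l (K, i) X" "\<sigma> X > 0" "low X"
  shows "m (1, i) (\<phi> X) > 0"
proof -
  have "C2 * \<sigma> X < hgt a (\<phi> X)"
    using assms(2,3) by (simp add: \<phi>(4) \<sigma>_def[symmetric] low_def algebra_simps)
  then show ?thesis
    using assms(1) by (intro capP) (simp_all add: \<phi>(3) \<sigma>_def)
qed

lemma high_pos:
  assumes "\<And>i. 0 \<le> l (K, i) X" "\<not> low X" "\<kappa> < K"
  shows "l (\<kappa>, i) X > 0"
  using assms by (intro capR) (simp_all add: low_def \<sigma>_def)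

lemma \<sigma>_pos_iff:
  assumes "\<And>i. 0 \<le> l (K, i) X"
  shows "\<sigma> X > 0 \<longleftrightarrow> (\<exists>i. l (K, i) X \<noteq> 0)"
  using assms by (auto simp: \<sigma>_def less_le sum_nonneg sum_nonneg_eq_0_iff)

lemma hconeD: 
  assumes "X \<in> hcone l' (Suc K)"
  shows "\<And>\<kappa> i. \<kappa> \<le> K \<Longrightarrow> 0 \<le> l (\<kappa>, i) X" "\<And>i. 0 \<le> m (0, i) (\<phi> X)" "\<And>i. 0 \<le> m (1, i) (\<phi> X)"
proof -
  have *: "0 \<le> l' (\<kappa>, i) X" if "\<kappa> \<le> Suc K" for \<kappa> i
    using assms that by (simp add: hcone_def)
  show **: "0 \<le> l (\<kappa>, i) X" if "\<kappa> \<le> K" for \<kappa> i using *[of \<kappa> i] that by (simp add: l'_simps)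
  show "0 \<le> m (1, i) (\<phi> X)" for i using *[of "Suc K" i] by (simp add: l'_simps)
  show "0 \<le> m (0, i) (\<phi> X)" for i using ** by (simp add: \<phi>(3))
qed

lemma hconeI:
  assumes "\<And>\<kappa> i. \<kappa> \<le> K \<Longrightarrow> 0 \<le> l (\<kappa>, i) X" "\<And>i. 0 \<le> m (1, i) (\<phi> X)"
  shows "X \<in> hcone l' (Suc K)"
  using assms by (auto simp: hcone_def l'_simps le_Suc_eq)

lemma hcone_one: "Y \<in> hcone m 1 \<longleftrightarrow> (\<forall>i. 0 \<le> m (0, i) Y \<and> 0 \<le> m (1, i) Y)"
  by (auto simp: hcone_def le_Suc_eq)

lemma \<phi>_nonzero: "X \<noteq> 0 \<Longrightarrow> \<phi> X \<noteq> 0"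
  using \<phi>(1,2) by (metis bij_is_inj linear_injective_0)

text \<open>Both apexes are cut off. Where \<open>\<sigma>\<close> vanishes, \<open>X\<close> is a
  positive multiple of \<open>v\<close>; since \<open>\<phi>\<close> reverses heights there,
  \<open>\<phi> X\<close> is a negative multiple of \<open>a\<close> and violates the constraints of
  layer 1 of \<open>P\<close>.\<close>

lemma \<sigma>_pos:
  assumes X: "X \<in> hcone l' (Suc K)" "X \<noteq> 0"
  shows "\<sigma> X > 0"
proof (rule ccontr)
  assume "\<not> \<sigma> X > 0"
  then have s: "l (K, i) X = 0" for i using \<sigma>_pos_iff[of X] hconeD(1)[OF X(1)] by auto
  then obtain c where c: "X = c *\<^sub>R v" using R.ker[of X] by (auto simp: span_singleton)
  have "c * l (0, i) v \<ge> 0" for i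
    using hconeD(1)[OF X(1), of 0 i] linear_scale[OF R.lin] by (simp add: c)
  moreover have "l (0, i) v > 0" for i using R.v_pos[of 0] R.K by simp
  ultimately have "c \<ge> 0" by (metis zero_le_mult_iff less_le_not_le)
  then have "c > 0" using c X(2) by (cases "c = 0") auto
  have "\<forall>i. m (0, i) (\<phi> X) = 0" using s by (simp add: \<phi>(3))
  then obtain d where d: "\<phi> X = d *\<^sub>R a"
    using P.ker_u by (auto simp: span_singleton)
  have "hgt v X = c" by (simp add: c linear_scale[OF linear_hgt] hgt_self R.v_nonzero)
  moreover have "hgt a (\<phi> X) = d" by (simp add: d linear_scale[OF linear_hgt] hgt_self P.u_nonzero)
  ultimately have "d = - c" using \<phi>(4)[of X] s by simp
  moreover have "m (1, i) (\<phi> X) = d * m (1, i) a" for i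
    by (simp only: d linear_scale[OF P.lin] real_scaleR_def)
  ultimately have "m (1, i) (\<phi> X) < 0" for i
    using P.u_pos[of 1 i] \<open>c > 0\<close> by (simp add: mult_neg_pos)
  then show False using hconeD(3)[OF X(1)] by (meson not_le)
qed

lemma tight_low:
  assumes X: "\<And>i. 0 \<le> l (K, i) X" "\<sigma> X > 0" "low X"
  shows "tight l' (Suc K) X = tight l K X" and "X \<in> hcone l' (Suc K) \<longleftrightarrow> X \<in> hcone l K"
proof -
  note pos = low_pos[OF X]
  show "tight l' (Suc K) X = tight l K X"
    using pos by (auto simp: tight_def l'_simps le_Suc_eq less_le)
  show "X \<in> hcone l' (Suc K) \<longleftrightarrow> X \<in> hcone l K"
    using pos by (auto simp: hcone_def l'_simps le_Suc_eq less_imp_le)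
qed

lemma tight_high:
  assumes X: "\<And>i. 0 \<le> l (K, i) X" "\<not> low X"
  shows "tight l' (Suc K) X = shift_by K ` tight m 1 (\<phi> X)" 
    and "X \<in> hcone l' (Suc K) \<longleftrightarrow> \<phi> X \<in> hcone m 1"
proof -
  note pos = high_pos[OF X]
  have "(\<kappa>, i) \<in> tight l' (Suc K) X \<longleftrightarrow> (\<kappa>, i) \<in> shift_by K ` tight m 1 (\<phi> X)" for \<kappa> i
  proof -
    consider "\<kappa> < K" | "\<kappa> = K" | "\<kappa> = Suc K" | "\<kappa> > Suc K" by linarith
    then show ?thesis
    proof cases
      case 1
      then show ?thesis using pos[OF 1, of i] by (auto simp: tight_def l'_simps shift_by_def)
    qed (auto simp: tight_def l'_simps shift_by_def image_iff \<phi>(3) le_Suc_eq)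
  qed
  then show "tight l' (Suc K) X = shift_by K ` tight m 1 (\<phi> X)" by auto
  have "0 \<le> l (\<kappa>, i) X" if "\<kappa> \<le> K" for \<kappa> i
    using that X(1) pos[of \<kappa> i] by (cases "\<kappa> = K") auto
  then show "X \<in> hcone l' (Suc K) \<longleftrightarrow> \<phi> X \<in> hcone m 1"
    using hconeD[of X] hconeI[of X] \<phi>(3) X(1) unfolding hcone_one by blast
qed

lemma new_tight_cases:
  assumes "X \<in> hcone l' (Suc K)" "X \<noteq> 0"
  obtains "X \<in> hcone l K" "tight l' (Suc K) X = tight l K X" "tight l K X \<noteq> layer K" 
  | "\<phi> X \<in> hcone m 1" "tight l' (Suc K) X = shift_by K ` tight m 1 (\<phi> X)" "tight m 1 (\<phi> X) \<noteq> layer 0"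
proof -
  have nn: "\<And>i. 0 \<le> l (K, i) X" using hconeD(1)[OF assms(1)] by simp
  have s: "\<sigma> X > 0" using \<sigma>_pos[OF assms] .
  then obtain i where i: "l (K, i) X \<noteq> 0" using \<sigma>_pos_iff[of X] nn by blast
  show ?thesis
  proof (cases "low X")
    case True
    then show ?thesis
      using that(1) tight_low[OF nn s True] assms i by (auto simp: tight_def layer_def)
  next
    case False
    have "(0, i) \<notin> tight m 1 (\<phi> X)" using i by (simp add: tight_def \<phi>(3))
    then have "tight m 1 (\<phi> X) \<noteq> layer 0" by (auto simp: layer_def)
    then show ?thesis
      using that(2) tight_high[OF nn False] assms by auto
  qed
qed

lemma new_node_cases:
  assumes "T \<in> nodes l' (Suc K)"
  obtains "T \<in> nodes l K" "f' T = f T" "T \<subseteq> {..K} \<times> UNIV"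
  | S where "S \<in> nodes m 1" "T = shift_by K ` S" "f' T = L - 1 + g S"
proof -
  obtain X where X: "card T = CARD('i)" "X \<in> hcone l' (Suc K)" "X \<noteq> 0" "tight l' (Suc K) X = T"
    using assms by (auto simp: nodes_def)
  show ?thesis
  proof (rule new_tight_cases[OF X(2,3)])
    assume *: "X \<in> hcone l K" "tight l' (Suc K) X = tight l K X"
    then have sub: "T \<subseteq> {..K} \<times> UNIV" using X(4) R.tight_subset by metis
    then have "f' T = f T" by (auto simp: f'_def)
    moreover have "T \<in> nodes l K" using X * by (auto simp: nodes_def)
    ultimately show ?thesis using sub that(1) by blast
  next
    assume *: "\<phi> X \<in> hcone m 1" "tight l' (Suc K) X = shift_by K ` tight m 1 (\<phi> X)" "tight m 1 (\<phi> X) \<noteq> layer 0"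
    define S where "S = tight m 1 (\<phi> X)"
    have T: "T = shift_by K ` S" using X(4) * by (simp add: S_def)
    have cS: "card S = CARD('i)"
      using X(1) T card_image[of "shift_by K" S] inj_shift_by by (metis inj_on_subset subset_UNIV)
    have S: "S \<in> nodes m 1" using * X(3) cS \<phi>_nonzero by (auto simp: nodes_def S_def)
    \<comment> \<open>A node of full size inside layer 0 would be the lost apex \<open>a\<close>.
      Hence a facet of the new layer is tight, which selects the second branch of
      \<open>f'\<close>.\<close>
    have "\<exists>i. (1, i) \<in> S"
    proof (rule ccontr)
      assume "\<nexists>i. (1, i) \<in> S"
      then have "S \<subseteq> layer 0" by (auto simp: S_def tight_def layer_def le_Suc_eq)
      then have "S = layer 0" using cS card_subset_eq[of "layer 0" S] by (simp add: layer_def)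
      then show False using *(3) S_def by simp
    qed
    then have "\<exists>i. (Suc K, i) \<in> T" unfolding T by (force simp: shift_by_def)
    then have "f' T = L - 1 + g S"
      by (simp add: f'_def T inj_vimage_image_eq[OF inj_shift_by])
    with S T show ?thesis by (rule that(2))
  qed
qed

text \<open>Facets common to both pieces lie in the shared layer. So \<open>T\<close> shares all but
  at most one facet with the apex \<open>v\<close>, and \<open>S\<close> with the apex
  \<open>a\<close>; the Lipschitz bounds are applied inside the original pieces, where these apexes
  still exist.\<close>

lemma cross:
  assumes T: "T \<in> nodes l K" "T \<subseteq> {..K} \<times> UNIV" and S: "S \<in> nodes m 1"
    and c: "CARD('i) \<le> card (T \<inter> shift_by K ` S) + 1"
  shows "L \<le> f T + 1" "f T \<le> L" "g S \<le> 1"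
proof -
  have fin: "finite T" "finite S" using T(1) S by (auto simp: nodes_def finite_tight)
  have sub: "T \<inter> shift_by K ` S \<subseteq> T \<inter> layer K" "T \<inter> shift_by K ` S \<subseteq> shift_by K ` (S \<inter> layer 0)"
    using T(2) by (auto simp: shift_by_def layer_def image_iff Bex_def)
  have "CARD('i) \<le> card (T \<inter> layer K) + 1"
    using c card_mono[OF _ sub(1)] fin by simp
  from R.lip[OF R.v_node T(1)] this show "L \<le> f T + 1" by (simp add: R.f_ends inf_commute)
  show "f T \<le> L" by (rule R.f_le[OF T(1)])
  have "CARD('i) \<le> card (S \<inter> layer 0) + 1"
    using c card_mono[OF _ sub(2)] fin card_image_le[of "S \<inter> layer 0" "shift_by K"] by simp
  from P.lip[OF S P.u_node this] show "g S \<le> 1" by (simp add: P.f_ends)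
qed

lemma new_lip:
  assumes "T \<in> nodes l' (Suc K)" "T' \<in> nodes l' (Suc K)" "CARD('i) \<le> card (T \<inter> T') + 1"
  shows "f' T \<le> f' T' + 1"
proof (rule new_node_cases[OF assms(1)]; rule new_node_cases[OF assms(2)])
  fix S S' assume S: "S \<in> nodes m 1" "T = shift_by K ` S" "f' T = L - 1 + g S"
    and S': "S' \<in> nodes m 1" "T' = shift_by K ` S'" "f' T' = L - 1 + g S'"
  have "T \<inter> T' = shift_by K ` (S \<inter> S')"
    by (simp add: S S' image_Int[OF inj_shift_by])
  then have "card (T \<inter> T') = card (S \<inter> S')"
    using card_image[of "shift_by K" "S \<inter> S'"] inj_shift_by by (metis inj_on_subset subset_UNIV)
  then show ?thesis using P.lip[OF S(1) S'(1)] assms(3) S(3) S'(3) by simp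
next
  fix S assume S: "S \<in> nodes m 1" "T' = shift_by K ` S" "f' T' = L - 1 + g S"
    and T: "T \<in> nodes l K" "f' T = f T" "T \<subseteq> {..K} \<times> UNIV"
  show ?thesis using cross[OF T(1,3) S(1)] assms(3) S T LM by auto
next
  fix S assume S: "S \<in> nodes m 1" "T = shift_by K ` S" "f' T = L - 1 + g S"
    and T: "T' \<in> nodes l K" "f' T' = f T'" "T' \<subseteq> {..K} \<times> UNIV"
  show ?thesis using cross[OF T(1,3) S(1)] assms(3) S T LM by (auto simp: inf_commute)
next
  assume "T \<in> nodes l K" "f' T = f T" "T' \<in> nodes l K" "f' T' = f T'"
  then show ?thesis using R.lip assms(3) by simp
qed

lemma R_point:
  assumes X: "X \<in> hcone l K" "\<kappa> < K" "(\<kappa>, i) \<in> tight l K X" "(K, j) \<notin> tight l K X"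
  shows "X \<in> hcone l' (Suc K)" "tight l' (Suc K) X = tight l K X"
proof -
  have nn: "\<And>i. 0 \<le> l (K, i) X" using X(1) by (simp add: hcone_def)
  have "low X" using high_pos[OF nn _ X(2), of i] X(3) by (auto simp: tight_def)
  moreover have "\<sigma> X > 0" using \<sigma>_pos_iff[OF nn] X(4) by (auto simp: tight_def)
  ultimately show "X \<in> hcone l' (Suc K)" "tight l' (Suc K) X = tight l K X"
    using tight_low[OF nn] X(1) by blast+
qed

lemma P_point:
  assumes Y: "Y \<in> hcone m 1" "(1, i) \<in> tight m 1 Y" "(0, j) \<notin> tight m 1 Y"
  obtains X where "\<phi> X = Y" "X \<in> hcone l' (Suc K)" "tight l' (Suc K) X = shift_by K ` tight m 1 Y"
proof -
  obtain X where X: "\<phi> X = Y" using \<phi>(2) by (metis bij_pointE)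
  have nn: "\<And>i. 0 \<le> l (K, i) X" using Y(1) by (metis X \<phi>(3) hcone_one)
  have "\<sigma> X > 0" using \<sigma>_pos_iff[OF nn] Y(3) by (auto simp: tight_def X[symmetric] \<phi>(3))
  then have "\<not> low X" using low_pos[OF nn, of i] Y(2) by (auto simp: tight_def X)
  then show ?thesis using tight_high[OF nn] Y(1) X that by metis
qed

text \<open>At height \<open>C1 + 1/2\<close> times \<open>S\<close> over \<open>v\<close>, the
  height over \<open>a\<close> is \<open>C2 + 1/2\<close> times \<open>S\<close>. Both caps apply
  strictly there, so only the shared layer can be tight, and it can be prescribed freely through
  \<open>s\<close>.\<close>

lemma mid_point:
  assumes "\<And>i. 0 \<le> (s::real^'i) $ i" "s \<noteq> 0"
  obtains X where "X \<in> hcone l' (Suc K)" "tight l' (Suc K) X = {K} \<times> {i. s $ i = 0}"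
proof -
  obtain \<Phi> :: "'v \<Rightarrow> (real^'i) \<times> real" and \<psi> where \<Phi>: "\<And>X. \<Phi> X = ((\<chi> i. l (K, i) X), hgt v X)" "\<And>y. \<Phi> (\<psi> y) = y"
    by (rule chart[of "\<lambda>i. l (K, i)" v, OF R.lin R.dim R.v_nonzero R.v_zero R.ker]) auto
  define S where "S = (\<Sum>i\<in>UNIV. s $ i)"
  define X where "X = \<psi> (s, (C1 + 1/2) * S)"
  have X: "l (K, i) X = s $ i" "hgt v X = (C1 + 1/2) * S" for i
    using \<Phi>(2)[of "(s, (C1 + 1/2) * S)"] unfolding \<Phi>(1) X_def by (auto simp: vec_eq_iff)
  have \<sigma>: "\<sigma> X = S" by (simp add: \<sigma>_def S_def X)
  have nn: "0 \<le> l (K, i) X" for i using assms by (simp add: X)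
  have S: "S > 0" using \<sigma>_pos_iff[OF nn] assms(2) by (auto simp: \<sigma> X vec_eq_iff)
  have "\<not> low X" using S by (simp add: low_def X \<sigma> algebra_simps)
  note R_pos = high_pos[OF nn this]
  have "C2 * S < hgt a (\<phi> X)" using S \<phi>(4)[of X] by (simp add: X S_def[symmetric] algebra_simps)
  then have P_pos: "m (1, i) (\<phi> X) > 0" for i
    using nn by (intro capP) (simp_all add: \<phi>(3) X S_def)
  have "0 \<le> l (\<kappa>, i) X" if "\<kappa> \<le> K" for \<kappa> i
    using R_pos[of \<kappa> i] nn that by (cases "\<kappa> = K") auto
  then have "X \<in> hcone l' (Suc K)" using P_pos by (intro hconeI) (auto simp: less_imp_le)
  moreover have "tight l' (Suc K) X = {K} \<times> {i. s $ i = 0}"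
  proof -
    have "(\<kappa>, i) \<in> tight l' (Suc K) X \<longleftrightarrow> \<kappa> = K \<and> s $ i = 0" for \<kappa> i
    proof -
      consider "\<kappa> < K" | "\<kappa> = K" | "\<kappa> = Suc K" | "\<kappa> > Suc K" by linarith
      then show ?thesis
        using R_pos[of \<kappa> i] P_pos[of i] by cases (auto simp: tight_def l'_simps X)
    qed
    then show ?thesis by auto
  qed
  ultimately show ?thesis by (rule that)
qed

lemma two_indices: "\<exists>j. j \<noteq> (i::'i)"
proof (rule ccontr)
  assume "\<not> ?thesis"
  then have "(UNIV::'i set) = {i}" by auto
  then show False using two by (metis card.empty card_insert_disjoint empty_iff finite.emptyI not_numeral_le_zero numeral_2_eq_2 Suc_n_not_le_n)
qed

lemma new_facet:
  assumes "\<kappa> \<le> Suc K"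
  shows "\<exists>X\<in>hcone l' (Suc K). tight l' (Suc K) X = {(\<kappa>, i)}"
proof -
  consider "\<kappa> < K" | "\<kappa> = K" | "\<kappa> = Suc K" using assms by linarith
  then show ?thesis
  proof cases
    case 1
    obtain X where "X \<in> hcone l K" "tight l K X = {(\<kappa>, i)}"
      using R.facet[OF less_imp_le[OF 1], of i] by blast
    then show ?thesis using R_point[of X \<kappa> i i] 1 by auto
  next
    case 2
    obtain j where "j \<noteq> i" using two_indices by blast
    \<comment> \<open>The direction vanishes exactly at \<open>i\<close>; the second index
      \<open>j\<close> keeps it nonzero, as \<open>mid_point\<close> demands.\<close>
    define s :: "real^'i" where "s = (\<chi> k. if k = i then 0 else 1)"
    have "s $ j \<noteq> 0" using \<open>j \<noteq> i\<close> by (simp add: s_def)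
    then have "s \<noteq> 0" by auto
    moreover have "0 \<le> s $ k" for k by (simp add: s_def)
    ultimately obtain X where X: "X \<in> hcone l' (Suc K)" "tight l' (Suc K) X = {K} \<times> {i. s $ i = 0}"
      using mid_point by metis
    have "{K} \<times> {i. s $ i = 0} = {(\<kappa>, i)}" using 2 by (auto simp: s_def)
    then show ?thesis using X by (metis (no_types, lifting))
  next
    case 3
    obtain Y where Y: "Y \<in> hcone m 1" "tight m 1 Y = {(1, i)}" using P.facet[OF order_refl, of i] by blast
    obtain X where "X \<in> hcone l' (Suc K)" "tight l' (Suc K) X = shift_by K ` tight m 1 Y"
      using P_point[OF Y(1), of i i] Y(2) by (metis Pair_inject insertI1 singletonD zero_neq_one)
    then show ?thesis using 3 Y by (intro bexI[of _ X]) (simp_all add: shift_by_def)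
  qed
qed

lemma new_interior: "\<exists>X\<in>hcone l' (Suc K). tight l' (Suc K) X = {}"
proof -
  define s :: "real^'i" where "s = (\<chi> k. 1)"
  have s: "s $ i = 1" for i by (simp add: s_def)
  then have "s \<noteq> 0" by (metis zero_index zero_neq_one)
  moreover have "0 \<le> s $ k" for k by (simp add: s)
  ultimately obtain X where X: "X \<in> hcone l' (Suc K)" "tight l' (Suc K) X = {K} \<times> {i. s $ i = 0}"
    using mid_point by metis
  have "{K} \<times> {i. s $ i = 0} = {}" by (simp add: s)
  then show ?thesis using X by (metis (no_types, lifting))
qed

lemma new_chain: "\<exists>v'. chain l' (Suc K) (L - 1 + M) f' u v'"
proof -
  obtain v' where v': "\<phi> v' = b" "v' \<in> hcone l' (Suc K)" "tight l' (Suc K) v' = shift_by K ` layer 1"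
    using P_point[OF P.v(1)] P.v(2) by (auto simp: layer_def)
  have lin: "linear (l' j)" for j
    using R.lin linear_compose[OF \<phi>(1) P.lin] by (cases j) (simp add: l'_def)
  have uR: "u \<in> hcone l' (Suc K)" "tight l' (Suc K) u = tight l K u"
    using R_point[OF R.u(1), of 0] R.u(2) R.K by (auto simp: layer_def)
  have grp: "shift_by K ` layer 1 = (layer (Suc K) :: (nat \<times> 'i) set)"
    by (auto simp: shift_by_def layer_def image_iff)
  have b: "layer 1 \<in> nodes m 1" by (rule P.v_node)
  have "chain l' (Suc K) (L - 1 + M) f' u v'"
  proof (rule chain.intro)
    show "linear (l' j)" for j by (rule lin)
    show "DIM('v) = CARD('i) + 1" by (rule R.dim)
    show "1 \<le> Suc K" by simp
    show "card (tight l' (Suc K) X) \<le> CARD('i)" if "X \<in> hcone l' (Suc K)" "X \<noteq> 0" for X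
    proof (rule new_tight_cases[OF that])
      assume "X \<in> hcone l K" "tight l' (Suc K) X = tight l K X"
      then show ?thesis using R.simple that by simp
    next
      assume "\<phi> X \<in> hcone m 1" "tight l' (Suc K) X = shift_by K ` tight m 1 (\<phi> X)"
      then show ?thesis
        using P.simple[OF _ \<phi>_nonzero[OF that(2)]] card_image_le[OF finite_tight[of m 1 "\<phi> X"], of "shift_by K"]
        by (metis order_trans)
    qed
    show "\<exists>X\<in>hcone l' (Suc K). tight l' (Suc K) X = {(\<kappa>, i)}" if "\<kappa> \<le> Suc K" for \<kappa> i
      using new_facet[OF that] .
    show "\<exists>X\<in>hcone l' (Suc K). tight l' (Suc K) X = {}" by (rule new_interior)
    show "u \<in> hcone l' (Suc K)" by (rule uR)
    show "tight l' (Suc K) u = layer 0" using uR R.u by simp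
    show "v' \<in> hcone l' (Suc K)" "tight l' (Suc K) v' = layer (Suc K)" using v' grp by auto
    show "X \<in> span {v'}" if "\<forall>i. l' (Suc K, i) X = 0" for X
    proof -
      have "\<phi> X \<in> span {b}" using that by (intro P.ker) (simp add: l'_simps)
      then obtain c where "\<phi> X = \<phi> (c *\<^sub>R v')"
        using linear_scale[OF \<phi>(1)] v'(1) by (auto simp: span_singleton)
      then have "X = c *\<^sub>R v'" using \<phi>(2) by (metis bij_is_inj injD)
      then show ?thesis by (simp add: span_base span_scale)
    qed
    show "X \<in> span {u}" if "\<forall>i. l' (0, i) X = 0" for X
      using that R.ker_u[of X] by (simp add: l'_simps)
    show "f' T \<le> f' T' + 1" if "T \<in> nodes l' (Suc K)" "T' \<in> nodes l' (Suc K)" "CARD('i) \<le> card (T \<inter> T') + 1" for T T'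
      using new_lip[OF that] .
    show "f' T \<le> L - 1 + M" if "T \<in> nodes l' (Suc K)" for T
      using R.f_le P.f_le LM by (rule_tac new_node_cases[OF that]) fastforce+
    show "f' (layer 0) = 0" using R.f_ends by (simp add: f'_def layer_def)
    have "\<exists>i. (Suc K, i) \<in> (layer (Suc K) :: (nat \<times> 'i) set)" by (auto simp: layer_def)
    moreover have "shift_by K -` layer (Suc K) = (layer 1 :: (nat \<times> 'i) set)"
      using inj_vimage_image_eq[OF inj_shift_by, of K "layer 1"] grp by metis
    ultimately show "f' (layer (Suc K)) = L - 1 + M"
      using P.f_ends by (simp add: f'_def)
  qed
  then show ?thesis ..
qed

end

theorem chain_glue:
  fixes l m :: "nat \<times> 'i::finite \<Rightarrow> 'v::euclidean_space \<Rightarrow> real"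
  assumes R: "chain l K L f u v" and P: "chain m 1 M g a b"
    and LM: "L \<ge> 1" "M \<ge> 1" and two: "CARD('i) \<ge> 2"
  shows "\<exists>(l' :: nat \<times> 'i \<Rightarrow> 'v \<Rightarrow> real) f' v'. chain l' (Suc K) (L - 1 + M) f' u v'"
proof -
  interpret R: chain l K L f u v by (rule R)
  interpret P: chain m 1 M g a b by (rule P)
  obtain C1 where C1: "C1 \<ge> 0" "\<And>X j. (\<And>i. 0 \<le> l (K, i) X) \<Longrightarrow> C1 * (\<Sum>i\<in>UNIV. l (K, i) X) < hgt v X
      \<Longrightarrow> j \<in> {..<K} \<times> UNIV \<Longrightarrow> l j X > 0"
  proof (rule cap[of "\<lambda>i. l (K, i)" v "{..<K} \<times> UNIV" l, OF R.lin R.dim R.v_nonzero R.v_zero R.ker])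
    show "0 < l j v" if "j \<in> {..<K} \<times> UNIV" for j using that R.v_pos by auto
  qed (simp_all add: R.lin that)
  obtain C2 where C2: "C2 \<ge> 0" "\<And>X j. (\<And>i. 0 \<le> m (0, i) X) \<Longrightarrow> C2 * (\<Sum>i\<in>UNIV. m (0, i) X) < hgt a X
      \<Longrightarrow> j \<in> {1} \<times> UNIV \<Longrightarrow> m j X > 0"
  proof (rule cap[of "\<lambda>i. m (0, i)" a "{1} \<times> UNIV" m, OF P.lin P.dim P.u_nonzero P.u_zero P.ker_u])
    show "0 < m j a" if "j \<in> {1} \<times> UNIV" for j using that P.u_pos by auto
  qed (simp_all add: P.lin that)
  obtain \<phi> where \<phi>: "linear \<phi>" "bij \<phi>" "\<And>X i. m (0, i) (\<phi> X) = l (K, i) X"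
      "\<And>X. hgt a (\<phi> X) = (C1 + C2 + 1) * (\<Sum>i\<in>UNIV. l (K, i) X) - hgt v X"
    using transition[of "\<lambda>i. l (K, i)" "\<lambda>i. m (0, i)" v a "C1 + C2 + 1",
        OF R.lin P.lin R.dim R.v_nonzero R.v_zero R.ker P.u_nonzero P.u_zero P.ker_u] by metis
  interpret G: glue l m K L f u v M g a b C1 C2 \<phi>
  proof
    show "l (\<kappa>, i) X > 0" if "\<And>i. 0 \<le> l (K, i) X" "C1 * (\<Sum>i\<in>UNIV. l (K, i) X) < hgt v X" "\<kappa> < K" for X \<kappa> i
      using C1(2)[of X "(\<kappa>, i)"] that by simp
    show "m (1, i) X > 0" if "\<And>i. 0 \<le> m (0, i) X" "C2 * (\<Sum>i\<in>UNIV. m (0, i) X) < hgt a X" for X i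
      using C2(2)[of X "(1, i)"] that by simp
  qed (fact LM two C1(1) C2(1) \<phi> linear_add[OF \<phi>(1)] linear_scale[OF \<phi>(1)])+
  obtain v' where "chain G.l' (Suc K) (L - 1 + M) G.f' u v'" using G.new_chain ..
  then show ?thesis by (intro exI)
qed

section \<open>Spindles, products and long chains\<close>

text \<open>Unlike a chain, a spindle carries a distinguished homogenizing coordinate
  \<open>snd\<close>, positive on the cone; products are formed over it. Facets, interior points and
  the kernels at the apexes, which a chain assumes, are consequences here.\<close>

locale spindle =
  fixes m :: "nat \<times> 'i::finite \<Rightarrow> 'e::euclidean_space \<times> real \<Rightarrow> real" and M :: nat
    and g :: "(nat \<times> 'i) set \<Rightarrow> nat" and a b :: "'e \<times> real"
  assumes lin: "\<And>j. linear (m j)"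
    and dim: "DIM('e) = CARD('i)"
    and simple: "\<And>X. X \<in> hcone m 1 \<Longrightarrow> X \<noteq> 0 \<Longrightarrow> card (tight m 1 X) \<le> CARD('i)"
    and bounded: "\<And>X. X \<in> hcone m 1 \<Longrightarrow> X \<noteq> 0 \<Longrightarrow> snd X > 0"
    and a: "a \<in> hcone m 1" "tight m 1 a = layer 0"
    and b: "b \<in> hcone m 1" "tight m 1 b = layer 1"
    and inj: "\<And>X \<kappa>. \<kappa> \<le> 1 \<Longrightarrow> (\<forall>i. m (\<kappa>, i) X = 0) \<Longrightarrow> snd X = 0 \<Longrightarrow> X = 0"
    and lip: "\<And>T T'. T \<in> nodes m 1 \<Longrightarrow> T' \<in> nodes m 1 \<Longrightarrow> CARD('i) \<le> card (T \<inter> T') + 1 \<Longrightarrow> g T \<le> g T' + 1"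
    and g_le: "\<And>T. T \<in> nodes m 1 \<Longrightarrow> g T \<le> M"
    and g_ends: "g (layer 0) = 0" "g (layer 1) = M"
begin

text \<open>The values of one layer together with \<open>snd\<close> are coordinates, so some
  direction \<open>w\<close> realizes \<open>s\<close> on layer \<open>\<kappa>\<close>. A
  sufficiently small step from the apex along \<open>w\<close> keeps the opposite layer
  positive.\<close>

lemma near_apex:
  fixes s :: "real^'i"
  assumes \<kappa>: "\<kappa> \<le> 1" and c: "c \<in> hcone m 1" "tight m 1 c = layer \<kappa>" and s: "\<And>i. 0 \<le> s $ i"
  obtains X where "X \<in> hcone m 1" "tight m 1 X = {\<kappa>} \<times> {i. s $ i = 0}"
proof -
  define \<Phi> :: "'e \<times> real \<Rightarrow> (real^'i) \<times> real" where "\<Phi> X = ((\<chi> i. m (\<kappa>, i) X), snd X)" for X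
  have lin\<Phi>: "linear \<Phi>"
    unfolding \<Phi>_def[abs_def] using linear_add[OF lin] linear_scale[OF lin]
    by (intro linearI) (simp_all add: vec_eq_iff)
  have "inj \<Phi>"
  proof (subst linear_injective_0[OF lin\<Phi>], intro allI impI)
    fix X assume "\<Phi> X = 0"
    then show "X = 0" using inj[OF \<kappa>, of X] by (simp add: \<Phi>_def zero_prod_def vec_eq_iff)
  qed
  then have "dim (range \<Phi>) = DIM((real^'i) \<times> real)"
    using dim_image_eq[OF lin\<Phi>, of UNIV] dim by simp
  then have "surj \<Phi>"
    using dim_eq_full[of "range \<Phi>"] linear_subspace_image[OF lin\<Phi> subspace_UNIV] by (metis span_eq_iff)
  then obtain w where "\<Phi> w = (s, 0)" by (metis surjD)
  then have w: "m (\<kappa>, i) w = s $ i" for i by (auto simp: \<Phi>_def vec_eq_iff)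
  have c0: "m (\<kappa>, i) c = 0" for i using c(2) by (auto simp: tight_def layer_def set_eq_iff)
  have c1: "m (\<kappa>', i) c > 0" if "\<kappa>' \<le> 1" "\<kappa>' \<noteq> \<kappa>" for \<kappa>' i
  proof -
    have "m (\<kappa>', i) c \<noteq> 0" using c(2) that by (auto simp: tight_def layer_def set_eq_iff)
    moreover have "m (\<kappa>', i) c \<ge> 0" using c(1) that by (simp add: hcone_def)
    ultimately show ?thesis by simp
  qed
  have "\<forall>\<^sub>F \<delta> in at_right 0. 0 < m (1 - \<kappa>, i) c + \<delta> * m (1 - \<kappa>, i) w" for i
  proof -
    have "((\<lambda>\<delta>. m (1 - \<kappa>, i) c + \<delta> * m (1 - \<kappa>, i) w) \<longlongrightarrow> m (1 - \<kappa>, i) c + 0 * m (1 - \<kappa>, i) w) (at_right 0)"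
      by (intro tendsto_intros)
    moreover have "0 < m (1 - \<kappa>, i) c + 0 * m (1 - \<kappa>, i) w" using c1[of "1 - \<kappa>"] \<kappa> by (cases \<kappa>) auto
    ultimately show ?thesis by (rule order_tendstoD)
  qed
  then have "\<forall>\<^sub>F \<delta> in at_right 0. \<forall>i. 0 < m (1 - \<kappa>, i) c + \<delta> * m (1 - \<kappa>, i) w"
    by (rule eventually_all_finite)
  moreover have "\<forall>\<^sub>F \<delta> in at_right (0::real). 0 < \<delta>" by (rule eventually_at_right_less)
  ultimately have "\<forall>\<^sub>F \<delta> in at_right 0. 0 < \<delta> \<and> (\<forall>i. 0 < m (1 - \<kappa>, i) c + \<delta> * m (1 - \<kappa>, i) w)"
    by eventually_elim auto
  then obtain \<delta> where \<delta>: "\<delta> > 0" "\<And>i. 0 < m (1 - \<kappa>, i) c + \<delta> * m (1 - \<kappa>, i) w"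
    using eventually_happens'[OF trivial_limit_at_right_real] by blast
  define X where "X = c + \<delta> *\<^sub>R w"
  have mX: "m j X = m j c + \<delta> * m j w" for j
    by (simp add: X_def linear_add[OF lin] linear_scale[OF lin])
  have X: "m (\<kappa>, i) X = \<delta> * s $ i" "m (1 - \<kappa>, i) X > 0" for i
    using \<delta>(2)[of i] by (simp add: mX w c0, simp only: mX)
  have \<kappa>': "\<kappa>' = \<kappa> \<or> \<kappa>' = 1 - \<kappa>" if "\<kappa>' \<le> 1" for \<kappa>' using that \<kappa> by linarith
  have "X \<in> hcone m 1"
    unfolding hcone_def
  proof (intro CollectI allI impI)
    fix \<kappa>' :: nat and i assume "\<kappa>' \<le> 1"
    then consider "\<kappa>' = \<kappa>" | "\<kappa>' = 1 - \<kappa>" using \<kappa>' by blast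
    then show "0 \<le> m (\<kappa>', i) X"
      using X(1)[of i] X(2)[of i] \<delta>(1) s[of i] by cases (simp_all only: mult_nonneg_nonneg less_imp_le)
  qed
  moreover have "tight m 1 X = {\<kappa>} \<times> {i. s $ i = 0}"
  proof -
    have "(\<kappa>', i) \<in> tight m 1 X \<longleftrightarrow> \<kappa>' = \<kappa> \<and> s $ i = 0" for \<kappa>' i
      using \<kappa>'[of \<kappa>'] X(1)[of i] X(2)[of i] \<delta>(1) \<kappa> by (auto simp: tight_def)
    then show ?thesis by auto
  qed
  ultimately show ?thesis by (rule that)
qed

text \<open>Subtracting the multiple of \<open>c\<close> with the same \<open>snd\<close> lands in
  the situation of \<open>inj\<close>; boundedness makes \<open>snd c\<close> invertible.\<close>

lemma kernel:
  assumes \<kappa>: "\<kappa> \<le> 1" and c: "c \<in> hcone m 1" "tight m 1 c = layer \<kappa>" and X: "\<forall>i. m (\<kappa>, i) X = 0"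
  shows "X \<in> span {c}"
proof -
  have c0: "m (\<kappa>, i) c = 0" for i using c(2) by (auto simp: tight_def layer_def set_eq_iff)
  have "m (1 - \<kappa>, i) c \<noteq> 0" for i
    using c(2) \<kappa> by (cases \<kappa>) (auto simp: tight_def layer_def set_eq_iff)
  then have "c \<noteq> 0" using linear_0[OF lin] by metis
  then have c1: "snd c > 0" using bounded c by blast
  have "X - (snd X / snd c) *\<^sub>R c = 0"
    using X c0 c1 by (intro inj[OF \<kappa>]) (simp_all add: linear_diff[OF lin] linear_scale[OF lin])
  then show ?thesis by (metis eq_iff_diff_eq_0 span_base singletonI span_scale)
qed

lemma chain: "chain m 1 M g a b"
proof (rule chain.intro)
  show "\<exists>X\<in>hcone m 1. tight m 1 X = {(\<kappa>, i)}" if \<kappa>: "\<kappa> \<le> 1" for \<kappa> i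
  proof -
    define s :: "real^'i" where "s = (\<chi> k. if k = i then 0 else 1)"
    have s0: "0 \<le> s $ k" for k by (simp add: s_def)
    have eq: "{\<kappa>} \<times> {i. s $ i = 0} = {(\<kappa>, i)}" by (auto simp: s_def)
    consider "\<kappa> = 0" | "\<kappa> = 1" using \<kappa> by linarith
    then show ?thesis
    proof cases
      case 1 then show ?thesis using near_apex[OF \<kappa> _ _ s0, of a] a eq by metis
    next
      case 2 then show ?thesis using near_apex[OF \<kappa> _ _ s0, of b] b eq by metis
    qed
  qed
  define s :: "real^'i" where "s = (\<chi> k. 1)"
  have s0: "0 \<le> s $ k" for k by (simp add: s_def)
  have eq: "{0::nat} \<times> {i. s $ i = 0} = {}" by (auto simp: s_def)
  show "\<exists>X\<in>hcone m 1. tight m 1 X = {}"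
    using near_apex[OF _ a s0] eq by (metis zero_le_one)
  show "X \<in> span {b}" if "\<forall>i. m (1, i) X = 0" for X using kernel[OF order_refl b that] .
  show "X \<in> span {a}" if "\<forall>i. m (0, i) X = 0" for X using kernel[OF zero_le_one a that] .
qed (use dim simple a b lip g_le g_ends lin in auto)

end

section \<open>Products of spindles\<close>

definition tagl :: "nat \<times> 'i \<Rightarrow> nat \<times> ('i + 'i)" where "tagl = (\<lambda>(\<kappa>, i). (\<kappa>, Inl i))"
definition tagr :: "nat \<times> 'i \<Rightarrow> nat \<times> ('i + 'i)" where "tagr = (\<lambda>(\<kappa>, i). (\<kappa>, Inr i))"

lemma inj_tag: "inj tagl" "inj tagr"
  by (auto simp: tagl_def tagr_def inj_def)

lemma tag_disjoint: "tagl ` A \<inter> tagr ` B = {}"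
  by (auto simp: tagl_def tagr_def)

lemma card_tag:
  assumes "finite A" "finite B"
  shows "card (tagl ` A \<union> tagr ` B) = card A + card B"
  using assms by (simp add: card_Un_disjoint tag_disjoint card_image inj_on_subset[OF inj_tag(1)] inj_on_subset[OF inj_tag(2)])

lemma tag_vimage: "tagl -` (tagl ` A \<union> tagr ` B) = A" "tagr -` (tagl ` A \<union> tagr ` B) = B"
proof -
  have "tagl -` tagr ` B = {}" "tagr -` tagl ` A = {}"
    using tag_disjoint[of UNIV B] tag_disjoint[of A UNIV] by blast+
  then show "tagl -` (tagl ` A \<union> tagr ` B) = A" "tagr -` (tagl ` A \<union> tagr ` B) = B"
    by (simp_all only: vimage_Un inj_vimage_image_eq[OF inj_tag(1)] inj_vimage_image_eq[OF inj_tag(2)] Un_empty_left Un_empty_right)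
qed

lemma tag_Int: "(tagl ` A \<union> tagr ` B) \<inter> (tagl ` A' \<union> tagr ` B') = tagl ` (A \<inter> A') \<union> tagr ` (B \<inter> B')"
  using tag_disjoint[of A B'] tag_disjoint[of A' B]
  unfolding image_Int[OF inj_tag(1)] image_Int[OF inj_tag(2)] by blast

context spindle
begin

definition p1 :: "('e \<times> 'e) \<times> real \<Rightarrow> 'e \<times> real" where "p1 X = (fst (fst X), snd X)"
definition p2 :: "('e \<times> 'e) \<times> real \<Rightarrow> 'e \<times> real" where "p2 X = (snd (fst X), snd X)"

text \<open>The product of two polytopes, homogenized: both factors share the last coordinate, and
  each constraint sees one factor only.\<close>

definition m2 :: "nat \<times> ('i + 'i) \<Rightarrow> ('e \<times> 'e) \<times> real \<Rightarrow> real" where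
  "m2 = (\<lambda>(\<kappa>, j). case j of Inl i \<Rightarrow> m (\<kappa>, i) \<circ> p1 | Inr i \<Rightarrow> m (\<kappa>, i) \<circ> p2)"

definition g2 :: "(nat \<times> ('i + 'i)) set \<Rightarrow> nat" where
  "g2 T = g (tagl -` T) + g (tagr -` T)"

lemma m2_simps [simp]: "m2 (\<kappa>, Inl i) X = m (\<kappa>, i) (p1 X)" "m2 (\<kappa>, Inr i) X = m (\<kappa>, i) (p2 X)"
  by (simp_all add: m2_def)

lemma linear_p: "linear p1" "linear p2"
  by (auto simp: p1_def p2_def intro!: linearI)

lemma hcone_m2: "X \<in> hcone m2 1 \<longleftrightarrow> p1 X \<in> hcone m 1 \<and> p2 X \<in> hcone m 1"
proof -
  have "(\<forall>j. 0 \<le> m2 (\<kappa>, j) X) \<longleftrightarrow> (\<forall>i. 0 \<le> m (\<kappa>, i) (p1 X)) \<and> (\<forall>i. 0 \<le> m (\<kappa>, i) (p2 X))" for \<kappa>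
    by (metis m2_simps sum.exhaust)
  then show ?thesis unfolding hcone_def by blast
qed

lemma tight_m2: "tight m2 1 X = tagl ` tight m 1 (p1 X) \<union> tagr ` tight m 1 (p2 X)"
proof -
  have "(\<kappa>, j) \<in> tight m2 1 X \<longleftrightarrow> (\<kappa>, j) \<in> tagl ` tight m 1 (p1 X) \<union> tagr ` tight m 1 (p2 X)" for \<kappa> j
    by (cases j) (auto simp: tight_def tagl_def tagr_def)
  then show ?thesis by auto
qed

lemma p_nonzero:
  assumes "X \<in> hcone m2 1" "X \<noteq> 0"
  shows "p1 X \<noteq> 0" "p2 X \<noteq> 0"
proof -
  have *: "p1 X \<in> hcone m 1" "p2 X \<in> hcone m 1" using assms(1) hcone_m2 by auto
  have "p1 X \<noteq> 0 \<or> p2 X \<noteq> 0" using assms(2) by (cases X) (auto simp: p1_def p2_def zero_prod_def)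
  then have "snd X > 0" using bounded[OF *(1)] bounded[OF *(2)] by (auto simp: p1_def p2_def)
  then show "p1 X \<noteq> 0" "p2 X \<noteq> 0" by (auto simp: p1_def p2_def zero_prod_def)
qed

text \<open>Each factor has at most \<open>CARD('i)\<close> tight constraints and together they have
  twice as many, so both counts are attained and both projections are nodes.\<close>

lemma node_m2:
  assumes "T \<in> nodes m2 1"
  obtains S S' where "S \<in> nodes m 1" "S' \<in> nodes m 1" "T = tagl ` S \<union> tagr ` S'" "g2 T = g S + g S'"
proof -
  obtain X where X: "card T = CARD('i + 'i)" "X \<in> hcone m2 1" "X \<noteq> 0" "tight m2 1 X = T"
    using assms by (auto simp: nodes_def)
  have *: "p1 X \<in> hcone m 1" "p2 X \<in> hcone m 1" "p1 X \<noteq> 0" "p2 X \<noteq> 0"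
    using X(2) hcone_m2 p_nonzero[OF X(2,3)] by auto
  have T: "T = tagl ` tight m 1 (p1 X) \<union> tagr ` tight m 1 (p2 X)" using X(4) tight_m2 by simp
  have "card (tight m 1 (p1 X)) + card (tight m 1 (p2 X)) = CARD('i) + CARD('i)"
  proof -
    have "card T = card (tight m 1 (p1 X)) + card (tight m 1 (p2 X))"
      by (simp only: T card_tag[OF finite_tight finite_tight])
    moreover have "CARD('i + 'i) = CARD('i) + CARD('i)" by simp
    ultimately show ?thesis using X(1) by linarith
  qed
  with simple[OF *(1,3)] simple[OF *(2,4)]
  have "card (tight m 1 (p1 X)) = CARD('i)" "card (tight m 1 (p2 X)) = CARD('i)" by linarith+
  with * have S: "tight m 1 (p1 X) \<in> nodes m 1" "tight m 1 (p2 X) \<in> nodes m 1"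
    unfolding nodes_def by blast+
  have "g2 T = g (tight m 1 (p1 X)) + g (tight m 1 (p2 X))"
    by (simp only: g2_def T tag_vimage)
  then show ?thesis by (rule that[OF S T])
qed

text \<open>Only one facet may be exchanged, so one of the two factors keeps its whole tight set and
  the other one loses at most one element.\<close>

lemma lip_m2:
  assumes "T \<in> nodes m2 1" "T' \<in> nodes m2 1" "CARD('i + 'i) \<le> card (T \<inter> T') + 1"
  shows "g2 T \<le> g2 T' + 1"
proof -
  obtain S1 S2 where S: "S1 \<in> nodes m 1" "S2 \<in> nodes m 1" "T = tagl ` S1 \<union> tagr ` S2" "g2 T = g S1 + g S2"
    by (rule node_m2[OF assms(1)])
  obtain S1' S2' where S': "S1' \<in> nodes m 1" "S2' \<in> nodes m 1" "T' = tagl ` S1' \<union> tagr ` S2'" "g2 T' = g S1' + g S2'"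
    by (rule node_m2[OF assms(2)])
  have fin: "finite S1" "finite S2" "finite S1'" "finite S2'"
    and card: "card S1 = CARD('i)" "card S2 = CARD('i)" "card S1' = CARD('i)" "card S2' = CARD('i)"
    using S S' finite_tight by (auto simp: nodes_def)
  have sum: "CARD('i) + CARD('i) \<le> card (S1 \<inter> S1') + card (S2 \<inter> S2') + 1"
    using assms(3) fin by (simp add: S S' tag_Int card_tag card_UNIV_sum)
  have le: "card (S1 \<inter> S1') \<le> CARD('i)" "card (S2 \<inter> S2') \<le> CARD('i)"
    using card_mono[of S1 "S1 \<inter> S1'"] card_mono[of S2 "S2 \<inter> S2'"] fin card by auto
  have eq: "A = B" if "finite A" "finite B" "card A = CARD('i)" "card B = CARD('i)" "card (A \<inter> B) = CARD('i)"
    for A B :: "(nat \<times> 'i) set"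
    using that by (metis card_subset_eq inf_le1 inf_le2)
  consider "card (S1 \<inter> S1') = CARD('i)" | "card (S2 \<inter> S2') = CARD('i)" using sum le by linarith
  then show ?thesis
  proof cases
    case 1
    then have "S1 = S1'" using eq fin card by blast
    then show ?thesis using lip[OF S(2) S'(2)] sum 1 S(4) S'(4) by simp
  next
    case 2
    then have "S2 = S2'" using eq fin card by blast
    then show ?thesis using lip[OF S(1) S'(1)] sum 2 S(4) S'(4) by simp
  qed
qed

lemma layer_m2: "tagl ` layer \<kappa> \<union> tagr ` layer \<kappa> = (layer \<kappa> :: (nat \<times> ('i + 'i)) set)"
proof (rule set_eqI)
  fix x :: "nat \<times> ('i + 'i)"
  obtain \<kappa>' j where x: "x = (\<kappa>', j)" by (metis surj_pair)
  show "x \<in> tagl ` layer \<kappa> \<union> tagr ` layer \<kappa> \<longleftrightarrow> x \<in> layer \<kappa>"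
    unfolding x tagl_def tagr_def layer_def by (cases j) (simp_all add: image_iff)
qed

lemma product: "spindle m2 (2 * M) g2 ((fst a, fst a), snd a) ((fst b, fst b), snd b)"
proof (rule spindle.intro)
  show "linear (m2 j)" for j
  proof -
    obtain \<kappa> k where j: "j = (\<kappa>, k)" by (metis surj_pair)
    show ?thesis
    proof (cases k)
      case (Inl i)
      then have "m2 j = m (\<kappa>, i) \<circ> p1" by (simp add: m2_def j)
      then show ?thesis using linear_compose[OF linear_p(1) lin] by simp
    next
      case (Inr i)
      then have "m2 j = m (\<kappa>, i) \<circ> p2" by (simp add: m2_def j)
      then show ?thesis using linear_compose[OF linear_p(2) lin] by simp
    qed
  qed
  show "DIM('e \<times> 'e) = CARD('i + 'i)" using dim by (simp add: card_UNIV_sum)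
  show "card (tight m2 1 X) \<le> CARD('i + 'i)" if "X \<in> hcone m2 1" "X \<noteq> 0" for X
  proof -
    have "card (tight m 1 (p1 X)) \<le> CARD('i)" "card (tight m 1 (p2 X)) \<le> CARD('i)"
      using simple p_nonzero[OF that] that(1) hcone_m2 by blast+
    then show ?thesis
      unfolding tight_m2 card_tag[OF finite_tight finite_tight] card_UNIV_sum by simp
  qed
  show "snd X > 0" if "X \<in> hcone m2 1" "X \<noteq> 0" for X
    using bounded[of "p1 X"] p_nonzero[OF that] that hcone_m2[of X] by (simp add: p1_def)
  show "((fst a, fst a), snd a) \<in> hcone m2 1" "((fst b, fst b), snd b) \<in> hcone m2 1"
    using a b by (auto simp only: hcone_m2 p1_def p2_def fst_conv snd_conv prod.collapse)
  show "tight m2 1 ((fst a, fst a), snd a) = layer 0" "tight m2 1 ((fst b, fst b), snd b) = layer 1"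
    using a b by (simp_all only: tight_m2 p1_def p2_def fst_conv snd_conv prod.collapse layer_m2)
  show "X = 0" if "\<kappa> \<le> 1" "\<forall>i. m2 (\<kappa>, i) X = 0" "snd X = 0" for X \<kappa>
  proof -
    have "p1 X = 0"
    proof (rule inj[OF that(1)], intro allI)
      show "m (\<kappa>, i) (p1 X) = 0" for i using that(2)[rule_format, of "Inl i"] by simp
    qed (simp add: p1_def that)
    moreover have "p2 X = 0"
    proof (rule inj[OF that(1)], intro allI)
      show "m (\<kappa>, i) (p2 X) = 0" for i using that(2)[rule_format, of "Inr i"] by simp
    qed (simp add: p2_def that)
    ultimately show "X = 0" by (cases X) (auto simp: p1_def p2_def zero_prod_def)
  qed
  show "g2 T \<le> g2 T' + 1" if "T \<in> nodes m2 1" "T' \<in> nodes m2 1" "CARD('i + 'i) \<le> card (T \<inter> T') + 1" for T T'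
    using lip_m2[OF that] .
  show "g2 T \<le> 2 * M" if T: "T \<in> nodes m2 1" for T
  proof -
    obtain S S' where "S \<in> nodes m 1" "S' \<in> nodes m 1" "T = tagl ` S \<union> tagr ` S'" "g2 T = g S + g S'"
      by (rule node_m2[OF T])
    then show ?thesis using g_le[of S] g_le[of S'] by simp
  qed
  have grp: "g2 (layer \<kappa>) = 2 * g (layer \<kappa>)" for \<kappa> :: nat
  proof -
    have "tagl -` layer \<kappa> = (layer \<kappa> :: (nat \<times> 'i) set)" "tagr -` layer \<kappa> = (layer \<kappa> :: (nat \<times> 'i) set)"
      by (rule set_eqI, case_tac x, simp add: tagl_def tagr_def layer_def)+
    then show ?thesis by (simp only: g2_def mult_2)
  qed
  show "g2 (layer 0) = 0" by (simp only: grp g_ends)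
  show "g2 (layer 1) = 2 * M" by (simp only: grp g_ends)
qed

end

text \<open>Every gluing loses one edge, so the diameter grows by \<open>M - 1\<close> while the number of facets
  grows by the dimension.\<close>

theorem long_chain:
  fixes m :: "nat \<times> 'i::finite \<Rightarrow> 'e::euclidean_space \<times> real \<Rightarrow> real"
  assumes P: "spindle m M g a b" and M: "M \<ge> 1" and two: "CARD('i) \<ge> 2"
  shows "\<exists>(l :: nat \<times> 'i \<Rightarrow> 'e \<times> real \<Rightarrow> real) f u v. chain l (Suc K) (Suc K * (M - 1) + 1) f u v"
proof (induction K)
  case 0
  have "chain m (Suc 0) (Suc 0 * (M - 1) + 1) g a b" using spindle.chain[OF P] M by simp
  then show ?case by metis
next
  case (Suc K)
  then obtain l :: "nat \<times> 'i \<Rightarrow> 'e \<times> real \<Rightarrow> real" and f u v where R: "chain l (Suc K) (Suc K * (M - 1) + 1) f u v"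
    by blast
  have "\<exists>(l' :: nat \<times> 'i \<Rightarrow> 'e \<times> real \<Rightarrow> real) f' v'.
    chain l' (Suc (Suc K)) (Suc K * (M - 1) + 1 - 1 + M) f' u v'"
    using M two by (intro chain_glue[OF R spindle.chain[OF P]]) simp_all
  moreover have "Suc K * (M - 1) + 1 - 1 + M = Suc (Suc K) * (M - 1) + 1" using M by simp
  ultimately show ?case by metis
qed

section \<open>Generic shifts and the potential\<close>

text \<open>On the hyperplane \<open>e X = 1\<close>, of dimension \<open>DIM('v) - 1\<close>, any
  \<open>DIM('v)\<close> of the functionals satisfy a nontrivial affine relation. If all of them
  became zero at one point after the shift, \<open>r\<close> would have to lie on a hyperplane fixed
  by that relation. Finitely many hyperplanes do not cover a ball.\<close>

lemma generic_shift:
  fixes f :: "'n::finite \<Rightarrow> 'v::euclidean_space \<Rightarrow> real" and e :: "'v \<Rightarrow> real"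
  assumes f: "\<And>i. linear (f i)" and e: "linear e" "e X0 \<noteq> 0" and \<delta>: "\<delta> > 0"
  obtains r :: "real^'n" where "\<And>i. \<bar>r $ i\<bar> \<le> \<delta>"
    "\<And>X. e X \<noteq> 0 \<Longrightarrow> card {i. f i X + r $ i * e X = 0} < DIM('v)"
proof -
  define Q where "Q S c k \<longleftrightarrow> c \<noteq> 0 \<and> (\<forall>i. i \<notin> S \<longrightarrow> c $ i = 0) \<and>
    (\<forall>X. e X = 1 \<longrightarrow> (\<Sum>i\<in>UNIV. c $ i * f i X) = k)" for S :: "'n set" and c :: "real^'n" and k :: real
  have "\<exists>c k. Q S c k" if S: "card S = DIM('v)" for S :: "'n set"
  proof -
    define F :: "'v \<Rightarrow> real^'n" where "F X = (\<chi> i. if i \<in> S then f i X else 0)" for X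
    have linF: "linear F"
      unfolding F_def[abs_def] using linear_add[OF f] linear_scale[OF f]
      by (intro linearI) (simp_all add: vec_eq_iff)
    define H where "H = {X. e X = 0}"
    have subH: "subspace H" unfolding H_def using e(1) by (rule linear_subspace_kernel)
    define U where "U = {v :: real^'n. \<forall>i. i \<notin> S \<longrightarrow> v $ i = 0}"
    have subU: "subspace U" by (auto simp: U_def subspace_def)
    have "X0 \<notin> H" using e(2) by (simp add: H_def)
    then have "dim H < DIM('v)"
      using subH by (metis dim_eq_full dim_subset_UNIV le_neq_implies_less span_eq_iff UNIV_I)
    then have "dim (F ` H) < dim U"
      using dim_image_le[OF linF, of H] S dim_substandard_cart[of S, where ?'a = real] dim_vec_eq[of U] unfolding U_def by (metis order_le_less_trans)
    moreover have "F ` H \<subseteq> U" by (auto simp: F_def U_def)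
    ultimately have "span (F ` H) \<subset> span U"
      by (metis dim_span psubsetI span_mono less_irrefl)
    \<comment> \<open>A nonzero vector supported on \<open>S\<close> and orthogonal to the image of
      the kernel \<open>H\<close> of \<open>e\<close>: its entries are the coefficients of the
      affine relation.\<close>
    then obtain c where c: "c \<noteq> 0" "c \<in> span U" "\<And>y. y \<in> span (F ` H) \<Longrightarrow> orthogonal c y"
      using orthogonal_to_subspace_exists_gen[of "F ` H" U] by metis
    have cU: "c $ i = 0" if "i \<notin> S" for i
      using c(2) subU that by (metis (mono_tags, lifting) U_def mem_Collect_eq span_eq_iff)
    have cF: "c \<bullet> F X = (\<Sum>i\<in>UNIV. c $ i * f i X)" for X
      using cU by (auto simp: inner_vec_def F_def intro!: sum.cong)
    have "(\<Sum>i\<in>UNIV. c $ i * f i X) = c \<bullet> F (X0 /\<^sub>R e X0)" if "e X = 1" for X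
    proof -
      have "X - X0 /\<^sub>R e X0 \<in> H"
        using that e(2) by (simp add: H_def linear_diff[OF e(1)] linear_scale[OF e(1)])
      then have "c \<bullet> F (X - X0 /\<^sub>R e X0) = 0"
        using c(3) by (simp add: orthogonal_def span_base)
      then show ?thesis by (simp add: linear_diff[OF linF] inner_diff_right cF)
    qed
    with c(1) cU have "Q S c (c \<bullet> F (X0 /\<^sub>R e X0))" unfolding Q_def by blast
    then show ?thesis by blast
  qed
  then obtain c k where "\<And>S. card S = DIM('v) \<Longrightarrow> Q S (c S) (k S)" by metis
  then have c: "\<And>S. card S = DIM('v) \<Longrightarrow> c S \<noteq> 0"
      "\<And>S i. card S = DIM('v) \<Longrightarrow> i \<notin> S \<Longrightarrow> c S $ i = 0"
      "\<And>S X. card S = DIM('v) \<Longrightarrow> e X = 1 \<Longrightarrow> (\<Sum>i\<in>UNIV. c S $ i * f i X) = k S"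
    unfolding Q_def by blast+
  define B where "B = (\<Union>S\<in>{S. card S = DIM('v)}. {r. c S \<bullet> r = - k S})"
  have "negligible B"
    unfolding B_def
  proof (rule negligible_Union[OF finite_imageI])
    fix t assume "t \<in> (\<lambda>S. {r. c S \<bullet> r = - k S}) ` {S. card S = DIM('v)}"
    then obtain S where "card S = DIM('v)" "t = {r. c S \<bullet> r = - k S}" by blast
    then show "negligible t" using c(1) by (simp add: negligible_hyperplane)
  qed simp
  moreover have "\<not> negligible (ball (0::real^'n) \<delta>)"
    using \<delta> by (intro open_not_negligible) auto
  ultimately have "\<not> ball 0 \<delta> \<subseteq> B" using negligible_subset by blast
  then obtain r where r: "r \<in> ball 0 \<delta>" "r \<notin> B" by blast
  have "\<bar>r $ i\<bar> \<le> \<delta>" for i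
    using component_le_norm_cart[of r i] r(1) by simp
  moreover have "card {i. f i X + r $ i * e X = 0} < DIM('v)" if X: "e X \<noteq> 0" for X
  proof (rule ccontr)
    assume "\<not> ?thesis"
    then have "DIM('v) \<le> card {i. f i X + r $ i * e X = 0}" by simp
    then obtain S where S: "S \<subseteq> {i. f i X + r $ i * e X = 0}" "card S = DIM('v)"
      by (rule obtain_subset_with_card_n)
    define Y where "Y = X /\<^sub>R e X"
    have Y: "e Y = 1" "f i Y = f i X / e X" for i
      using X by (simp_all add: Y_def linear_scale[OF e(1)] linear_scale[OF f] field_simps)
    have "f i Y = - r $ i" if "i \<in> S" for i
      using S(1) that X by (auto simp: Y field_simps eq_neg_iff_add_eq_0)
    then have "c S $ i * f i Y = - (c S $ i * r $ i)" for i
      using c(2)[OF S(2), of i] by (cases "i \<in> S") auto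
    then have "k S = - (c S \<bullet> r)"
      using c(3)[OF S(2) Y(1)] by (simp add: inner_vec_def sum_negf)
    then show False using r(2) S(2) by (auto simp: B_def)
  qed
  ultimately show ?thesis by (rule that)
qed

text \<open>The potential counts the constraints of layer 1 that are tight; it is one more at the nodes
  that cannot be reached monotonically from a node with \<open>k + 1\<close> of them.\<close>

lemma potential_exists:
  fixes N :: "(nat \<times> 'i::finite) set set" and k c :: nat
  assumes N: "\<And>T. T \<in> N \<Longrightarrow> card T = CARD('i) \<and> T \<subseteq> layer 0 \<union> layer 1"
    and D: "k + c < CARD('i)" and c1: "c \<ge> 1"
    and bad: "\<And>S T. S \<in> N \<Longrightarrow> T \<in> N \<Longrightarrow> card (S \<inter> layer 1) = k + 1 \<Longrightarrow> card (T \<inter> layer 1) = k + c \<Longrightarrow>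
      S \<inter> layer 1 \<subseteq> T \<inter> layer 1 \<Longrightarrow> T \<inter> layer 0 \<subseteq> S \<inter> layer 0 \<Longrightarrow> False"
  obtains g :: "(nat \<times> 'i) set \<Rightarrow> nat" where
    "\<And>T T'. T \<in> N \<Longrightarrow> T' \<in> N \<Longrightarrow> CARD('i) \<le> card (T \<inter> T') + 1 \<Longrightarrow> g T \<le> g T' + 1"
    "\<And>T. T \<in> N \<Longrightarrow> g T \<le> CARD('i) + 1" "g (layer 0) = 0" "g (layer 1) = CARD('i) + 1"
proof -
  define nb where "nb T = card (T \<inter> layer 1)" for T :: "(nat \<times> 'i) set"
  \<comment> \<open>Reachable from a node with \<open>k + 1\<close> tight constraints of layer 1 by
    exchanges that only remove layer 0 and only add layer 1, as far as inclusion of tight sets can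
    tell.\<close>
  define ok where "ok T \<longleftrightarrow> (\<exists>S\<in>N. nb S = k + 1 \<and> S \<inter> layer 1 \<subseteq> T \<inter> layer 1 \<and> T \<inter> layer 0 \<subseteq> S \<inter> layer 0)" for T
  define e where "e T = (if nb T \<le> k \<or> ok T \<and> nb T \<le> k + c then 0 else 1 :: nat)" for T
  have disj: "layer 0 \<inter> (layer 1 :: (nat \<times> 'i) set) = {}" by (auto simp: layer_def)
  have fin: "finite T" if "T \<in> N" for T
    using N[OF that] card.infinite zero_less_card_finite by fastforce
  have nbN: "nb T \<le> CARD('i)" if "T \<in> N" for T
    unfolding nb_def using N[OF that] card_mono[OF fin[OF that], of "T \<inter> layer 1"] by simp
  have lip: "nb T' + e T' \<le> nb T + e T + 1"
    if T: "T \<in> N" "T' \<in> N" and c: "CARD('i) \<le> card (T \<inter> T') + 1" for T T'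
  proof (cases "T = T'")
    case False
    note f = fin[OF T(1)] fin[OF T(2)] and n = N[OF T(1)] N[OF T(2)]
    have "card (T \<inter> T') \<noteq> CARD('i)"
      using False f n by (metis card_subset_eq inf_le1 inf_le2)
    moreover have "card (T \<inter> T') \<le> CARD('i)"
      using card_mono[OF f(1), of "T \<inter> T'"] n by simp
    ultimately have I: "card (T \<inter> T') + 1 = CARD('i)" using c by linarith
    have "card (T' - T) = 1" "card (T - T') = 1"
      using I n f card_Diff_subset_Int[of T' T] card_Diff_subset_Int[of T T'] by (simp_all add: inf_commute)
    then obtain x y where y: "T' - T = {y}" and x: "T - T' = {x}" by (metis card_1_singletonE)
    have T': "T' = insert y (T - {x})" using x y by blast
    have xy: "x \<in> T" "y \<notin> T" "x \<noteq> y" using x y by blast+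
    have le: "nb T' \<le> nb T + 1"
    proof -
      have "T' \<inter> layer 1 \<subseteq> insert y (T \<inter> layer 1)" using T' by blast
      then have "nb T' \<le> card (insert y (T \<inter> layer 1))" unfolding nb_def using f by (intro card_mono) auto
      also have "\<dots> \<le> nb T + 1" unfolding nb_def using f by (simp add: card_insert_if)
      finally show ?thesis .
    qed
    \<comment> \<open>If \<open>nb\<close> does not grow, there is room for \<open>e\<close> to rise
      from 0 to 1. Only a step raising \<open>nb\<close> needs care, and it must replace a facet of
      layer 0 by one of layer 1.\<close>
    show ?thesis
    proof (cases "nb T' = nb T + 1")
      case True
      have yB: "y \<in> layer 1"
      proof (rule ccontr)
        assume "y \<notin> layer 1"
        then have "T' \<inter> layer 1 \<subseteq> T \<inter> layer 1" using T' by blast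
        then have "nb T' \<le> nb T" unfolding nb_def using f by (intro card_mono) auto
        then show False using True by simp
      qed
      have xA: "x \<notin> layer 1"
      proof
        assume "x \<in> layer 1"
        then have "T' \<inter> layer 1 = insert y (T \<inter> layer 1 - {x})" using T' yB xy by blast
        then have "nb T' = nb T" unfolding nb_def using f xy \<open>x \<in> layer 1\<close>
          by (simp add: card_insert_if card_Diff_singleton) (metis Int_iff One_nat_def Suc_pred card_gt_0_iff empty_iff finite_Int)
        then show False using True by simp
      qed
      have sub: "T \<inter> layer 1 \<subseteq> T' \<inter> layer 1" "T' \<inter> layer 0 \<subseteq> T \<inter> layer 0"
        using T' xA yB disj by blast+
      have "e T' \<le> e T"
      proof (cases "nb T \<le> k")
        case nb: True
        \<comment> \<open>On reaching level \<open>k + 1\<close> a node is its own witness.\<close>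
        have "ok T'" if "nb T' = k + 1" using T(2) that by (auto simp: ok_def)
        then have "e T' = 0" using nb True c1 by (cases "nb T' \<le> k") (auto simp: e_def)
        then show ?thesis by simp
      next
        case nb: False
        show ?thesis
        proof (cases "ok T \<and> nb T \<le> k + c")
          case ok: True
          then obtain S where S: "S \<in> N" "nb S = k + 1" "S \<inter> layer 1 \<subseteq> T \<inter> layer 1" "T \<inter> layer 0 \<subseteq> S \<inter> layer 0"
            by (auto simp: ok_def)
          \<comment> \<open>The forbidden pairs enter only here: an \<open>ok\<close> node never
            reaches level \<open>k + c\<close>, so \<open>e\<close> cannot jump to 1 on leaving the
            window between the two levels upwards.\<close>
          have "nb T \<noteq> k + c" using bad[OF S(1) T(1)] S unfolding nb_def by blast
          then have "nb T' \<le> k + c" using ok True by simp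
          moreover have "ok T'" unfolding ok_def using S sub by blast
          ultimately show ?thesis by (simp add: e_def)
        qed (use nb in \<open>simp add: e_def\<close>)
      qed
      then show ?thesis using True by simp
    next
      case False
      then show ?thesis using le by (simp add: e_def)
    qed
  qed simp
  show ?thesis
  proof (rule that[of "\<lambda>T. nb T + e T"])
    show "nb T + e T \<le> nb T' + e T' + 1" if "T \<in> N" "T' \<in> N" "CARD('i) \<le> card (T \<inter> T') + 1" for T T'
      using lip[of T' T] that by (simp add: inf_commute)
    show "nb T + e T \<le> CARD('i) + 1" if "T \<in> N" for T
      using nbN[OF that] by (simp add: e_def)
    have "nb (layer 0) = 0" unfolding nb_def disj by simp
    then show "nb (layer 0) + e (layer 0) = 0" by (simp add: e_def)
    have "nb (layer 1) = CARD('i)" by (simp add: nb_def)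
    then show "nb (layer 1) + e (layer 1) = CARD('i) + 1" using D by (simp add: e_def)
  qed
qed

section \<open>The strong d-step construction\<close>

text \<open>The facets of one layer: \<open>Inl (Inl c)\<close> are left as they are,
  \<open>Inl (Inr k)\<close> are the tilted surplus facets, \<open>Inr None\<close> is the wedged
  facet and \<open>Inr (Some k)\<close> are the wedge coordinates. At the untilted apex the other
  side's coordinates \<open>y\<close> fill the simplex \<open>y \<ge> 0\<close> with sum at most
  \<open>q\<close>; the value \<open>q / (CARD('k) + 1)\<close> in each coordinate is its
  barycentre, strictly inside every facet of the opposite layer.\<close>

definition side :: "(('c + 'k) option \<Rightarrow> 'w::real_inner) \<Rightarrow> real \<Rightarrow> 'w \<Rightarrow> real \<Rightarrow> real \<Rightarrow> real^'k \<Rightarrow> real^'k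
    \<Rightarrow> ('c + 'k::finite) + 'k option \<Rightarrow> real" where
  "side av \<epsilon> z p q y y' j = (case j of
     Inl i \<Rightarrow> p - av (Some i) \<bullet> z + (case i of Inl c \<Rightarrow> 0 | Inr k \<Rightarrow> \<epsilon> * (y $ k - q / (real CARD('k) + 1)))
   | Inr None \<Rightarrow> p - av None \<bullet> z - (\<Sum>k\<in>UNIV. y' $ k)
   | Inr (Some k) \<Rightarrow> y' $ k)"

lemma side_simps [simp]:
  "side av \<epsilon> z p q y y' (Inl (Inl c)) = p - av (Some (Inl c)) \<bullet> z"
  "side av \<epsilon> z p q y y' (Inl (Inr k)) = p - av (Some (Inr k)) \<bullet> z + \<epsilon> * (y $ k - q / (real CARD('k) + 1))"
  "side av \<epsilon> z p q y y' (Inr None) = p - av None \<bullet> z - (\<Sum>k\<in>UNIV. y' $ k)"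
  "side av \<epsilon> z p q y y' (Inr (Some k)) = y' $ k"
  for y y' :: "real^'k::finite"
  by (simp_all add: side_def)

lemma index_cases:
  obtains c where "j = Inl (Inl c)" | k where "j = Inl (Inr k)" | "j = Inr None" | k where "j = Inr (Some k)"
  by (metis not_Some_eq sum.exhaust)

lemma side_add:
  "side av \<epsilon> (z + z') (p + p') (q + q') (y + w) (y' + w') j = side av \<epsilon> z p q y y' j + side av \<epsilon> z' p' q' w w' j"
  by (cases j rule: index_cases) (simp_all add: inner_add_right sum.distrib algebra_simps add_divide_distrib)

lemma side_scale:
  "side av \<epsilon> (c *\<^sub>R z) (c * p) (c * q) (c *\<^sub>R y) (c *\<^sub>R y') j = c * side av \<epsilon> z p q y y' j"
  by (cases j rule: index_cases) (simp_all add: sum_distrib_left algebra_simps)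

lemma tendsto_side:
  assumes "(\<epsilon> \<longlongrightarrow> e) F" "(z \<longlongrightarrow> z0) F" "(p \<longlongrightarrow> p0) F" "(q \<longlongrightarrow> q0) F" "(y \<longlongrightarrow> y0) F" "(y' \<longlongrightarrow> y1) F"
  shows "((\<lambda>n. side av (\<epsilon> n) (z n) (p n) (q n) (y n) (y' n) j) \<longlongrightarrow> side av e z0 p0 q0 y0 y1 j) F"
  by (cases j rule: index_cases; simp; intro tendsto_intros assms; simp)

text \<open>By \<open>basis\<close>, the facets that are not tilted already determine
  \<open>z\<close> and \<open>p\<close> at the apex, leaving the tilted ones to determine
  \<open>y\<close>. By \<open>pos\<close>, the normals positively span the space, which bounds the
  polytope.\<close>

locale cap_config =
  fixes av :: "('c::finite + 'k::finite) option \<Rightarrow> 'w::euclidean_space"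
  assumes dimw: "DIM('w) = CARD('c)"
    and basis: "\<And>z p. av None \<bullet> z = p \<Longrightarrow> (\<And>c. av (Some (Inl c)) \<bullet> z = p) \<Longrightarrow> z = 0"
    and pos: "\<And>z. (\<And>i. av i \<bullet> z \<le> 0) \<Longrightarrow> z = 0"
begin

lemma side0D:
  assumes "\<And>j. 0 \<le> side av 0 z p q y y' j"
  shows "av i \<bullet> z \<le> p" "0 \<le> p" "p = 0 \<Longrightarrow> z = 0" "0 \<le> y' $ k" "(\<Sum>k\<in>UNIV. y' $ k) \<le> p - av None \<bullet> z"
proof -
  show y: "0 \<le> y' $ k" for k using assms[of "Inr (Some k)"] by simp
  show s: "(\<Sum>k\<in>UNIV. y' $ k) \<le> p - av None \<bullet> z" using assms[of "Inr None"] by simp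
  have "0 \<le> (\<Sum>k\<in>UNIV. y' $ k)" using y by (simp add: sum_nonneg)
  then have n: "av None \<bullet> z \<le> p" using s by linarith
  show le: "av i \<bullet> z \<le> p" for i
  proof (cases i)
    case (Some j)
    then show ?thesis using assms[of "Inl j"] by (simp add: side_def split: sum.splits)
  qed (simp add: n)
  show "0 \<le> p"
  proof (rule ccontr)
    assume "\<not> 0 \<le> p"
    then have "z = 0" using le by (intro pos) (meson le_less_trans less_imp_le not_le)
    then show False using n \<open>\<not> 0 \<le> p\<close> by simp
  qed
  show "p = 0 \<Longrightarrow> z = 0" using le by (intro pos) simp
qed

text \<open>Untilted facets are tight exactly at ties. In the block \<open>Inr\<close> of
  \<open>CARD('k) + 1\<close> constraints, all can be tight only if \<open>y'\<close> vanishes and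
  \<open>av None\<close> is tied; otherwise at least one is missing. Equality in the count therefore
  reads off the ties from \<open>T\<close> alone.\<close>

lemma side0_count:
  assumes nn: "\<And>j. 0 \<le> side av 0 z p q y y' j" and T: "T \<subseteq> {j. side av 0 z p q y y' j = 0}"
  defines "S \<equiv> {i. av i \<bullet> z = p}"
  shows "card T \<le> card S + CARD('k)"
    and "card T = card S + CARD('k) \<Longrightarrow> Some i \<in> S \<longleftrightarrow> Inl i \<in> T"
    and "card T = card S + CARD('k) \<Longrightarrow> None \<in> S \<longleftrightarrow> range Inr \<subseteq> T"
proof -
  define M where "M = {i. Some i \<in> S}"
  define M' where "M' = {i. Inl i \<in> T}"
  define R where "R = {o'. Inr o' \<in> T}"
  define \<delta> where "\<delta> = (if None \<in> S then 1 else 0 :: nat)"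
  have S: "S = Some ` M \<union> (if None \<in> S then {None} else {})"
  proof (rule set_eqI)
    fix x show "x \<in> S \<longleftrightarrow> x \<in> Some ` M \<union> (if None \<in> S then {None} else {})"
      by (cases x) (auto simp: M_def)
  qed
  have cS: "card S = card M + \<delta>"
  proof (cases "None \<in> S")
    case True
    then have "S = insert None (Some ` M)" using S by simp
    then have "card S = card (insert None (Some ` M))" by simp
    also have "\<dots> = card M + 1" by (subst card_insert_disjoint) (auto simp: card_image)
    finally show ?thesis using True by (simp add: \<delta>_def)
  next
    case False
    then have "S = Some ` M" using S by simp
    then have "card S = card (Some ` M)" by simp
    then show ?thesis using False by (simp add: \<delta>_def card_image)
  qed
  have TR: "T = Inl ` M' \<union> Inr ` R"
  proof (rule set_eqI)
    fix x show "x \<in> T \<longleftrightarrow> x \<in> Inl ` M' \<union> Inr ` R"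
      by (cases x) (auto simp: M'_def R_def)
  qed
  have "Inl ` M' \<inter> Inr ` R = {}" by auto
  then have cT: "card T = card M' + card R"
    unfolding TR by (subst card_Un_disjoint) (simp_all add: card_image)
  have sub: "M' \<subseteq> M"
  proof
    fix i assume "i \<in> M'"
    then have "side av 0 z p q y y' (Inl i) = 0" using T by (auto simp: M'_def)
    then show "i \<in> M" by (simp add: M_def S_def side_def split: sum.splits)
  qed
  then have cM: "card M' \<le> card M" by (intro card_mono) auto
  have RU: "None \<in> S" if "R = UNIV"
  proof -
    have r: "side av 0 z p q y y' (Inr o') = 0" for o' using that T by (auto simp: R_def)
    have "y' $ k = 0" for k using r[of "Some k"] by simp
    then show ?thesis using r[of None] by (simp add: S_def)
  qed
  have cU: "CARD('k option) = CARD('k) + 1" by simp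
  have cR: "card R \<le> CARD('k) + \<delta>"
  proof (cases "R = UNIV")
    case True
    then show ?thesis using RU by (simp add: \<delta>_def)
  next
    case False
    then have "card R < CARD('k option)" by (intro psubset_card_mono) auto
    then show ?thesis using cU by simp
  qed
  show "card T \<le> card S + CARD('k)" using cS cT cM cR by linarith
  assume eq: "card T = card S + CARD('k)"
  then have "card M' = card M" and cR': "card R = CARD('k) + \<delta>" using cS cT cM cR by linarith+
  then have "M' = M" using sub by (intro card_subset_eq) auto
  then show "Some i \<in> S \<longleftrightarrow> Inl i \<in> T" by (auto simp: M_def M'_def)
  have "R = UNIV" if "None \<in> S"
  proof (rule card_subset_eq)
    show "card R = card (UNIV :: 'k option set)" using that cR' cU by (simp add: \<delta>_def)
  qed auto
  moreover have "R = UNIV \<longleftrightarrow> range Inr \<subseteq> T" by (auto simp: R_def)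
  ultimately show "None \<in> S \<longleftrightarrow> range Inr \<subseteq> T" using RU by blast
qed

lemma apex_inj:
  assumes "\<epsilon> > 0" and s: "\<And>j. side av \<epsilon> z p q y y' j = 0" and pq: "p + q = 0"
  shows "z = 0 \<and> p = 0 \<and> q = 0 \<and> y = 0 \<and> y' = 0"
proof -
  have y': "y' $ k = 0" for k using s[of "Inr (Some k)"] by simp
  have n: "av None \<bullet> z = p" using s[of "Inr None"] y' by simp
  moreover have "av (Some (Inl c)) \<bullet> z = p" for c using s[of "Inl (Inl c)"] by simp
  ultimately have z: "z = 0" by (rule basis)
  then have p: "p = 0" using n by simp
  then have q: "q = 0" using pq by simp
  have "y $ k = 0" for k using s[of "Inl (Inr k)"] assms(1) z p q by simp
  then show ?thesis using y' z p q by (simp add: vec_eq_iff)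
qed

text \<open>The untilted constraints give \<open>z\<close> and \<open>p\<close> of order
  \<open>\<epsilon>\<^sup>2\<close>. In the tilted ones, \<open>\<epsilon>\<close> times the
  deviation of \<open>y\<close> from the barycentre is then of order
  \<open>\<epsilon>\<^sup>2\<close> as well, so the deviation is of order \<open>\<epsilon>\<close>.
  For this reason the generic shifts must be bounded by the square of the tilt.\<close>

lemma apex_limit:
  fixes \<epsilon> :: "nat \<Rightarrow> real"
  assumes \<epsilon>: "\<And>n. \<epsilon> n > 0" "\<epsilon> \<longlonglongrightarrow> 0"
    and s: "\<And>n j. \<bar>side av (\<epsilon> n) (z n) (p n) (q n) (y n) (y' n) j\<bar> \<le> (\<epsilon> n)\<^sup>2" and pq: "\<And>n. p n + q n = 2"
  shows "z \<longlonglongrightarrow> 0" "p \<longlonglongrightarrow> 0" "q \<longlonglongrightarrow> 2" "y \<longlonglongrightarrow> (\<chi> k. 2 / (real CARD('k) + 1))" "y' \<longlonglongrightarrow> 0"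
proof -
  have \<epsilon>2: "(\<lambda>n. C * (\<epsilon> n)\<^sup>2) \<longlonglongrightarrow> 0" for C
    using tendsto_mult_left[OF tendsto_power[OF \<epsilon>(2), of 2], of C] by simp
  have y': "\<bar>y' n $ k\<bar> \<le> (\<epsilon> n)\<^sup>2" for n k using s[of n "Inr (Some k)"] by simp
  have "(\<lambda>n. y' n $ k) \<longlonglongrightarrow> 0 $ k" for k
    unfolding zero_index
    by (rule Lim_null_comparison[of _ "\<lambda>n. 1 * (\<epsilon> n)\<^sup>2", OF _ \<epsilon>2[of 1]]) (simp add: y')
  then show "y' \<longlonglongrightarrow> 0" by (rule vec_tendstoI)
  define G where "G = (\<lambda>(z, p). (p - av None \<bullet> z, \<chi> c. p - av (Some (Inl c)) \<bullet> z :: real^'c))"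
  have linG: "linear G"
    unfolding G_def by (rule linearI) (auto simp: vec_eq_iff inner_add_right algebra_simps)
  have "inj G"
  proof (subst linear_injective_0[OF linG], intro allI impI)
    fix x assume G0: "G x = 0"
    obtain z p where x: "x = (z, p)" by (cases x)
    have "av None \<bullet> z = p" "av (Some (Inl c)) \<bullet> z = p" for c
      using G0 unfolding x G_def zero_prod_def by (simp_all add: vec_eq_iff)
    then have "z = 0" by (rule basis)
    then show "x = 0" using \<open>av None \<bullet> z = p\<close> by (simp add: x zero_prod_def)
  qed
  then obtain B where B: "B > 0" "\<And>x. B * norm x \<le> norm (G x)"
    using linear_inj_bounded_below_pos[OF linG] by blast
  define K where "K = (1 + real CARD('k) + real CARD('c)) / B"
  have "norm (z n, p n) \<le> K * (\<epsilon> n)\<^sup>2" for n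
  proof -
    have "\<bar>\<Sum>k\<in>UNIV. y' n $ k\<bar> \<le> (\<Sum>k\<in>UNIV. \<bar>y' n $ k\<bar>)" by (rule sum_abs)
    also have "\<dots> \<le> (\<Sum>k\<in>(UNIV::'k set). (\<epsilon> n)\<^sup>2)" by (rule sum_mono) (rule y')
    finally have "\<bar>\<Sum>k\<in>UNIV. y' n $ k\<bar> \<le> real CARD('k) * (\<epsilon> n)\<^sup>2" by simp
    then have 1: "\<bar>p n - av None \<bullet> z n\<bar> \<le> (1 + real CARD('k)) * (\<epsilon> n)\<^sup>2"
      using s[of n "Inr None"] by (simp add: algebra_simps)
    have "norm (\<chi> c. p n - av (Some (Inl c)) \<bullet> z n :: real^'c) \<le> (\<Sum>c\<in>UNIV. \<bar>p n - av (Some (Inl c)) \<bullet> z n\<bar>)"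
      using norm_le_l1_cart[of "\<chi> c. p n - av (Some (Inl c)) \<bullet> z n :: real^'c"] by simp
    also have "\<dots> \<le> (\<Sum>c\<in>(UNIV::'c set). (\<epsilon> n)\<^sup>2)"
    proof (rule sum_mono)
      show "\<bar>p n - av (Some (Inl c)) \<bullet> z n\<bar> \<le> (\<epsilon> n)\<^sup>2" for c using s[of n "Inl (Inl c)"] by simp
    qed
    finally have 2: "norm (\<chi> c. p n - av (Some (Inl c)) \<bullet> z n :: real^'c) \<le> real CARD('c) * (\<epsilon> n)\<^sup>2" by simp
    have "B * norm (z n, p n) \<le> (1 + real CARD('k) + real CARD('c)) * (\<epsilon> n)\<^sup>2"
      using B(2)[of "(z n, p n)"] 1 2
        norm_Pair_le[of "p n - av None \<bullet> z n" "\<chi> c. p n - av (Some (Inl c)) \<bullet> z n :: real^'c"]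
      by (simp add: G_def algebra_simps)
    then show ?thesis using B(1) by (simp add: K_def field_simps)
  qed
  then have zp: "norm (z n) \<le> K * (\<epsilon> n)\<^sup>2" "\<bar>p n\<bar> \<le> K * (\<epsilon> n)\<^sup>2" for n
    using norm_fst_le[of "z n" "p n"] norm_snd_le[of "p n" "z n"] by (auto intro: order_trans)
  show z0: "z \<longlonglongrightarrow> 0" by (rule Lim_null_comparison[OF _ \<epsilon>2[of K]]) (simp add: zp)
  show p0: "p \<longlonglongrightarrow> 0" by (rule Lim_null_comparison[OF _ \<epsilon>2[of K]]) (simp add: zp)
  have q: "q = (\<lambda>n. 2 - p n)" using pq by (simp add: fun_eq_iff algebra_simps eq_diff_eq)
  have "(\<lambda>n. 2 - p n) \<longlonglongrightarrow> 2 - 0" by (intro tendsto_intros p0)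
  then show q2: "q \<longlonglongrightarrow> 2" unfolding q by simp
  have "(\<lambda>n. y n $ k) \<longlonglongrightarrow> (\<chi> k. 2 / (real CARD('k) + 1)) $ k" for k
  proof -
    define \<theta> where "\<theta> = real CARD('k) + 1"
    define a where "a = av (Some (Inr k))"
    have bd: "\<bar>y n $ k - q n / \<theta>\<bar> \<le> (1 + K + norm a * K) * \<epsilon> n" for n
    proof -
      have "\<bar>a \<bullet> z n\<bar> \<le> norm a * norm (z n)" by (rule Cauchy_Schwarz_ineq2)
      also have "\<dots> \<le> norm a * (K * (\<epsilon> n)\<^sup>2)" by (intro mult_left_mono zp) simp
      finally have "\<bar>\<epsilon> n * (y n $ k - q n / \<theta>)\<bar> \<le> (\<epsilon> n)\<^sup>2 + K * (\<epsilon> n)\<^sup>2 + norm a * (K * (\<epsilon> n)\<^sup>2)"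
        using s[of n "Inl (Inr k)"] zp(2)[of n] unfolding side_simps a_def[symmetric] \<theta>_def[symmetric] by linarith
      moreover have "\<bar>\<epsilon> n * (y n $ k - q n / \<theta>)\<bar> = \<epsilon> n * \<bar>y n $ k - q n / \<theta>\<bar>"
        using \<epsilon>(1)[of n] by (simp only: abs_mult abs_of_pos)
      moreover have "(\<epsilon> n)\<^sup>2 + K * (\<epsilon> n)\<^sup>2 + norm a * (K * (\<epsilon> n)\<^sup>2) = \<epsilon> n * ((1 + K + norm a * K) * \<epsilon> n)"
        by (simp add: power2_eq_square algebra_simps)
      ultimately have "\<epsilon> n * \<bar>y n $ k - q n / \<theta>\<bar> \<le> \<epsilon> n * ((1 + K + norm a * K) * \<epsilon> n)" by simp
      then show ?thesis using \<epsilon>(1)[of n] by (metis mult_le_cancel_left_pos)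
    qed
    have lim: "(\<lambda>n. (1 + K + norm a * K) * \<epsilon> n) \<longlonglongrightarrow> 0"
      using tendsto_mult_left[OF \<epsilon>(2), of "1 + K + norm a * K"] by simp
    have "(\<lambda>n. y n $ k - q n / \<theta>) \<longlonglongrightarrow> 0"
      by (rule Lim_null_comparison[OF _ lim]) (simp add: bd)
    moreover have "(\<lambda>n. q n / \<theta>) \<longlonglongrightarrow> 2 / \<theta>"
      unfolding \<theta>_def by (intro tendsto_intros q2) simp
    ultimately have "(\<lambda>n. (y n $ k - q n / \<theta>) + q n / \<theta>) \<longlonglongrightarrow> 0 + 2 / \<theta>" by (rule tendsto_add)
    then show ?thesis by (simp add: \<theta>_def)
  qed
  then show "y \<longlonglongrightarrow> (\<chi> k. 2 / (real CARD('k) + 1))" by (rule vec_tendstoI)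
qed

end

lemma apex_pos:
  fixes av :: "('c::finite + 'k::finite) option \<Rightarrow> 'w::real_inner"
  shows "0 < side av 0 0 2 0 0 (\<chi> k. 2 / (real CARD('k) + 1)) j"
proof (cases j rule: index_cases)
  case 3
  have "real CARD('k) * (2 / (real CARD('k) + 1)) < 2" by (simp add: field_simps)
  then show ?thesis using 3 by simp
qed simp_all

section \<open>The lifted cone\<close>

type_synonym ('w, 'k) lifted = "('w \<times> real \<times> (real^'k) \<times> (real^'k)) \<times> real"

text \<open>Here \<open>p = \<tau> - t\<close> and \<open>q = \<tau> + t\<close>, so
  \<open>\<tau>\<close> homogenizes and \<open>t\<close> runs from one apex to the other. Layer 1 is
  layer 0 with \<open>p\<close>, \<open>q\<close> and \<open>y\<close>, \<open>y'\<close> exchanged: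
  the wedge coordinates of either side tilt the other one. The term with \<open>r\<close> is the
  generic shift.\<close>

definition ell :: "(('c + 'k::finite) option \<Rightarrow> 'w::real_inner) \<Rightarrow> (('c + 'k) option \<Rightarrow> 'w) \<Rightarrow> real \<Rightarrow>
    (nat \<Rightarrow> ('c + 'k) + 'k option \<Rightarrow> real) \<Rightarrow> nat \<times> (('c + 'k) + 'k option) \<Rightarrow> ('w, 'k) lifted \<Rightarrow> real" where
  "ell av bv \<epsilon> r = (\<lambda>(\<kappa>, j) ((z, t, y, y'), \<tau>).
     (if \<kappa> = 0 then side av \<epsilon> z (\<tau> - t) (\<tau> + t) y y' j else side bv \<epsilon> z (\<tau> + t) (\<tau> - t) y' y j) + r \<kappa> j * \<tau>)"

lemma linear_ell:
  fixes av bv :: "('c + 'k::finite) option \<Rightarrow> 'w::real_inner"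
  shows "linear (ell av bv \<epsilon> r i)"
proof -
  obtain \<kappa> j where i: "i = (\<kappa>, j)" by (cases i)
  show ?thesis
  proof (rule linearI)
    fix X Y :: "('w, 'k) lifted"
    obtain z t y y' \<tau> where X: "X = ((z, t, y, y'), \<tau>)" by (metis surj_pair)
    obtain z1 t1 y1 y1' \<tau>1 where Y: "Y = ((z1, t1, y1, y1'), \<tau>1)" by (metis surj_pair)
    have "(\<tau> + \<tau>1) - (t + t1) = (\<tau> - t) + (\<tau>1 - t1)" "(\<tau> + \<tau>1) + (t + t1) = (\<tau> + t) + (\<tau>1 + t1)" by simp_all
    then have "side av \<epsilon> (z + z1) ((\<tau> + \<tau>1) - (t + t1)) ((\<tau> + \<tau>1) + (t + t1)) (y + y1) (y' + y1') j
        = side av \<epsilon> z (\<tau> - t) (\<tau> + t) y y' j + side av \<epsilon> z1 (\<tau>1 - t1) (\<tau>1 + t1) y1 y1' j"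
      "side bv \<epsilon> (z + z1) ((\<tau> + \<tau>1) + (t + t1)) ((\<tau> + \<tau>1) - (t + t1)) (y' + y1') (y + y1) j
        = side bv \<epsilon> z (\<tau> + t) (\<tau> - t) y' y j + side bv \<epsilon> z1 (\<tau>1 + t1) (\<tau>1 - t1) y1' y1 j"
      by (simp_all only: side_add)
    then show "ell av bv \<epsilon> r i (X + Y) = ell av bv \<epsilon> r i X + ell av bv \<epsilon> r i Y"
      unfolding X Y i ell_def by (simp add: distrib_left)
  next
    fix c and X :: "('w, 'k) lifted"
    obtain z t y y' \<tau> where X: "X = ((z, t, y, y'), \<tau>)" by (metis surj_pair)
    have "c * \<tau> - c * t = c * (\<tau> - t)" "c * \<tau> + c * t = c * (\<tau> + t)" by (simp_all add: algebra_simps)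
    then have "side av \<epsilon> (c *\<^sub>R z) (c * \<tau> - c * t) (c * \<tau> + c * t) (c *\<^sub>R y) (c *\<^sub>R y') j
        = c * side av \<epsilon> z (\<tau> - t) (\<tau> + t) y y' j"
      "side bv \<epsilon> (c *\<^sub>R z) (c * \<tau> + c * t) (c * \<tau> - c * t) (c *\<^sub>R y') (c *\<^sub>R y) j
        = c * side bv \<epsilon> z (\<tau> + t) (\<tau> - t) y' y j"
      by (simp_all only: side_scale)
    then show "ell av bv \<epsilon> r i (c *\<^sub>R X) = c *\<^sub>R ell av bv \<epsilon> r i X"
      unfolding X i ell_def by (simp add: distrib_left)
  qed
qed

lemma tendsto_ell:
  fixes av bv :: "('c + 'k::finite) option \<Rightarrow> 'w::real_inner"
  assumes \<epsilon>: "(\<epsilon> \<longlongrightarrow> 0) F" and r: "((\<lambda>n. r n (fst i) (snd i)) \<longlongrightarrow> 0) F" and X: "(X \<longlongrightarrow> x) F"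
  shows "((\<lambda>n. ell av bv (\<epsilon> n) (r n) i (X n)) \<longlongrightarrow> ell av bv 0 (\<lambda>_ _. 0) i x) F"
proof -
  obtain \<kappa> j where i: "i = (\<kappa>, j)" by (cases i)
  define z t y y' \<tau> where d: "z = (\<lambda>X :: ('w, 'k) lifted. fst (fst X))" "t = (\<lambda>X :: ('w, 'k) lifted. fst (snd (fst X)))"
    "y = (\<lambda>X :: ('w, 'k) lifted. fst (snd (snd (fst X))))" "y' = (\<lambda>X :: ('w, 'k) lifted. snd (snd (snd (fst X))))"
    "\<tau> = (\<lambda>X :: ('w, 'k) lifted. snd X)"
  have e: "ell av bv e q i Y = (if \<kappa> = 0 then side av e (z Y) (\<tau> Y - t Y) (\<tau> Y + t Y) (y Y) (y' Y) j
      else side bv e (z Y) (\<tau> Y + t Y) (\<tau> Y - t Y) (y' Y) (y Y) j) + q \<kappa> j * \<tau> Y" for e q Y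
    by (simp add: ell_def d i case_prod_beta)
  have l: "((\<lambda>n. z (X n)) \<longlongrightarrow> z x) F" "((\<lambda>n. t (X n)) \<longlongrightarrow> t x) F" "((\<lambda>n. y (X n)) \<longlongrightarrow> y x) F"
      "((\<lambda>n. y' (X n)) \<longlongrightarrow> y' x) F" "((\<lambda>n. \<tau> (X n)) \<longlongrightarrow> \<tau> x) F"
    unfolding d by (intro tendsto_fst tendsto_snd X)+
  have r': "((\<lambda>n. r n \<kappa> j) \<longlongrightarrow> 0) F" using r by (simp add: i)
  show ?thesis
  proof (cases "\<kappa> = 0")
    case True
    then show ?thesis unfolding e using True
      by (simp only: if_True) (intro tendsto_add tendsto_side tendsto_mult \<epsilon> r'[unfolded True] l tendsto_diff)
  next
    case False
    then show ?thesis unfolding e using False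
      by (simp only: if_False) (intro tendsto_add tendsto_side tendsto_mult \<epsilon> r' l tendsto_diff)
  qed
qed

lemma hcone_scale:
  assumes lin: "\<And>j. linear (l j)" and X: "X \<in> hcone l K" and c: "c > 0"
  shows "c *\<^sub>R X \<in> hcone l K" "tight l K (c *\<^sub>R X) = tight l K X"
  using X c by (auto simp: hcone_def tight_def linear_scale[OF lin])

section \<open>The limit cone without tilt and shift\<close>

locale config = A: cap_config av + B: cap_config bv
  for av bv :: "('c::finite + 'k::finite) option \<Rightarrow> 'w::euclidean_space" +
  assumes ties: "\<And>z p q. z \<noteq> 0 \<Longrightarrow> (\<And>i. av i \<bullet> z \<le> p) \<Longrightarrow> (\<And>i. bv i \<bullet> z \<le> q) \<Longrightarrow>
      card {i. av i \<bullet> z = p} + card {i. bv i \<bullet> z = q} \<le> CARD('c) + 1"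
    and chains: "\<And>z p q z' p' q' i j. z \<noteq> 0 \<Longrightarrow> z' \<noteq> 0 \<Longrightarrow>
      (\<And>i. av i \<bullet> z \<le> p) \<Longrightarrow> (\<And>i. bv i \<bullet> z \<le> q) \<Longrightarrow> (\<And>i. av i \<bullet> z' \<le> p') \<Longrightarrow> (\<And>i. bv i \<bullet> z' \<le> q') \<Longrightarrow>
      CARD('c) \<le> card {i. av i \<bullet> z = p} \<Longrightarrow> CARD('c) \<le> card {i. bv i \<bullet> z' = q'} \<Longrightarrow>
      av i \<bullet> z = p \<Longrightarrow> av i \<bullet> z' = p' \<Longrightarrow> bv j \<bullet> z = q \<Longrightarrow> bv j \<bullet> z' = q' \<Longrightarrow> False"
begin

abbreviation "E0 \<equiv> ell av bv 0 (\<lambda>_ _. 0)"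

definition part :: "nat \<Rightarrow> (nat \<times> (('c + 'k) + 'k option)) set \<Rightarrow> (('c + 'k) + 'k option) set" where
  "part \<kappa> T = {j. (\<kappa>, j) \<in> T}"

lemma E0_side:
  assumes "X = ((z, t, y, y'), \<tau>)"
  shows "E0 (0, j) X = side av 0 z (\<tau> - t) (\<tau> + t) y y' j" "E0 (1, j) X = side bv 0 z (\<tau> + t) (\<tau> - t) y' y j"
  by (simp_all add: assms ell_def)

lemma E0_hcone:
  assumes "X = ((z, t, y, y'), \<tau>)" "X \<in> hcone E0 1"
  shows "0 \<le> side av 0 z (\<tau> - t) (\<tau> + t) y y' j" "0 \<le> side bv 0 z (\<tau> + t) (\<tau> - t) y' y j"
proof -
  have "0 \<le> E0 (0, j) X" "0 \<le> E0 (1, j) X" using assms(2) by (simp_all add: hcone_def)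
  then show "0 \<le> side av 0 z (\<tau> - t) (\<tau> + t) y y' j" "0 \<le> side bv 0 z (\<tau> + t) (\<tau> - t) y' y j"
    unfolding E0_side[OF assms(1)] .
qed

text \<open>At \<open>\<tau> = 0\<close> the nonnegative numbers \<open>p\<close> and
  \<open>q\<close> sum to zero, so both vanish; this forces \<open>z = 0\<close>, and the wedge
  inequalities then force \<open>y\<close> and \<open>y'\<close> to vanish.\<close>

lemma E0_pos:
  assumes X: "X \<in> hcone E0 1" "X \<noteq> 0"
  shows "snd X > 0"
proof -
  obtain z t y y' \<tau> where X': "X = ((z, t, y, y'), \<tau>)" by (metis surj_pair)
  note s = E0_hcone[OF X' X(1)]
  note a = A.side0D[OF s(1)] and b = B.side0D[OF s(2)]
  have "\<tau> \<noteq> 0"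
  proof
    assume \<tau>: "\<tau> = 0"
    then have t: "t = 0" using a(2) b(2) by linarith
    then have z: "z = 0" using a(3) \<tau> by simp
    have "(\<Sum>k\<in>UNIV. y' $ k) \<le> 0" "(\<Sum>k\<in>UNIV. y $ k) \<le> 0" using a(5) b(5) z t \<tau> by simp_all
    then have "(\<Sum>k\<in>UNIV. y' $ k) = 0" "(\<Sum>k\<in>UNIV. y $ k) = 0"
      using a(4) b(4) by (simp_all add: antisym sum_nonneg)
    then have "y' $ k = 0" "y $ k = 0" for k
      using a(4) b(4) sum_nonneg_eq_0_iff[of UNIV "\<lambda>k. y' $ k"] sum_nonneg_eq_0_iff[of UNIV "\<lambda>k. y $ k"] by simp_all
    then have "y = 0" "y' = 0" by (simp_all add: vec_eq_iff)
    then show False using X(2) z t \<tau> by (simp add: X' zero_prod_def)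
  qed
  then show ?thesis using a(2) b(2) by (simp add: X')
qed

lemma E0_count:
  assumes X: "X = ((z, t, y, y'), \<tau>)" "X \<in> hcone E0 1" and T: "T \<subseteq> tight E0 1 X"
  defines "SA \<equiv> {i. av i \<bullet> z = \<tau> - t}" and "SB \<equiv> {i. bv i \<bullet> z = \<tau> + t}"
  shows "card (part 0 T) \<le> card SA + CARD('k)" "card (part 1 T) \<le> card SB + CARD('k)"
    "card (part 0 T) = card SA + CARD('k) \<Longrightarrow> Some i \<in> SA \<longleftrightarrow> Inl i \<in> part 0 T"
    "card (part 0 T) = card SA + CARD('k) \<Longrightarrow> None \<in> SA \<longleftrightarrow> range Inr \<subseteq> part 0 T"
    "card (part 1 T) = card SB + CARD('k) \<Longrightarrow> Some i \<in> SB \<longleftrightarrow> Inl i \<in> part 1 T"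
    "card (part 1 T) = card SB + CARD('k) \<Longrightarrow> None \<in> SB \<longleftrightarrow> range Inr \<subseteq> part 1 T"
proof -
  note s = E0_hcone[OF X(1,2)]
  have A: "part 0 T \<subseteq> {j. side av 0 z (\<tau> - t) (\<tau> + t) y y' j = 0}"
    using T E0_side(1)[OF X(1)] by (auto simp: part_def tight_def)
  have B: "part 1 T \<subseteq> {j. side bv 0 z (\<tau> + t) (\<tau> - t) y' y j = 0}"
    using T E0_side(2)[OF X(1)] by (auto simp: part_def tight_def)
  show "card (part 0 T) \<le> card SA + CARD('k)" "card (part 1 T) \<le> card SB + CARD('k)"
    "card (part 0 T) = card SA + CARD('k) \<Longrightarrow> Some i \<in> SA \<longleftrightarrow> Inl i \<in> part 0 T"
    "card (part 0 T) = card SA + CARD('k) \<Longrightarrow> None \<in> SA \<longleftrightarrow> range Inr \<subseteq> part 0 T"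
    "card (part 1 T) = card SB + CARD('k) \<Longrightarrow> Some i \<in> SB \<longleftrightarrow> Inl i \<in> part 1 T"
    "card (part 1 T) = card SB + CARD('k) \<Longrightarrow> None \<in> SB \<longleftrightarrow> range Inr \<subseteq> part 1 T"
    unfolding SA_def SB_def
    by (fact A.side0_count[OF s(1) A] B.side0_count[OF s(2) B])+
qed

text \<open>Away from the two apexes \<open>z = 0\<close> a full tight set of the limit cone determines the ties of \<open>z\<close>.\<close>

lemma E0_node:
  assumes X: "X = ((z, t, y, y'), \<tau>)" "X \<in> hcone E0 1" "X \<noteq> 0" and T: "T \<subseteq> tight E0 1 X"
    and card: "card (part 0 T) + card (part 1 T) = CARD('c) + 2 * CARD('k) + 1"
    and ends: "CARD('k) < card (part 0 T)" "CARD('k) < card (part 1 T)"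
  defines "SA \<equiv> {i. av i \<bullet> z = \<tau> - t}" and "SB \<equiv> {i. bv i \<bullet> z = \<tau> + t}"
  shows "z \<noteq> 0" "\<And>i. av i \<bullet> z \<le> \<tau> - t" "\<And>i. bv i \<bullet> z \<le> \<tau> + t"
    "card (part 0 T) = card SA + CARD('k)" "card (part 1 T) = card SB + CARD('k)"
proof -
  note s = E0_hcone[OF X(1,2)]
  note a = A.side0D[OF s(1)] and b = B.side0D[OF s(2)]
  have \<tau>: "\<tau> > 0" using E0_pos[OF X(2,3)] by (simp add: X(1))
  have le: "card (part 0 T) \<le> card SA + CARD('k)" "card (part 1 T) \<le> card SB + CARD('k)"
    unfolding SA_def SB_def using E0_count(1,2)[OF X(1,2) T] by simp_all
  show z: "z \<noteq> 0"
  proof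
    assume z: "z = 0"
    consider "\<tau> - t > 0" | "\<tau> + t > 0" using \<tau> by linarith
    then show False
    proof cases
      case 1
      then have "SA = {}" by (auto simp: SA_def z)
      then show False using le(1) ends(1) by simp
    next
      case 2
      then have "SB = {}" by (auto simp: SB_def z)
      then show False using le(2) ends(2) by simp
    qed
  qed
  show "\<And>i. av i \<bullet> z \<le> \<tau> - t" "\<And>i. bv i \<bullet> z \<le> \<tau> + t" using a(1) b(1) .
  have "card SA + card SB \<le> CARD('c) + 1"
    unfolding SA_def SB_def using a(1) b(1) by (intro ties[OF z])
  then show "card (part 0 T) = card SA + CARD('k)" "card (part 1 T) = card SB + CARD('k)"
    using le card by linarith+
qed

text \<open>By \<open>E0_node\<close> the first point has \<open>CARD('c)\<close> ties in
  \<open>av\<close> and one in \<open>bv\<close>, the second the reverse. The inclusions of parts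
  transport the single \<open>bv\<close>-tie of the first point to the second and the single
  \<open>av\<close>-tie of the second to the first, and \<open>chains\<close> applies.\<close>

lemma no_bad_pair:
  assumes X: "X \<in> hcone E0 1" "X \<noteq> 0" "T \<subseteq> tight E0 1 X" and X': "X' \<in> hcone E0 1" "X' \<noteq> 0" "T' \<subseteq> tight E0 1 X'"
    and T: "card (part 0 T) = CARD('c) + CARD('k)" "card (part 1 T) = CARD('k) + 1"
    and T': "card (part 0 T') = CARD('k) + 1" "card (part 1 T') = CARD('k) + CARD('c)"
    and sub: "part 1 T \<subseteq> part 1 T'" "part 0 T' \<subseteq> part 0 T"
  shows False
proof -
  obtain z t y w \<tau> where x: "X = ((z, t, y, w), \<tau>)" by (metis surj_pair)
  obtain z' t' y' w' \<tau>' where x': "X' = ((z', t', y', w'), \<tau>')" by (metis surj_pair)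
  have c: "0 < CARD('c)" by simp
  have "card (part 0 T) + card (part 1 T) = CARD('c) + 2 * CARD('k) + 1" "CARD('k) < card (part 0 T)" "CARD('k) < card (part 1 T)"
    using T c by linarith+
  note N = E0_node[OF x X this]
  have "card (part 0 T') + card (part 1 T') = CARD('c) + 2 * CARD('k) + 1" "CARD('k) < card (part 0 T')" "CARD('k) < card (part 1 T')"
    using T' c by linarith+
  note N' = E0_node[OF x' X' this]
  note C = E0_count(3-6)[OF x X(1,3)] and C' = E0_count(3-6)[OF x' X'(1,3)]
  have "card {i. bv i \<bullet> z = \<tau> + t} = 1" using N(5) T by linarith
  then obtain j where j: "bv j \<bullet> z = \<tau> + t" by (metis (mono_tags, lifting) card_1_singletonE insertI1 mem_Collect_eq)
  have j': "bv j \<bullet> z' = \<tau>' + t'"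
  proof (cases j)
    case None
    then have "range Inr \<subseteq> part 1 T" using C(4)[OF N(5)] j by simp
    then show ?thesis using C'(4)[OF N'(5)] sub None by auto
  next
    case (Some i)
    then have "Inl i \<in> part 1 T" using C(3)[OF N(5)] j by simp
    then show ?thesis using C'(3)[OF N'(5)] sub Some by auto
  qed
  have "card {i. av i \<bullet> z' = \<tau>' - t'} = 1" using N'(4) T' by linarith
  then obtain i where i: "av i \<bullet> z' = \<tau>' - t'" by (metis (mono_tags, lifting) card_1_singletonE insertI1 mem_Collect_eq)
  have i': "av i \<bullet> z = \<tau> - t"
  proof (cases i)
    case None
    then have "range Inr \<subseteq> part 0 T'" using C'(2)[OF N'(4)] i by simp
    then show ?thesis using C(2)[OF N(4)] sub None by auto
  next
    case (Some k)
    then have "Inl k \<in> part 0 T'" using C'(1)[OF N'(4)] i by simp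
    then show ?thesis using C(1)[OF N(4)] sub Some by auto
  qed
  have "CARD('c) \<le> card {i. av i \<bullet> z = \<tau> - t}" "CARD('c) \<le> card {i. bv i \<bullet> z' = \<tau>' + t'}"
    using N(4) T N'(5) T' by linarith+
  from chains[OF N(1) N'(1) N(2) N(3) N'(2) N'(3) this i' i j j'] show False .
qed

end

section \<open>Perturbations tending to zero\<close>

locale sequence = config av bv
  for av bv :: "('c::finite + 'k::finite) option \<Rightarrow> 'w::euclidean_space" +
  fixes \<epsilon> :: "nat \<Rightarrow> real" and r :: "nat \<Rightarrow> nat \<Rightarrow> ('c + 'k) + 'k option \<Rightarrow> real"
  assumes \<epsilon>: "\<And>n. \<epsilon> n > 0" "\<epsilon> \<longlonglongrightarrow> 0"
    and r: "\<And>n \<kappa> j. \<bar>r n \<kappa> j\<bar> \<le> (\<epsilon> n)\<^sup>2"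
    and generic: "\<And>n X. snd X \<noteq> 0 \<Longrightarrow> card (tight (ell av bv (\<epsilon> n) (r n)) 1 X) \<le> CARD(('c + 'k) + 'k option)"
begin

definition E where "E n = ell av bv (\<epsilon> n) (r n)"

lemma linear_E: "linear (E n i)"
  unfolding E_def by (rule linear_ell)

lemma tendsto_E:
  assumes s: "strict_mono s" and X: "X \<longlonglongrightarrow> x"
  shows "(\<lambda>n. E (s n) i (X n)) \<longlonglongrightarrow> E0 i x"
proof -
  have \<epsilon>s: "(\<lambda>n. \<epsilon> (s n)) \<longlonglongrightarrow> 0"
    using LIMSEQ_subseq_LIMSEQ[OF \<epsilon>(2) s] by (simp add: comp_def)
  have lim: "(\<lambda>n. (\<epsilon> (s n))\<^sup>2) \<longlonglongrightarrow> 0"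
    using tendsto_power[OF \<epsilon>s, of 2] by simp
  have "(\<lambda>n. r (s n) (fst i) (snd i)) \<longlonglongrightarrow> 0"
    by (rule Lim_null_comparison[OF _ lim]) (simp add: r)
  then show ?thesis unfolding E_def by (intro tendsto_ell \<epsilon>s X)
qed

text \<open>Compactness of the unit sphere yields the limit, and weak inequalities pass to it. A set
  \<open>T\<close> that is tight along the whole sequence stays tight, but further constraints may
  become tight in the limit, so only an inclusion results.\<close>

lemma limit_point:
  assumes s: "strict_mono s" and X: "\<And>n. X n \<in> hcone (E (s n)) 1" "\<And>n. norm (X n) = 1"
  obtains x q where "strict_mono (q :: nat \<Rightarrow> nat)" "(X \<circ> q) \<longlonglongrightarrow> x" "x \<noteq> 0" "x \<in> hcone E0 1"
    "\<And>T. (\<And>n. T \<subseteq> tight (E (s n)) 1 (X n)) \<Longrightarrow> T \<subseteq> tight E0 1 x"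
proof -
  have "X n \<in> sphere 0 1" for n using X(2) by simp
  then obtain x q where q: "x \<in> sphere 0 1" "strict_mono (q :: nat \<Rightarrow> nat)" "(X \<circ> q) \<longlonglongrightarrow> x"
    using compact_sphere[of 0 1] unfolding compact_def by meson
  have sq: "strict_mono (s \<circ> q)" using s q(2) by (rule strict_mono_o)
  have lim: "(\<lambda>n. E ((s \<circ> q) n) i ((X \<circ> q) n)) \<longlonglongrightarrow> E0 i x" for i
    by (rule tendsto_E[OF sq q(3)])
  have "0 \<le> E0 (\<kappa>, i) x" if "\<kappa> \<le> 1" for \<kappa> i
  proof (rule LIMSEQ_le_const[OF lim], intro exI allI impI)
    show "0 \<le> E ((s \<circ> q) n) (\<kappa>, i) ((X \<circ> q) n)" for n
      using X(1)[of "q n"] that by (simp add: hcone_def)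
  qed
  then have x: "x \<in> hcone E0 1" by (simp add: hcone_def)
  moreover have "x \<noteq> 0" using q(1) by auto
  moreover have "T \<subseteq> tight E0 1 x" if T: "\<And>n. T \<subseteq> tight (E (s n)) 1 (X n)" for T
  proof
    fix i assume i: "i \<in> T"
    obtain \<kappa> j where ij: "i = (\<kappa>, j)" by (cases i)
    have *: "\<kappa> \<le> 1 \<and> E (s n) i (X n) = 0" for n using T[of n] i by (auto simp: tight_def ij)
    then have "(\<lambda>n. E ((s \<circ> q) n) i ((X \<circ> q) n)) = (\<lambda>n. 0)" by (simp add: fun_eq_iff)
    then have "E0 i x = 0" using lim[of i] LIMSEQ_unique[OF _ tendsto_const] by metis
    then show "i \<in> tight E0 1 x" using * by (simp add: tight_def ij)
  qed
  ultimately show ?thesis using that q by blast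
qed

lemma normalize:
  assumes "X \<in> hcone (E n) 1" "X \<noteq> 0"
  shows "X /\<^sub>R norm X \<in> hcone (E n) 1" "norm (X /\<^sub>R norm X) = 1" "tight (E n) 1 (X /\<^sub>R norm X) = tight (E n) 1 X"
  using hcone_scale[OF linear_E assms(1), of "inverse (norm X)"] assms(2) by simp_all

text \<open>Violations for infinitely many \<open>n\<close>, scaled to norm 1, would accumulate at a
  nonzero point of the limit cone with \<open>snd\<close> at most 0, against
  \<open>E0_pos\<close>.\<close>

lemma ev_bounded: "\<forall>\<^sub>F n in sequentially. \<forall>X\<in>hcone (E n) 1. X \<noteq> 0 \<longrightarrow> snd X > 0"
proof (rule ccontr)
  assume "\<not> ?thesis"
  then obtain s where s: "strict_mono s" "\<And>n::nat. \<not> (\<forall>X\<in>hcone (E (s n)) 1. X \<noteq> 0 \<longrightarrow> snd X > 0)"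
    using not_eventually_sequentiallyD by blast
  then have "\<forall>n. \<exists>X. X \<in> hcone (E (s n)) 1 \<and> X \<noteq> 0 \<and> snd X \<le> 0" by (meson not_le)
  then obtain X where X: "\<And>n. X n \<in> hcone (E (s n)) 1" "\<And>n. X n \<noteq> 0" "\<And>n. snd (X n) \<le> 0" by metis
  define Y where "Y n = X n /\<^sub>R norm (X n)" for n
  have Y: "\<And>n. Y n \<in> hcone (E (s n)) 1" "\<And>n. norm (Y n) = 1"
    unfolding Y_def by (rule normalize[OF X(1,2)])+
  obtain x q where x: "strict_mono (q :: nat \<Rightarrow> nat)" "(Y \<circ> q) \<longlonglongrightarrow> x" "x \<noteq> 0" "x \<in> hcone E0 1"
    by (rule limit_point[OF s(1) Y])
  have "(\<lambda>n. snd ((Y \<circ> q) n)) \<longlonglongrightarrow> snd x" by (rule tendsto_snd[OF x(2)])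
  moreover have "snd ((Y \<circ> q) n) \<le> 0" for n
    using X(2)[of "q n"] X(3)[of "q n"] by (simp add: Y_def mult_nonneg_nonpos)
  ultimately have "snd x \<le> 0" by (intro LIMSEQ_le_const2) auto
  then show False using E0_pos[OF x(4,3)] by simp
qed

definition bad :: "nat \<Rightarrow> (nat \<times> (('c + 'k) + 'k option)) set \<times> (nat \<times> (('c + 'k) + 'k option)) set \<Rightarrow> bool" where
  "bad n = (\<lambda>(T, T'). T \<in> nodes (E n) 1 \<and> T' \<in> nodes (E n) 1 \<and>
    card (part 1 T) = CARD('k) + 1 \<and> card (part 1 T') = CARD('k) + CARD('c) \<and>
    part 1 T \<subseteq> part 1 T' \<and> part 0 T' \<subseteq> part 0 T)"

lemma card_parts:
  assumes "T \<subseteq> layer 0 \<union> layer 1"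
  shows "card T = card (part 0 T) + card (part 1 T)"
proof -
  have T: "T = Pair 0 ` part 0 T \<union> Pair 1 ` part 1 T"
    using assms by (auto simp: part_def layer_def)
  have "Pair (0::nat) ` part 0 T \<inter> Pair 1 ` part 1 T = {}" by auto
  then have "card (Pair (0::nat) ` part 0 T \<union> Pair 1 ` part 1 T) = card (part 0 T) + card (part 1 T)"
    by (subst card_Un_disjoint) (auto simp: card_image inj_on_def)
  then show ?thesis using T by simp
qed

lemma card_index: "CARD(('c + 'k) + 'k option) = CARD('c) + 2 * CARD('k) + 1"
  by simp

lemma tight_layers: "tight l 1 X \<subseteq> layer 0 \<union> layer 1"
  by (auto simp: tight_def layer_def le_Suc_eq)

lemma not_always_bad:
  fixes s :: "nat \<Rightarrow> nat"
  assumes s: "strict_mono s" and bad: "\<And>n. bad (s n) (T, T')"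
  shows False
proof -
  have nodes: "T \<in> nodes (E (s n)) 1" "T' \<in> nodes (E (s n)) 1" for n
    using bad[of n] by (simp_all add: bad_def)
  have "\<forall>n. \<exists>X. X \<in> hcone (E (s n)) 1 \<and> X \<noteq> 0 \<and> tight (E (s n)) 1 X = T"
    using nodes unfolding nodes_def by blast
  then obtain X where X: "\<And>n. X n \<in> hcone (E (s n)) 1" "\<And>n. X n \<noteq> 0" "\<And>n. tight (E (s n)) 1 (X n) = T" by metis
  have "\<forall>n. \<exists>X. X \<in> hcone (E (s n)) 1 \<and> X \<noteq> 0 \<and> tight (E (s n)) 1 X = T'"
    using nodes unfolding nodes_def by blast
  then obtain X' where X': "\<And>n. X' n \<in> hcone (E (s n)) 1" "\<And>n. X' n \<noteq> 0" "\<And>n. tight (E (s n)) 1 (X' n) = T'" by metis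
  obtain x where x: "x \<noteq> 0" "x \<in> hcone E0 1" and T: "T \<subseteq> tight E0 1 x"
  proof (rule limit_point[OF s normalize(1,2)[OF X(1,2)]])
    fix x assume x: "x \<noteq> 0" "x \<in> hcone E0 1"
      and T: "\<And>T. (\<And>n. T \<subseteq> tight (E (s n)) 1 (X n /\<^sub>R norm (X n))) \<Longrightarrow> T \<subseteq> tight E0 1 x"
    show thesis
      by (rule that[OF x T]) (simp only: normalize(3)[OF X(1,2)] X(3) subset_refl)
  qed
  obtain x' where x': "x' \<noteq> 0" "x' \<in> hcone E0 1" and T': "T' \<subseteq> tight E0 1 x'"
  proof (rule limit_point[OF s normalize(1,2)[OF X'(1,2)]])
    fix x assume x: "x \<noteq> 0" "x \<in> hcone E0 1"
      and T: "\<And>T. (\<And>n. T \<subseteq> tight (E (s n)) 1 (X' n /\<^sub>R norm (X' n))) \<Longrightarrow> T \<subseteq> tight E0 1 x"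
    show thesis
      by (rule that[OF x T]) (simp only: normalize(3)[OF X'(1,2)] X'(3) subset_refl)
  qed
  have b: "card (part 1 T) = CARD('k) + 1" "card (part 1 T') = CARD('k) + CARD('c)"
      "part 1 T \<subseteq> part 1 T'" "part 0 T' \<subseteq> part 0 T"
      "card T = CARD('c) + 2 * CARD('k) + 1" "card T' = CARD('c) + 2 * CARD('k) + 1"
    using bad[of 0] card_index by (auto simp: bad_def nodes_def)
  have "T \<subseteq> layer 0 \<union> layer 1" "T' \<subseteq> layer 0 \<union> layer 1"
    by (rule subset_trans[OF T tight_layers], rule subset_trans[OF T' tight_layers])
  then have "card (part 0 T) = CARD('c) + CARD('k)" "card (part 0 T') = CARD('k) + 1"
    using b card_parts[of T] card_parts[of T'] by linarith+
  with no_bad_pair[OF x(2,1) T x'(2,1) T'] b show False by blast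
qed

text \<open>A fixed pair of tight sets that recurs infinitely often would produce two limit points
  contradicting \<open>no_bad_pair\<close>. Since there are only finitely many pairs, one threshold
  for \<open>n\<close> excludes all of them at once.\<close>

lemma ev_good: "\<forall>\<^sub>F n in sequentially. \<forall>P. \<not> bad n P"
proof -
  define I where "I = Pow (layer 0 \<union> layer 1 :: (nat \<times> (('c + 'k) + 'k option)) set)"
  have "finite (I \<times> I)" by (simp add: I_def layer_def)
  moreover have "\<forall>\<^sub>F n in sequentially. \<not> bad n P" for P
  proof (rule ccontr)
    assume "\<not> ?thesis"
    then obtain s where "strict_mono s" "\<And>n::nat. \<not> \<not> bad (s n) P"
      using not_eventually_sequentiallyD by blast
    then show False using not_always_bad by (cases P) blast
  qed
  ultimately have "\<forall>\<^sub>F n in sequentially. \<forall>P\<in>I \<times> I. \<not> bad n P"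
    by (intro eventually_ball_finite) auto
  moreover have "P \<in> I \<times> I" if "bad n P" for n P
    using that tight_layers by (cases P) (force simp: bad_def nodes_def I_def)
  ultimately show ?thesis by (elim eventually_mono) blast
qed

definition apex :: "nat \<Rightarrow> nat \<Rightarrow> ('w, 'k) lifted" where
  "apex \<kappa> n = (SOME X. snd X = 1 \<and> (\<forall>j. E n (\<kappa>, j) X = 0))"

lemma inj_E:
  assumes "\<kappa> \<le> 1" "\<forall>j. E n (\<kappa>, j) X = 0" "snd X = 0"
  shows "X = 0"
proof -
  obtain z t y y' \<tau> where X: "X = ((z, t, y, y'), \<tau>)" by (metis surj_pair)
  have \<tau>: "\<tau> = 0" using assms(3) by (simp add: X)
  show ?thesis
  proof (cases "\<kappa> = 0")
    case True
    then have "side av (\<epsilon> n) z (- t) t y y' j = 0" for j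
      using assms(2) by (auto simp: E_def ell_def X \<tau>)
    from A.apex_inj[OF \<epsilon>(1) this] show ?thesis by (simp add: X \<tau> zero_prod_def)
  next
    case False
    then have "side bv (\<epsilon> n) z t (- t) y' y j = 0" for j
      using assms(1,2) by (auto simp: E_def ell_def X \<tau>)
    from B.apex_inj[OF \<epsilon>(1) this] show ?thesis by (simp add: X \<tau> zero_prod_def)
  qed
qed

lemma dim_space: "DIM('w \<times> real \<times> (real^'k) \<times> (real^'k)) = CARD(('c + 'k) + 'k option)"
  using A.dimw by simp

lemma apex:
  assumes "\<kappa> \<le> 1"
  shows "snd (apex \<kappa> n) = 1" "E n (\<kappa>, j) (apex \<kappa> n) = 0"
proof -
  define \<Phi> :: "('w, 'k) lifted \<Rightarrow> (real^(('c + 'k) + 'k option)) \<times> real"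
    where "\<Phi> X = ((\<chi> j. E n (\<kappa>, j) X), snd X)" for X
  have "surj \<Phi>"
  proof (rule linear_inj_imp_surj)
    show "linear \<Phi>"
      unfolding \<Phi>_def[abs_def] using linear_add[OF linear_E] linear_scale[OF linear_E]
      by (intro linearI) (simp_all add: vec_eq_iff)
    show "X = 0" if "\<Phi> X = 0" for X
      using that inj_E[OF assms, of n X] by (simp add: \<Phi>_def zero_prod_def vec_eq_iff)
    show "DIM(('w \<times> real \<times> (real^'k) \<times> (real^'k)) \<times> real) = DIM((real^(('c + 'k) + 'k option)) \<times> real)"
      using dim_space by simp
  qed
  then obtain X where "\<Phi> X = (0, 1)" by (metis surjD)
  then have "snd X = 1" "\<forall>j. E n (\<kappa>, j) X = 0" by (simp_all add: \<Phi>_def vec_eq_iff)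
  then have "\<exists>X. snd X = 1 \<and> (\<forall>j. E n (\<kappa>, j) X = 0)" by blast
  from someI_ex[OF this] show "snd (apex \<kappa> n) = 1" "E n (\<kappa>, j) (apex \<kappa> n) = 0"
    unfolding apex_def by blast+
qed

lemma apex_tendsto:
  "apex 0 \<longlonglongrightarrow> ((0, 1, \<chi> k. 2 / (real CARD('k) + 1), 0), 1)"
  "apex 1 \<longlonglongrightarrow> ((0, -1, 0, \<chi> k. 2 / (real CARD('k) + 1)), 1)"
proof -
  define z t y y' where d: "z = (\<lambda>X :: ('w, 'k) lifted. fst (fst X))" "t = (\<lambda>X :: ('w, 'k) lifted. fst (snd (fst X)))"
    "y = (\<lambda>X :: ('w, 'k) lifted. fst (snd (snd (fst X))))" "y' = (\<lambda>X :: ('w, 'k) lifted. snd (snd (snd (fst X))))"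
  have eq: "apex \<kappa> = (\<lambda>n. ((z (apex \<kappa> n), t (apex \<kappa> n), y (apex \<kappa> n), y' (apex \<kappa> n)), 1))" if "\<kappa> \<le> 1" for \<kappa>
    by (rule ext) (simp add: d prod_eq_iff apex(1)[OF that])
  have s: "side av (\<epsilon> n) (z (apex 0 n)) (1 - t (apex 0 n)) (1 + t (apex 0 n)) (y (apex 0 n)) (y' (apex 0 n)) j = - r n 0 j" for n j
    using apex(2)[of 0 n j] apex(1)[of 0 n] by (simp add: E_def ell_def d case_prod_beta)
  have "\<bar>side av (\<epsilon> n) (z (apex 0 n)) (1 - t (apex 0 n)) (1 + t (apex 0 n)) (y (apex 0 n)) (y' (apex 0 n)) j\<bar> \<le> (\<epsilon> n)\<^sup>2" for n j
    unfolding s using r by simp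
  note L = A.apex_limit[OF \<epsilon> this]
  have "(\<lambda>n. 1 - (1 - t (apex 0 n))) \<longlonglongrightarrow> 1 - 0" by (intro tendsto_intros L) simp
  then have "(\<lambda>n. t (apex 0 n)) \<longlonglongrightarrow> 1" by simp
  then show "apex 0 \<longlonglongrightarrow> ((0, 1, \<chi> k. 2 / (real CARD('k) + 1), 0), 1)"
    by (subst eq, simp) (intro tendsto_Pair L tendsto_const; simp)
  have s': "side bv (\<epsilon> n) (z (apex 1 n)) (1 + t (apex 1 n)) (1 - t (apex 1 n)) (y' (apex 1 n)) (y (apex 1 n)) j = - r n 1 j" for n j
    using apex(2)[of 1 n j] apex(1)[of 1 n] by (simp add: E_def ell_def d case_prod_beta)
  have "\<bar>side bv (\<epsilon> n) (z (apex 1 n)) (1 + t (apex 1 n)) (1 - t (apex 1 n)) (y' (apex 1 n)) (y (apex 1 n)) j\<bar> \<le> (\<epsilon> n)\<^sup>2" for n j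
    unfolding s' using r by simp
  note L = B.apex_limit[OF \<epsilon> this]
  have "(\<lambda>n. (1 + t (apex 1 n)) - 1) \<longlonglongrightarrow> 0 - 1" by (intro tendsto_intros L) simp
  then have "(\<lambda>n. t (apex 1 n)) \<longlonglongrightarrow> -1" by simp
  then show "apex 1 \<longlonglongrightarrow> ((0, -1, 0, \<chi> k. 2 / (real CARD('k) + 1)), 1)"
    by (subst eq, simp) (intro tendsto_Pair L tendsto_const; simp)
qed

text \<open>The facets of the opposite layer are strictly positive at the limit of the apexes by
  \<open>apex_pos\<close>, hence also at the apexes for large \<open>n\<close>.\<close>

lemma ev_apex:
  assumes "\<kappa> \<le> 1"
  shows "\<forall>\<^sub>F n in sequentially. apex \<kappa> n \<in> hcone (E n) 1 \<and> tight (E n) 1 (apex \<kappa> n) = layer \<kappa>"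
proof -
  have "\<forall>\<^sub>F n in sequentially. 0 < E n (1 - \<kappa>, j) (apex \<kappa> n)" for j
  proof -
    consider "\<kappa> = 0" | "\<kappa> = 1" using assms by linarith
    then show ?thesis
    proof cases
      case 1
      have "(\<lambda>n. E (id n) (1, j) (apex 0 n)) \<longlonglongrightarrow> E0 (1, j) ((0, 1, \<chi> k. 2 / (real CARD('k) + 1), 0), 1)"
        by (intro tendsto_E apex_tendsto) (simp add: strict_mono_def)
      moreover have "0 < E0 (1, j) ((0, 1, \<chi> k. 2 / (real CARD('k) + 1), 0), 1)"
        unfolding E0_side(2)[OF refl] using apex_pos[of bv j] by simp
      ultimately show ?thesis using order_tendstoD(1) 1 by fastforce
    next
      case 2
      have "(\<lambda>n. E (id n) (0, j) (apex 1 n)) \<longlonglongrightarrow> E0 (0, j) ((0, -1, 0, \<chi> k. 2 / (real CARD('k) + 1)), 1)"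
        by (intro tendsto_E apex_tendsto) (simp add: strict_mono_def)
      moreover have "0 < E0 (0, j) ((0, -1, 0, \<chi> k. 2 / (real CARD('k) + 1)), 1)"
        unfolding E0_side(1)[OF refl] using apex_pos[of av j] by simp
      ultimately show ?thesis using order_tendstoD(1) 2 by fastforce
    qed
  qed
  then have "\<forall>\<^sub>F n in sequentially. \<forall>j. 0 < E n (1 - \<kappa>, j) (apex \<kappa> n)"
    by (rule eventually_all_finite)
  then show ?thesis
  proof (rule eventually_mono)
    fix n assume p: "\<forall>j. 0 < E n (1 - \<kappa>, j) (apex \<kappa> n)"
    have *: "E n (\<kappa>', j) (apex \<kappa> n) = 0 \<and> \<kappa>' = \<kappa> \<or> 0 < E n (\<kappa>', j) (apex \<kappa> n) \<and> \<kappa>' \<noteq> \<kappa>" if le: "\<kappa>' \<le> 1" for \<kappa>' j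
    proof -
      have "\<kappa>' = \<kappa> \<or> \<kappa>' = 1 - \<kappa> \<and> \<kappa>' \<noteq> \<kappa>" using le assms by arith
      then consider "\<kappa>' = \<kappa>" | "\<kappa>' = 1 - \<kappa>" "\<kappa>' \<noteq> \<kappa>" by blast
      then show ?thesis using p apex(2)[OF assms] by cases auto
    qed
    have "0 \<le> E n (\<kappa>', j) (apex \<kappa> n)" if "\<kappa>' \<le> 1" for \<kappa>' j
      using *[OF that, of j] by linarith
    then have "apex \<kappa> n \<in> hcone (E n) 1" by (simp add: hcone_def)
    moreover have "(\<kappa>', j) \<in> tight (E n) 1 (apex \<kappa> n) \<longleftrightarrow> (\<kappa>', j) \<in> layer \<kappa>" for \<kappa>' j
    proof (cases "\<kappa>' \<le> 1")
      case True
      show ?thesis using *[OF True, of j] True by (simp add: tight_def layer_def) linarith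
    next
      case False
      then show ?thesis using assms by (auto simp: tight_def layer_def)
    qed
    then have "tight (E n) 1 (apex \<kappa> n) = layer \<kappa>" by auto
    ultimately show "apex \<kappa> n \<in> hcone (E n) 1 \<and> tight (E n) 1 (apex \<kappa> n) = layer \<kappa>" by blast
  qed
qed

lemma spindle_exists:
  "\<exists>n g. spindle (E n) (CARD(('c + 'k) + 'k option) + 1) g (apex 0 n) (apex 1 n)"
proof -
  let ?D = "CARD(('c + 'k) + 'k option)"
  have "\<forall>\<^sub>F n in sequentially. (\<forall>X\<in>hcone (E n) 1. X \<noteq> 0 \<longrightarrow> snd X > 0) \<and> (\<forall>P. \<not> bad n P) \<and>
     (apex 0 n \<in> hcone (E n) 1 \<and> tight (E n) 1 (apex 0 n) = layer 0) \<and>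
     (apex 1 n \<in> hcone (E n) 1 \<and> tight (E n) 1 (apex 1 n) = layer 1)"
    by (intro eventually_conj ev_bounded ev_good ev_apex) simp_all
  then obtain n where n: "\<And>X. X \<in> hcone (E n) 1 \<Longrightarrow> X \<noteq> 0 \<Longrightarrow> snd X > 0" "\<And>P. \<not> bad n P"
      "apex 0 n \<in> hcone (E n) 1" "tight (E n) 1 (apex 0 n) = layer 0"
      "apex 1 n \<in> hcone (E n) 1" "tight (E n) 1 (apex 1 n) = layer 1"
    unfolding eventually_sequentially by blast
  have part: "card (T \<inter> layer \<kappa>) = card (part \<kappa> T)" "T \<inter> layer \<kappa> = Pair \<kappa> ` part \<kappa> T"
    for T :: "(nat \<times> (('c + 'k) + 'k option)) set" and \<kappa>
  proof -
    show eq: "T \<inter> layer \<kappa> = Pair \<kappa> ` part \<kappa> T" by (auto simp: part_def layer_def)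
    show "card (T \<inter> layer \<kappa>) = card (part \<kappa> T)" unfolding eq by (simp add: card_image inj_on_def)
  qed
  have sub: "part \<kappa> S \<subseteq> part \<kappa> T" if "S \<inter> layer \<kappa> \<subseteq> T \<inter> layer \<kappa>"
    for S T :: "(nat \<times> (('c + 'k) + 'k option)) set" and \<kappa>
    using that by (auto simp: part_def layer_def)
  have N: "card T = ?D \<and> T \<subseteq> layer 0 \<union> layer 1" if T: "T \<in> nodes (E n) 1" for T
  proof -
    obtain X where "card T = ?D" "tight (E n) 1 X = T" using T unfolding nodes_def by blast
    then show ?thesis using tight_layers[of "E n" X] by simp
  qed
  \<comment> \<open>The levels \<open>k + 1\<close> and \<open>k + c\<close> of the potential are
    those of \<open>bad\<close>: after deducting the \<open>CARD('k)\<close> contributed by the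
    wedge coordinates they mean one tie and \<open>CARD('c)\<close> ties of
    \<open>bv\<close>.\<close>
  have kc: "CARD('k) + CARD('c) < ?D" "1 \<le> CARD('c)" unfolding card_index by simp_all
  obtain g where g: "\<And>T T'. T \<in> nodes (E n) 1 \<Longrightarrow> T' \<in> nodes (E n) 1 \<Longrightarrow> ?D \<le> card (T \<inter> T') + 1 \<Longrightarrow> g T \<le> g T' + 1"
    "\<And>T. T \<in> nodes (E n) 1 \<Longrightarrow> g T \<le> ?D + 1" "g (layer 0) = 0" "g (layer 1) = ?D + 1"
  proof (rule potential_exists[OF N kc])
    show False if "S \<in> nodes (E n) 1" "T \<in> nodes (E n) 1" "card (S \<inter> layer 1) = CARD('k) + 1"
      "card (T \<inter> layer 1) = CARD('k) + CARD('c)" "S \<inter> layer 1 \<subseteq> T \<inter> layer 1" "T \<inter> layer 0 \<subseteq> S \<inter> layer 0" for S T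
    proof -
      have "bad n (S, T)"
        unfolding bad_def prod.case using that part(1) sub by (intro conjI) simp_all
      then show False using n(2) by blast
    qed
  qed (assumption | rule that)+
  have "spindle (E n) (?D + 1) g (apex 0 n) (apex 1 n)"
  proof (rule spindle.intro)
    show "linear (E n j)" for j by (rule linear_E)
    show "DIM('w \<times> real \<times> (real^'k) \<times> (real^'k)) = ?D" by (rule dim_space)
    show "card (tight (E n) 1 X) \<le> ?D" if "X \<in> hcone (E n) 1" "X \<noteq> 0" for X
      unfolding E_def using n(1)[OF that] by (intro generic) simp
    show "X = 0" if "\<kappa> \<le> 1" "\<forall>j. E n (\<kappa>, j) X = 0" "snd X = 0" for X \<kappa>
      by (rule inj_E[OF that])
  qed (fact n g)+
  then show ?thesis by blast
qed

end

context config
begin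

theorem spindle_exists:
  "\<exists>(m :: nat \<times> (('c + 'k) + 'k option) \<Rightarrow> ('w, 'k) lifted \<Rightarrow> real) g a b.
    spindle m (CARD(('c + 'k) + 'k option) + 1) g a b"
proof -
  define \<epsilon> where "\<epsilon> n = inverse (real (Suc n))" for n
  have \<epsilon>: "\<epsilon> n > 0" "\<epsilon> \<longlonglongrightarrow> 0" for n
    using LIMSEQ_inverse_real_of_nat by (simp_all add: \<epsilon>_def[abs_def])
  \<comment> \<open>Generic shifts are indexed by a finite type, so \<open>bool\<close> replaces the
    layer number: \<open>True\<close> is layer 0 and \<open>False\<close> is layer 1.\<close>
  define num where "num = (\<lambda>b. if b then 0 else 1 :: nat)"
  define f where "f n i = ell av bv (\<epsilon> n) (\<lambda>_ _. 0) (num (fst i), snd i)" for n and i :: "bool \<times> (('c + 'k) + 'k option)"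
  define G where "G n \<rho> \<longleftrightarrow> (\<forall>i. \<bar>\<rho> $ i\<bar> \<le> (\<epsilon> n)\<^sup>2) \<and>
      (\<forall>X. snd X \<noteq> 0 \<longrightarrow> card {i. f n i X + \<rho> $ i * snd X = 0} < DIM(('w, 'k) lifted))"
    for n and \<rho> :: "real^(bool \<times> (('c + 'k) + 'k option))"
  have "\<exists>\<rho>. G n \<rho>" for n
  proof -
    have f: "linear (f n i)" for i unfolding f_def by (rule linear_ell)
    obtain \<rho> :: "real^(bool \<times> (('c + 'k) + 'k option))" where "\<And>i. \<bar>\<rho> $ i\<bar> \<le> (\<epsilon> n)\<^sup>2"
      "\<And>X. snd X \<noteq> 0 \<Longrightarrow> card {i. f n i X + \<rho> $ i * snd X = 0} < DIM(('w, 'k) lifted)"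
    proof (rule generic_shift[of "f n" snd "(0, 1)" "(\<epsilon> n)\<^sup>2"])
      show "linear (f n i)" for i by (rule f)
      show "linear (snd :: ('w, 'k) lifted \<Rightarrow> real)" by (rule linear_snd)
      show "0 < (\<epsilon> n)\<^sup>2" using \<epsilon>(1)[of n] by simp
      show "snd ((0, 1) :: ('w, 'k) lifted) \<noteq> 0" by simp
    qed (rule that)
    then show ?thesis unfolding G_def by blast
  qed
  then obtain \<rho> where "\<And>n. G n (\<rho> n)" by metis
  then have \<rho>: "\<And>n i. \<bar>\<rho> n $ i\<bar> \<le> (\<epsilon> n)\<^sup>2"
      "\<And>n X. snd X \<noteq> 0 \<Longrightarrow> card {i. f n i X + \<rho> n $ i * snd X = 0} < DIM(('w, 'k) lifted)"
    unfolding G_def by blast+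
  define r where "r n \<kappa> j = \<rho> n $ (\<kappa> = 0, j)" for n and \<kappa> :: nat and j
  interpret sequence av bv \<epsilon> r
  proof
    show "\<epsilon> n > 0" "\<epsilon> \<longlonglongrightarrow> 0" for n by (rule \<epsilon>)+
    show "\<bar>r n \<kappa> j\<bar> \<le> (\<epsilon> n)\<^sup>2" for n \<kappa> j by (simp add: r_def \<rho>)
    show "card (tight (ell av bv (\<epsilon> n) (r n)) 1 X) \<le> CARD(('c + 'k) + 'k option)" if "snd X \<noteq> 0" for n X
    proof -
      have e: "ell av bv (\<epsilon> n) (r n) (\<kappa>, j) X = f n (\<kappa> = 0, j) X + \<rho> n $ (\<kappa> = 0, j) * snd X" if "\<kappa> \<le> 1" for \<kappa> j
        using that by (cases X) (auto simp: ell_def f_def r_def num_def case_prod_beta)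
      have "tight (ell av bv (\<epsilon> n) (r n)) 1 X \<subseteq> (\<lambda>(b, j). (num b, j)) ` {i. f n i X + \<rho> n $ i * snd X = 0}"
      proof
        fix i assume i: "i \<in> tight (ell av bv (\<epsilon> n) (r n)) 1 X"
        obtain \<kappa> j where ij: "i = (\<kappa>, j)" by (cases i)
        have "\<kappa> \<le> 1" "f n (\<kappa> = 0, j) X + \<rho> n $ (\<kappa> = 0, j) * snd X = 0"
          using i e[of \<kappa> j] by (auto simp: tight_def ij)
        then show "i \<in> (\<lambda>(b, j). (num b, j)) ` {i. f n i X + \<rho> n $ i * snd X = 0}"
          by (intro image_eqI[of _ _ "(\<kappa> = 0, j)"]) (auto simp: ij num_def)
      qed
      then have "card (tight (ell av bv (\<epsilon> n) (r n)) 1 X) \<le> card {i. f n i X + \<rho> n $ i * snd X = 0}"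
        by (rule surj_card_le[OF finite])
      moreover have "card {i. f n i X + \<rho> n $ i * snd X = 0} < DIM(('w, 'k) lifted)" by (rule \<rho>(2)[OF that])
      moreover have "DIM(('w, 'k) lifted) = CARD(('c + 'k) + 'k option) + 1" using A.dimw by simp
      ultimately show ?thesis by linarith
    qed
  qed
  obtain n g where "spindle (E n) (CARD(('c + 'k) + 'k option) + 1) g (apex 0 n) (apex 1 n)"
    using spindle_exists by blast
  then show ?thesis by (intro exI)
qed

end

section \<open>From cones to polytopes\<close>

lemma linear_functional_inner:
  fixes f :: "'v::euclidean_space \<Rightarrow> real"
  assumes "linear f"
  shows "f x = adjoint f 1 \<bullet> x"
  using adjoint_works[OF assms, of x 1] by (simp add: inner_commute)

locale slice =
  fixes h :: "'j \<Rightarrow> 'v::euclidean_space \<Rightarrow> real" and J :: "'j set" and e :: "'v \<Rightarrow> real"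
  assumes fin: "finite J" and lin: "\<And>j. linear (h j)" and lin_e: "linear e"
    and e_pos: "\<And>X. (\<forall>j\<in>J. 0 \<le> h j X) \<Longrightarrow> X \<noteq> 0 \<Longrightarrow> e X > 0"
begin

definition S where "S = {X. (\<forall>j\<in>J. 0 \<le> h j X) \<and> e X = 1}"
definition tt where "tt X = {j \<in> J. h j X = 0}"
text \<open>The direction space of the face \<open>F T\<close> whenever \<open>T\<close> is the full
  tight set of one of its points; see \<open>dim_diffs\<close>.\<close>

definition W where "W T = {w. e w = 0 \<and> (\<forall>j\<in>T. h j w = 0)}"
definition F where "F T = {X \<in> S. \<forall>j\<in>T. h j X = 0}"

lemma subspace_W: "subspace (W T)"
  by (auto simp: W_def subspace_def linear_0[OF lin] linear_0[OF lin_e] linear_add[OF lin] linear_add[OF lin_e]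
      linear_scale[OF lin] linear_scale[OF lin_e])

lemma convex_F: "convex (F T)"
  unfolding F_def S_def
  by (intro convexI) (simp add: linear_add[OF lin] linear_add[OF lin_e] linear_scale[OF lin] linear_scale[OF lin_e])

lemma F_empty: "F {} = S"
  by (simp add: F_def)

lemma finite_tt: "finite (tt X)"
  using fin by (simp add: tt_def)

lemma face_F:
  assumes "T \<subseteq> J"
  shows "F T face_of S"
  unfolding face_of_def
proof (intro conjI ballI impI)
  show "F T \<subseteq> S" by (auto simp: F_def)
  show "convex (F T)" by (rule convex_F)
  fix a b x assume ab: "a \<in> S" "b \<in> S" and x: "x \<in> F T" "x \<in> open_segment a b"
  then obtain u where u: "0 < u" "u < 1" "x = (1 - u) *\<^sub>R a + u *\<^sub>R b" by (auto simp: in_segment)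
  have *: "h j a = 0 \<and> h j b = 0" if "j \<in> T" for j
  proof -
    have "0 \<le> h j a" "0 \<le> h j b" using ab that assms by (auto simp: S_def)
    moreover have "(1 - u) * h j a + u * h j b = 0"
      using x(1) that by (simp add: F_def u(3) linear_add[OF lin] linear_scale[OF lin])
    ultimately show ?thesis using u(1,2)
      by (smt (verit, best) mult_nonneg_nonneg mult_eq_0_iff)
  qed
  show "a \<in> F T" "b \<in> F T" using ab * by (auto simp: F_def)
qed

lemma nudge:
  assumes x: "x \<in> S" and w: "w \<in> W (tt x)"
  obtains \<delta> where "\<delta> > 0" "x + \<delta> *\<^sub>R w \<in> F (tt x)"
proof -
  have "\<forall>\<^sub>F \<delta> in at_right 0. 0 \<le> h j (x + \<delta> *\<^sub>R w)" if j: "j \<in> J" for j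
  proof (cases "j \<in> tt x")
    case True
    then show ?thesis using w by (simp add: tt_def W_def linear_add[OF lin] linear_scale[OF lin])
  next
    case False
    then have "h j x > 0" using x j by (force simp: S_def tt_def)
    moreover have "((\<lambda>\<delta>. h j x + \<delta> * h j w) \<longlongrightarrow> h j x + 0 * h j w) (at_right 0)"
      by (intro tendsto_intros)
    ultimately have "\<forall>\<^sub>F \<delta> in at_right 0. 0 < h j x + \<delta> * h j w"
      by (intro order_tendstoD(1)) auto
    then show ?thesis
      by (rule eventually_mono) (simp add: linear_add[OF lin] linear_scale[OF lin])
  qed
  then have "\<forall>\<^sub>F \<delta> in at_right 0. \<forall>j\<in>J. 0 \<le> h j (x + \<delta> *\<^sub>R w)"
    using fin by (intro eventually_ball_finite) auto
  moreover have "\<forall>\<^sub>F \<delta> in at_right (0::real). 0 < \<delta>" by (rule eventually_at_right_less)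
  ultimately have "\<forall>\<^sub>F \<delta> in at_right 0. 0 < \<delta> \<and> (\<forall>j\<in>J. 0 \<le> h j (x + \<delta> *\<^sub>R w))"
    by (rule eventually_elim2) simp
  then obtain \<delta> where \<delta>: "0 < \<delta>" "\<forall>j\<in>J. 0 \<le> h j (x + \<delta> *\<^sub>R w)"
    using eventually_happens'[OF trivial_limit_at_right_real] by blast
  have "x + \<delta> *\<^sub>R w \<in> F (tt x)"
    using x w \<delta>(2) by (auto simp: F_def S_def W_def tt_def linear_add[OF lin] linear_add[OF lin_e]
        linear_scale[OF lin] linear_scale[OF lin_e])
  with \<delta>(1) show ?thesis by (rule that)
qed

lemma in_F_tt: "x \<in> S \<Longrightarrow> x \<in> F (tt x)"
  by (simp add: F_def tt_def)

text \<open>A point \<open>x\<close> of the face with the fewest tight constraints is relatively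
  interior. The midpoint of \<open>x\<close> and another point of the face has the intersection of
  their tight sets, so minimality gives one inclusion; prolonging the segment from \<open>y\<close>
  through \<open>x\<close> gives the other by the face property.\<close>

lemma face_eq:
  assumes G: "G face_of S" "G \<noteq> {}"
  obtains x where "x \<in> G" "x \<in> S" "G = F (tt x)"
proof -
  have GS: "G \<subseteq> S" and conv: "convex G" using G(1) by (auto simp: face_of_def)
  obtain x where x: "x \<in> G" "\<And>y. y \<in> G \<Longrightarrow> card (tt x) \<le> card (tt y)"
    using ex_has_least_nat[of "\<lambda>x. x \<in> G" _ "\<lambda>x. card (tt x)"] G(2) by blast
  have "y \<in> F (tt x)" if y: "y \<in> G" for y
  proof -
    define m where "m = (1/2) *\<^sub>R x + (1/2) *\<^sub>R y"
    have "m \<in> G" unfolding m_def using conv x(1) y by (intro convexD) auto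
    have hm: "h j m = (h j x + h j y) / 2" for j
      by (simp add: m_def linear_add[OF lin] linear_scale[OF lin])
    have nn: "0 \<le> h j x" "0 \<le> h j y" if "j \<in> J" for j
      using that GS x(1) y by (auto simp: S_def)
    have "h j m = 0 \<longleftrightarrow> h j x = 0 \<and> h j y = 0" if "j \<in> J" for j
      using nn[OF that] unfolding hm by (simp add: add_nonneg_eq_0_iff)
    then have tm: "tt m = tt x \<inter> tt y" by (auto simp: tt_def)
    have "card (tt x) \<le> card (tt x \<inter> tt y)" using x(2)[OF \<open>m \<in> G\<close>] tm by simp
    then have "tt x \<inter> tt y = tt x"
      using card_seteq[OF finite_tt[of x], of "tt x \<inter> tt y"] by simp
    then show ?thesis using GS y by (auto simp: F_def tt_def)
  qed
  moreover have "y \<in> G" if y: "y \<in> F (tt x)" for y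
  proof (cases "y = x")
    case False
    have yS: "y \<in> S" and xS: "x \<in> S" using y x(1) GS by (auto simp: F_def)
    have "x - y \<in> W (tt x)"
      using y xS by (auto simp: F_def S_def W_def tt_def linear_diff[OF lin] linear_diff[OF lin_e])
    then obtain \<delta> where \<delta>: "\<delta> > 0" "x + \<delta> *\<^sub>R (x - y) \<in> F (tt x)"
      using nudge[OF xS] by blast
    \<comment> \<open>The point beyond \<open>x\<close> as seen from \<open>y\<close>; the ratio
      \<open>inverse (1 + \<delta>)\<close> below expresses \<open>x\<close> as an inner point of
      the segment from \<open>y\<close> to \<open>z\<close>.\<close>
    define z where "z = x + \<delta> *\<^sub>R (x - y)"
    have zS: "z \<in> S" using \<delta>(2) by (simp add: z_def F_def)
    define t where "t = inverse (1 + \<delta>)"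
    have t: "0 < t" "t < 1" "t * (1 + \<delta>) = 1" using \<delta>(1) by (simp_all add: t_def inverse_less_1_iff)
    have "(1 - t) *\<^sub>R y + t *\<^sub>R z = (1 - t * (1 + \<delta>)) *\<^sub>R y + (t * (1 + \<delta>)) *\<^sub>R x"
      by (simp add: z_def algebra_simps)
    then have xe: "x = (1 - t) *\<^sub>R y + t *\<^sub>R z" using t(3) by simp
    have "z \<noteq> y"
    proof
      assume "z = y"
      then have "x = y" using xe by (simp add: algebra_simps)
      then show False using False by simp
    qed
    then have "x \<in> open_segment y z" using xe t unfolding in_segment by metis
    then show ?thesis using G(1) yS zS x(1) unfolding face_of_def by blast
  qed (use x(1) in simp)
  ultimately have "G = F (tt x)" by blast
  with x(1) GS show ?thesis by (intro that[of x]) auto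
qed

lemma dim_diffs:
  assumes x: "x \<in> S"
  shows "dim {a - b |a b. a \<in> F (tt x) \<and> b \<in> F (tt x)} = dim (W (tt x))"
proof -
  let ?D = "{a - b |a b. a \<in> F (tt x) \<and> b \<in> F (tt x)}"
  have "?D \<subseteq> W (tt x)"
    by (auto simp: F_def S_def W_def linear_diff[OF lin] linear_diff[OF lin_e])
  moreover have "W (tt x) \<subseteq> span ?D"
  proof
    fix w assume "w \<in> W (tt x)"
    then obtain \<delta> where \<delta>: "\<delta> > 0" "x + \<delta> *\<^sub>R w \<in> F (tt x)" by (rule nudge[OF x])
    then have "(x + \<delta> *\<^sub>R w) - x \<in> span ?D" using in_F_tt[OF x] by (intro span_base) blast
    then have "inverse \<delta> *\<^sub>R ((x + \<delta> *\<^sub>R w) - x) \<in> span ?D" by (rule span_scale)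
    then show "w \<in> span ?D" using \<delta>(1) by simp
  qed
  ultimately have "dim ?D \<le> dim (W (tt x))" "dim (W (tt x)) \<le> dim (span ?D)"
    by (simp_all only: dim_subset)
  then show ?thesis by simp
qed

lemma affine_dim_F:
  assumes "x \<in> S"
  shows "affine_dim (F (tt x)) = int (dim (W (tt x)))"
  using in_F_tt[OF assms] dim_diffs[OF assms] by (auto simp: affine_dim_def)

text \<open>\<open>W T\<close> is the orthogonal complement of the vectors representing
  \<open>e\<close> and the constraints in \<open>T\<close>, and each vector costs at most one
  dimension.\<close>

lemma dim_W:
  assumes "finite T"
  shows "DIM('v) \<le> dim (W T) + card T + 1"
proof -
  define vec where "vec f = adjoint f 1" for f :: "'v \<Rightarrow> real"
  have vec: "f x = vec f \<bullet> x" if "linear f" for f :: "'v \<Rightarrow> real" and x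
    using linear_functional_inner[OF that] by (simp add: vec_def)
  define A where "A = insert (vec e) (vec ` h ` T)"
  have W: "W T = {y \<in> UNIV. \<forall>x\<in>span A. orthogonal x y}"
  proof (intro equalityI subsetI)
    fix y assume "y \<in> W T"
    then have "x \<bullet> y = 0" if "x \<in> A" for x
      using that by (auto simp: A_def W_def vec[OF lin_e] vec[OF lin])
    then have "orthogonal y x" if "x \<in> span A" for x
      using that orthogonal_to_span[of x A y] by (auto simp: orthogonal_def inner_commute)
    then show "y \<in> {y \<in> UNIV. \<forall>x\<in>span A. orthogonal x y}" by (simp add: orthogonal_commute)
  next
    fix y assume "y \<in> {y \<in> UNIV. \<forall>x\<in>span A. orthogonal x y}"
    then have "x \<bullet> y = 0" if "x \<in> A" for x using that by (simp add: span_base orthogonal_def)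
    then show "y \<in> W T" by (simp add: W_def vec[OF lin_e] vec[OF lin] A_def)
  qed
  have "dim (W T) + dim (span A) = DIM('v)"
    unfolding W using dim_subspace_orthogonal_to_vectors[of "span A" UNIV] by simp
  moreover have "dim (span A) \<le> card A" using assms dim_le_card'[of A] by (simp add: A_def)
  moreover have "card A \<le> card T + 1"
    using assms card_insert_le_m1[of "card T + 1" "vec ` h ` T" "vec e"] card_image_le[of "h ` T" vec] card_image_le[of T h]
    unfolding A_def by (simp add: card_insert_if)
  ultimately show ?thesis by linarith
qed

text \<open>Boundedness comes from the cone: \<open>e\<close> has a positive minimum on its unit
  vectors, so \<open>e x = 1\<close> bounds the norm of \<open>x\<close>.\<close>

lemma polytope_S: "polytope S"
proof -
  define vec where "vec f = adjoint f 1" for f :: "'v \<Rightarrow> real"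
  have vec: "f x = vec f \<bullet> x" if "linear f" for f :: "'v \<Rightarrow> real" and x
    using linear_functional_inner[OF that] by (simp add: vec_def)
  have "S = \<Inter> (insert {x. vec e \<bullet> x \<le> 1} (insert {x. vec e \<bullet> x \<ge> 1} ((\<lambda>j. {x. vec (h j) \<bullet> x \<ge> 0}) ` J)))"
    by (auto simp: S_def vec[OF lin_e, symmetric] vec[OF lin, symmetric])
  moreover have "polyhedron \<dots>"
    using fin by (intro polyhedron_Inter) (auto simp: polyhedron_halfspace_le polyhedron_halfspace_ge)
  ultimately have "polyhedron S" by simp
  moreover have "bounded S"
  proof (cases "S = {}")
    case False
    then obtain x0 where x0: "x0 \<in> S" by blast
    define K where "K = sphere 0 1 \<inter> (\<Inter>j\<in>J. {x. 0 \<le> h j x})"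
    have nz: "x \<noteq> 0" if "x \<in> S" for x using that linear_0[OF lin_e] by (auto simp: S_def)
    have inK: "x /\<^sub>R norm x \<in> K" if "x \<in> S" for x
      using nz[OF that] that by (auto simp: K_def S_def linear_scale[OF lin])
    have cont: "continuous_on UNIV f" if "linear f" for f :: "'v \<Rightarrow> real"
      using that by (simp add: linear_continuous_on linear_conv_bounded_linear)
    have "closed {x. 0 \<le> h j x}" for j
      by (intro closed_Collect_le continuous_intros cont lin)
    then have "compact K" unfolding K_def by (intro compact_Int_closed closed_INT) auto
    moreover have "K \<noteq> {}" using inK[OF x0] by blast
    ultimately obtain y where y: "y \<in> K" "\<And>x. x \<in> K \<Longrightarrow> e y \<le> e x"
      using continuous_attains_inf[of K e] continuous_on_subset[OF cont[OF lin_e]] by blast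
    have "e y > 0" using y(1) by (intro e_pos) (auto simp: K_def)
    have "norm x \<le> 1 / e y" if "x \<in> S" for x
    proof -
      have "e y \<le> e (x /\<^sub>R norm x)" by (rule y(2)[OF inK[OF that]])
      also have "\<dots> = 1 / norm x" using that by (simp add: linear_scale[OF lin_e] S_def field_simps)
      finally show ?thesis using \<open>e y > 0\<close> nz[OF that] by (simp add: field_simps)
    qed
    then show ?thesis by (auto simp: bounded_iff)
  qed simp
  ultimately show ?thesis by (simp add: polytope_eq_bounded_polyhedron)
qed

lemma vertex_tight:
  assumes "w \<in> polytope_vertices S"
  shows "w \<in> S" "DIM('v) \<le> card (tt w) + 1"
proof -
  have w: "w extreme_point_of S" using assms by (simp add: polytope_vertices_def)
  then show wS: "w \<in> S" by (simp add: extreme_point_of_def)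
  have "{w} face_of S" using w by (simp add: face_of_singleton)
  then obtain x where x: "x \<in> {w}" "{w} = F (tt x)" by (rule face_eq) auto
  then have "F (tt w) = {w}" by (metis singletonD)
  then have "{a - b |a b. a \<in> F (tt w) \<and> b \<in> F (tt w)} = {0}" by auto
  then have "dim (W (tt w)) = 0" using dim_diffs[OF wS] by simp
  then show "DIM('v) \<le> card (tt w) + 1" using dim_W[OF finite_tt[of w]] by linarith
qed

lemma vertexI:
  assumes x: "x \<in> S" and W: "W (tt x) \<subseteq> {0}"
  shows "x \<in> polytope_vertices S"
proof -
  have "y = x" if "y \<in> F (tt x)" for y
  proof -
    have "y - x \<in> W (tt x)"
      using that x by (auto simp: F_def S_def W_def tt_def linear_diff[OF lin] linear_diff[OF lin_e])
    then show ?thesis using W by auto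
  qed
  then have "F (tt x) = {x}" using in_F_tt[OF x] by blast
  moreover have "F (tt x) face_of S" by (rule face_F) (auto simp: tt_def)
  ultimately show ?thesis by (simp add: face_of_singleton polytope_vertices_def)
qed

lemma edge_tight:
  assumes "(u, w) \<in> polytope_adj S"
  shows "DIM('v) \<le> card (tt u \<inter> tt w) + 2"
proof -
  obtain G where G: "is_edge_of G S" "u \<in> G" "w \<in> G" using assms by (auto simp: polytope_adj_def)
  then obtain x where x: "x \<in> S" "G = F (tt x)"
    using face_eq[of G] by (auto simp: is_edge_of_def)
  have "dim (W (tt x)) = 1" using G(1) affine_dim_F[OF x(1)] by (simp add: is_edge_of_def x(2))
  then have "DIM('v) \<le> card (tt x) + 2" using dim_W[OF finite_tt[of x]] by simp
  also have "card (tt x) \<le> card (tt u \<inter> tt w)"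
  proof (rule card_mono)
    show "finite (tt u \<inter> tt w)" using finite_tt by simp
    show "tt x \<subseteq> tt u \<inter> tt w" using G(2,3) by (auto simp: x(2) F_def tt_def)
  qed
  finally show ?thesis by simp
qed

text \<open>A point where only \<open>j\<close> is tight shows that \<open>F {j}\<close> has
  codimension one and that different \<open>j\<close> give different faces. Conversely, if
  \<open>F (tt x)\<close> has codimension one and \<open>j\<close> is tight at \<open>x\<close>, its
  direction space is that of \<open>F {j}\<close>; a point with tight set \<open>{j}\<close> then
  has all of \<open>tt x\<close> tight, so \<open>tt x = {j}\<close>.\<close>

lemma facets:
  assumes x0: "x0 \<in> S" "tt x0 = {}" and xj: "\<And>j. j \<in> J \<Longrightarrow> \<exists>x\<in>S. tt x = {j}"
  shows "affine_dim S = int DIM('v) - 1" "card {G. is_facet_of G S} = card J"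
proof -
  have "e x0 = 1" using x0 by (simp add: S_def)
  have dim0: "dim (W {}) + 1 = DIM('v)"
  proof -
    have "x0 \<notin> W {}" using \<open>e x0 = 1\<close> by (simp add: W_def)
    moreover have "span (W {}) = W {}" by (simp only: span_eq_iff subspace_W)
    ultimately have "span (W {}) \<noteq> UNIV" by blast
    then have "dim (W {}) \<noteq> DIM('v)" using dim_eq_full[of "W {}"] by simp
    then show ?thesis using dim_W[of "{}"] dim_subset_UNIV[of "W {}"] by simp
  qed
  show aff: "affine_dim S = int DIM('v) - 1"
    using affine_dim_F[OF x0(1)] dim0 by (simp add: x0(2) F_empty)
  have strict: "dim (W {j}) + 2 = DIM('v)" if j: "j \<in> J" for j
  proof -
    obtain x where x: "x \<in> S" "tt x = {j}" using xj[OF j] by blast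
    have "h j x = 0" "h j x0 \<noteq> 0" using x x0 j by (auto simp: tt_def)
    then have "x0 - x \<in> W {} - W {j}"
      using x x0 by (simp add: W_def S_def linear_diff[OF lin] linear_diff[OF lin_e])
    moreover have "W {j} \<subseteq> W {}" by (auto simp: W_def)
    ultimately have "dim (W {j}) \<noteq> dim (W {})"
      using subspace_dim_equal[OF subspace_W subspace_W, of "{j}" "{}"] by auto
    moreover have "dim (W {j}) \<le> dim (W {})" using \<open>W {j} \<subseteq> W {}\<close> by (rule dim_subset)
    ultimately show ?thesis using dim0 dim_W[of "{j}"] by simp
  qed
  have "{G. is_facet_of G S} = (\<lambda>j. F {j}) ` J"
  proof (intro equalityI subsetI)
    fix G assume "G \<in> {G. is_facet_of G S}"
    then have G: "G face_of S" "G \<noteq> {}" "affine_dim G = affine_dim S - 1" by (auto simp: is_facet_of_def)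
    obtain x where x: "x \<in> G" "x \<in> S" "G = F (tt x)" by (rule face_eq[OF G(1,2)])
    have dimG: "dim (W (tt x)) + 2 = DIM('v)"
    proof -
      have "affine_dim G = int (dim (W (tt x)))" unfolding x(3) by (rule affine_dim_F[OF x(2)])
      then show ?thesis using G(3) aff by linarith
    qed
    have "tt x \<noteq> {}" using dimG dim0 by auto
    then obtain j where j: "j \<in> tt x" by blast
    have jJ: "j \<in> J" using j by (simp add: tt_def)
    have "W (tt x) \<subseteq> W {j}" using j by (auto simp: W_def)
    then have WW: "W (tt x) = W {j}"
      using dimG strict[OF jJ] by (intro subspace_dim_equal subspace_W) simp_all
    obtain y where y: "y \<in> S" "tt y = {j}" using xj[OF jJ] by blast
    have "y - x \<in> W {j}"
      using y x(2) j by (auto simp: W_def S_def tt_def linear_diff[OF lin] linear_diff[OF lin_e])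
    then have "y - x \<in> W (tt x)" using WW by simp
    then have "h k y = 0" if "k \<in> tt x" for k
      using that by (simp add: W_def tt_def linear_diff[OF lin])
    then have "tt x \<subseteq> tt y" by (auto simp: tt_def)
    then have "tt x = {j}" using y(2) j by blast
    then show "G \<in> (\<lambda>j. F {j}) ` J" using x(3) jJ by auto
  next
    fix G assume "G \<in> (\<lambda>j. F {j}) ` J"
    then obtain j where j: "j \<in> J" "G = F {j}" by blast
    obtain x where x: "x \<in> S" "tt x = {j}" using xj[OF j(1)] by blast
    have "affine_dim G = affine_dim S - 1"
      using affine_dim_F[OF x(1)] strict[OF j(1)] aff by (simp add: x(2) j(2))
    moreover have "G \<noteq> {}" using in_F_tt[OF x(1)] by (auto simp: x(2) j(2))
    moreover have "G face_of S" using j by (simp add: face_F)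
    ultimately show "G \<in> {G. is_facet_of G S}" by (simp add: is_facet_of_def)
  qed
  moreover have "inj_on (\<lambda>j. F {j}) J"
  proof
    fix i j assume i: "i \<in> J" and j: "j \<in> J" and eq: "F {i} = F {j}"
    obtain x where x: "x \<in> S" "tt x = {i}" using xj[OF i] by blast
    then have "x \<in> F {j}" using in_F_tt[OF x(1)] eq by simp
    then have "j \<in> tt x" using j by (simp add: F_def tt_def)
    then show "i = j" using x by simp
  qed
  ultimately show "card {G. is_facet_of G S} = card J" by (simp add: card_image)
qed

end

text \<open>A lower bound for the diameter is certified by a function \<open>\<phi>\<close> that changes by at most one
  along every edge.\<close>

lemma (in chain) polytope_exists:
  "\<exists>(P :: 'v set) \<phi> p q. polytope P \<and> affine_dim P = int CARD('i) \<and>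
    card {F. is_facet_of F P} = Suc K * CARD('i) \<and> p \<in> polytope_vertices P \<and> q \<in> polytope_vertices P \<and>
    \<phi> p = (0::nat) \<and> \<phi> q = L \<and> (\<forall>(x, y)\<in>polytope_adj P. \<phi> y \<le> \<phi> x + 1)"
proof -
  define J where "J = {..K} \<times> (UNIV :: 'i set)"
  \<comment> \<open>The sum of all constraints is a suitable normalizing functional: where it
    vanishes all \<open>Suc K * CARD('i)\<close> constraints are tight, more than
    \<open>simple\<close> permits at a nonzero point.\<close>
  define e where "e X = (\<Sum>j\<in>J. l j X)" for X
  have hc: "X \<in> hcone l K \<longleftrightarrow> (\<forall>j\<in>J. 0 \<le> l j X)" for X
    by (auto simp: hcone_def J_def)
  have tJ: "tight l K X = {j \<in> J. l j X = 0}" for X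
    by (auto simp: tight_def J_def)
  have cJ: "card J = Suc K * CARD('i)" by (simp add: J_def card_cartesian_product)
  have cpos: "0 < CARD('i)" by simp
  have finJ: "finite J" by (simp add: J_def)
  have lin_e: "linear e"
    unfolding e_def by (intro linearI) (simp_all add: linear_add[OF lin] linear_scale[OF lin] sum.distrib sum_distrib_left)
  have e_pos: "e X > 0" if X: "\<forall>j\<in>J. 0 \<le> l j X" "X \<noteq> 0" for X
  proof (rule ccontr)
    assume "\<not> e X > 0"
    then have "e X = 0" using X(1) sum_nonneg[of J "\<lambda>j. l j X"] by (simp add: e_def)
    moreover have "(\<Sum>j\<in>J. l j X) = 0 \<longleftrightarrow> (\<forall>j\<in>J. l j X = 0)"
      using sum_nonneg_eq_0_iff[OF finJ, of "\<lambda>j. l j X"] X(1) by blast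
    ultimately have "\<forall>j\<in>J. l j X = 0" unfolding e_def by blast
    then have "tight l K X = J" by (auto simp: tJ)
    then have "Suc K * CARD('i) \<le> CARD('i)" using simple[of X] X hc cJ by metis
    then show False using K cpos by simp
  qed
  interpret slice l J e
  proof
    show "finite J" by (simp add: J_def)
  qed (use lin lin_e e_pos in \<open>auto simp: linear_iff\<close>)
  have tt: "tt X = tight l K X" for X by (simp add: tt_def tJ)
  define nrm where "nrm X = X /\<^sub>R e X" for X
  have nrm: "nrm X \<in> S" "tt (nrm X) = tight l K X" if X: "X \<in> hcone l K" "X \<noteq> 0" for X
  proof -
    have "e X > 0" using e_pos X hc by blast
    then show "nrm X \<in> S" using X(1) by (simp add: nrm_def S_def hc linear_scale[OF lin] linear_scale[OF lin_e])
    show "tt (nrm X) = tight l K X"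
      using \<open>e X > 0\<close> by (auto simp: nrm_def tt_def tJ linear_scale[OF lin])
  qed
  have S: "X \<in> hcone l K" "X \<noteq> 0" if "X \<in> S" for X
    using that linear_0[OF lin_e] by (auto simp: S_def hc)
  have nonfull: "X \<noteq> 0" if "tight l K X \<noteq> J" for X
    using that linear_0[OF lin] by (auto simp: tJ)
  obtain X0 where X0: "X0 \<in> hcone l K" "tight l K X0 = {}" using interior by blast
  have "J \<noteq> {}" by (auto simp: J_def)
  then have X0S: "nrm X0 \<in> S" "tt (nrm X0) = {}" using nrm[OF X0(1) nonfull] X0(2) by auto
  have XjS: "\<exists>x\<in>S. tt x = {j}" if j: "j \<in> J" for j
  proof -
    obtain \<kappa> i where ij: "j = (\<kappa>, i)" "\<kappa> \<le> K" using j by (auto simp: J_def)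
    obtain X where X: "X \<in> hcone l K" "tight l K X = {j}" using facet[OF ij(2), of i] ij(1) by blast
    have "2 * 1 \<le> Suc K * CARD('i)" using K cpos by (intro mult_le_mono) linarith+
    then have "card J > 1" unfolding cJ by linarith
    then have "tight l K X \<noteq> J" using X(2) by auto
    then show ?thesis using nrm[OF X(1) nonfull] X(2) by auto
  qed
  have node: "tt X \<in> nodes l K" if "X \<in> polytope_vertices S" for X
  proof -
    have XS: "X \<in> S" and "DIM('v) \<le> card (tt X) + 1" using vertex_tight[OF that] by auto
    then have "card (tight l K X) = CARD('i)"
      using simple[OF S[OF XS]] dim by (simp add: tt)
    then show ?thesis using S[OF XS] by (auto simp: nodes_def tt)
  qed
  have vtx: "nrm w \<in> polytope_vertices S" "tt (nrm w) = layer \<kappa>"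
    if w: "w \<in> hcone l K" "tight l K w = layer \<kappa>" and w0: "w \<noteq> 0" and ker: "\<And>X. (\<forall>i. l (\<kappa>, i) X = 0) \<Longrightarrow> X \<in> span {w}" for w \<kappa>
  proof -
    note n = nrm[OF w(1) w0]
    show "tt (nrm w) = layer \<kappa>" using n(2) w(2) by simp
    have "e w > 0" using e_pos w(1) w0 hc by blast
    \<comment> \<open>A direction in \<open>W\<close> lies on the ray of \<open>w\<close> by
      \<open>ker\<close>, and \<open>e\<close> vanishes on it but not at \<open>w\<close>.\<close>
    have "x = 0" if "x \<in> W (tt (nrm w))" for x
    proof -
      have "\<forall>i. l (\<kappa>, i) x = 0" "e x = 0" using that n(2) w(2) by (auto simp: W_def layer_def)
      then obtain c where "x = c *\<^sub>R w" using ker by (auto simp: span_singleton)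
      then show ?thesis using \<open>e x = 0\<close> \<open>e w > 0\<close> by (simp add: linear_scale[OF lin_e])
    qed
    then show "nrm w \<in> polytope_vertices S" by (intro vertexI n) auto
  qed
  define \<phi> where "\<phi> X = f (tt X)" for X
  have "\<phi> y \<le> \<phi> x + 1" if "(x, y) \<in> polytope_adj S" for x y
  proof -
    have "x \<in> polytope_vertices S" "y \<in> polytope_vertices S" using that by (auto simp: polytope_adj_def)
    moreover have "CARD('i) \<le> card (tt y \<inter> tt x) + 1" using edge_tight[OF that] dim by (simp add: inf_commute)
    ultimately show ?thesis unfolding \<phi>_def by (intro lip node)
  qed
  moreover have "\<phi> (nrm u) = 0" "\<phi> (nrm v) = L"
    using vtx(2)[OF u u_nonzero ker_u] vtx(2)[OF v v_nonzero ker] f_ends by (simp_all add: \<phi>_def)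
  moreover have "affine_dim S = int CARD('i)" "card {F. is_facet_of F S} = Suc K * CARD('i)"
    using facets[OF X0S XjS] dim cJ by simp_all
  ultimately show ?thesis
    using polytope_S vtx(1)[OF u u_nonzero ker_u] vtx(1)[OF v v_nonzero ker]
    by (intro exI[of _ S] exI[of _ \<phi>] exI[of _ "nrm u"] exI[of _ "nrm v"]) auto
qed

section \<open>Transfer to finitely supported sequences\<close>

lemma embedding_exists:
  obtains g :: "'v::euclidean_space \<Rightarrow> point" where "linear g" "inj g"
proof -
  obtain idx :: "'v \<Rightarrow> nat" where idx: "inj_on idx Basis"
    using finite_imp_inj_to_nat_seg[OF finite_Basis] by blast
  define g :: "'v \<Rightarrow> point" where "g x = (\<Sum>b\<in>Basis. Poly_Mapping.single (idx b) (x \<bullet> b))" for x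
  have scale: "Poly_Mapping.lookup (c *\<^sub>R (p :: point)) n = c * Poly_Mapping.lookup p n" for c p n
    by (simp add: scaleR_poly_mapping_def Abs_poly_mapping_inverse)
  have single: "c *\<^sub>R Poly_Mapping.single n (t::real) = Poly_Mapping.single n (c * t)" for c t and n :: nat
    by (rule poly_mapping_eqI) (simp add: scale lookup_single when_def)
  have lin: "linear g"
    by (rule linearI) (simp_all add: g_def inner_add_left single_add sum.distrib scaleR_sum_right single)
  have look: "Poly_Mapping.lookup (g x) (idx b) = x \<bullet> b" if b: "b \<in> Basis" for x b
  proof -
    have "Poly_Mapping.lookup (g x) (idx b) = (\<Sum>c\<in>Basis. Poly_Mapping.lookup (Poly_Mapping.single (idx c) (x \<bullet> c)) (idx b))"
      by (simp add: g_def lookup_sum)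
    also have "\<dots> = (\<Sum>c\<in>Basis. if c = b then x \<bullet> c else 0)"
      using idx b by (intro sum.cong refl) (auto simp: lookup_single when_def inj_on_def)
    finally show ?thesis using b by simp
  qed
  have "inj g"
  proof (rule injI)
    fix x y assume "g x = g y"
    then show "x = y" using look by (metis euclidean_eqI)
  qed
  with lin show ?thesis by (rule that)
qed

lemma affine_dim_image:
  fixes g :: "'a::real_vector \<Rightarrow> 'b::real_vector"
  assumes g: "linear g" "inj g"
  shows "affine_dim (g ` S) = affine_dim S"
proof -
  let ?D = "{x - y |x y. x \<in> S \<and> y \<in> S}"
  have "{x - y |x y. x \<in> g ` S \<and> y \<in> g ` S} = (\<lambda>(x, y). g x - g y) ` (S \<times> S)" by force
  also have "\<dots> = g ` (\<lambda>(x, y). x - y) ` (S \<times> S)"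
    by (simp add: image_image case_prod_beta linear_diff[OF g(1)])
  also have "(\<lambda>(x, y). x - y) ` (S \<times> S) = ?D" by force
  finally have D: "{x - y |x y. x \<in> g ` S \<and> y \<in> g ` S} = g ` ?D" .
  obtain B where B: "B \<subseteq> ?D" "independent B" "?D \<subseteq> span B" "card B = dim ?D"
    by (rule basis_exists)
  have "dim (g ` ?D) = dim ?D"
  proof (rule dim_unique)
    show "g ` B \<subseteq> g ` ?D" using B(1) by blast
    show "g ` ?D \<subseteq> span (g ` B)" using B(3) linear_span_image[OF g(1), of B] by blast
    show "independent (g ` B)" using B(2) g by (simp add: linear_independent_injective_image inj_on_subset)
    show "card (g ` B) = dim ?D" by (simp only: card_image[OF inj_on_subset[OF g(2) subset_UNIV]] B(4))
  qed
  then show ?thesis by (simp only: affine_dim_def image_is_empty D)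
qed

lemma polytope_linear_image_general:
  fixes g :: "'a::real_vector \<Rightarrow> 'b::real_vector"
  assumes "linear g" "polytope S"
  shows "polytope (g ` S)"
proof -
  obtain V where "finite V" "S = convex hull V" using assms(2) by (auto simp: polytope_def)
  then have "g ` S = convex hull (g ` V)" "finite (g ` V)"
    using convex_hull_linear_image[OF assms(1)] by simp_all
  then show ?thesis by (auto simp: polytope_def)
qed

lemma face_of_image_iff:
  fixes g :: "'a::real_vector \<Rightarrow> 'b::real_vector"
  assumes "linear g" "inj g"
  shows "G face_of g ` S \<longleftrightarrow> (\<exists>F. F face_of S \<and> G = g ` F)"
proof
  assume G: "G face_of g ` S"
  then have "G \<subseteq> g ` S" by (simp add: face_of_def)
  then obtain F where "G = g ` F" by (auto simp: subset_image_iff)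
  then show "\<exists>F. F face_of S \<and> G = g ` F" using G face_of_linear_image[OF assms] by blast
qed (use face_of_linear_image[OF assms] in blast)

lemma transfer:
  fixes P :: "'v::real_vector set" and g :: "'v \<Rightarrow> 'b::real_vector"
  assumes g: "linear g" "inj g"
  shows "card {F. is_facet_of F (g ` P)} = card {F. is_facet_of F P}"
    and "polytope_vertices (g ` P) = g ` polytope_vertices P"
    and "(x, y) \<in> polytope_adj (g ` P) \<Longrightarrow> \<exists>a b. x = g a \<and> y = g b \<and> (a, b) \<in> polytope_adj P"
proof -
  have "{F. is_facet_of F (g ` P)} = image g ` {F. is_facet_of F P}"
    by (auto simp: is_facet_of_def face_of_image_iff[OF g] affine_dim_image[OF g])
  moreover have "inj_on (image g) A" for A
    using g(2) by (metis inj_image_eq_iff inj_onI)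
  ultimately show "card {F. is_facet_of F (g ` P)} = card {F. is_facet_of F P}"
    by (simp add: card_image)
  have sing: "{x} = g ` F \<longleftrightarrow> (\<exists>a. F = {a} \<and> x = g a)" for x F
  proof
    assume eq: "{x} = g ` F"
    then obtain a where a: "a \<in> F" "x = g a" by blast
    have "b = a" if "b \<in> F" for b
    proof -
      have "g b = g a" using eq a(2) that by blast
      then show ?thesis using g(2) by (rule injD[rotated])
    qed
    then have "F = {a}" using a(1) by blast
    then show "\<exists>a. F = {a} \<and> x = g a" using a(2) by blast
  qed auto
  show V: "polytope_vertices (g ` P) = g ` polytope_vertices P"
  proof -
    have "x extreme_point_of g ` P \<longleftrightarrow> (\<exists>a. a extreme_point_of P \<and> x = g a)" for x
      unfolding face_of_singleton[symmetric] face_of_image_iff[OF g] sing by blast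
    then show ?thesis by (auto simp: polytope_vertices_def)
  qed
  assume xy: "(x, y) \<in> polytope_adj (g ` P)"
  then obtain a b where ab: "x = g a" "y = g b" "a \<in> polytope_vertices P" "b \<in> polytope_vertices P"
    by (auto simp: polytope_adj_def V)
  obtain E where E: "is_edge_of E (g ` P)" "x \<in> E" "y \<in> E" "x \<noteq> y" using xy by (auto simp: polytope_adj_def)
  then obtain F where F: "F face_of P" "E = g ` F" by (auto simp: is_edge_of_def face_of_image_iff[OF g])
  have "is_edge_of F P" using E(1) F by (simp add: is_edge_of_def affine_dim_image[OF g])
  moreover have "a \<in> F" "b \<in> F" using E(2,3) F(2) ab g(2) by (simp_all add: inj_image_mem_iff)
  ultimately show "\<exists>a b. x = g a \<and> y = g b \<and> (a, b) \<in> polytope_adj P"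
    using ab E(4) by (auto simp: polytope_adj_def)
qed

text \<open>Along a path with \<open>n\<close> edges \<open>\<phi>\<close> rises by at most
  \<open>n\<close>. For a pair without a path the infimum defining the distance is infinite, so the
  bound is uniform.\<close>

lemma diameter_ge:
  assumes p: "p \<in> polytope_vertices P" and q: "q \<in> polytope_vertices P" and "\<phi> p = 0"
    and adj: "\<And>x y. (x, y) \<in> polytope_adj P \<Longrightarrow> \<phi> y \<le> \<phi> x + (1::nat)"
  shows "enat (\<phi> q) \<le> combinatorial_diameter P"
proof -
  have "\<phi> y \<le> \<phi> x + n" if "(x, y) \<in> polytope_adj P ^^ n" for x y n
    using that
  proof (induction n arbitrary: y)
    case (Suc n)
    then obtain z where "(x, z) \<in> polytope_adj P ^^ n" "(z, y) \<in> polytope_adj P" by auto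
    then show ?case using Suc.IH[of z] adj[of z y] by simp
  qed simp
  then have "enat (\<phi> q) \<le> graph_dist P p q"
    unfolding graph_dist_def using \<open>\<phi> p = 0\<close> by (intro INF_greatest) fastforce
  also have "\<dots> \<le> combinatorial_diameter P"
    unfolding combinatorial_diameter_def using p q by (meson SUP_upper SUP_upper2 order_refl)
  finally show ?thesis .
qed

lemma (in chain) point_polytope_exists:
  "\<exists>P :: point set. polytope P \<and> affine_dim P = int CARD('i) \<and>
    card {F. is_facet_of F P} = Suc K * CARD('i) \<and> enat L \<le> combinatorial_diameter P"
proof -
  obtain P :: "'v set" and \<phi> p q where P: "polytope P" "affine_dim P = int CARD('i)"
    "card {F. is_facet_of F P} = Suc K * CARD('i)" and pq: "p \<in> polytope_vertices P" "q \<in> polytope_vertices P"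
    "\<phi> p = (0::nat)" "\<phi> q = L" and adj: "\<forall>(x, y)\<in>polytope_adj P. \<phi> y \<le> \<phi> x + 1"
    using polytope_exists by blast
  obtain g :: "'v \<Rightarrow> point" where g: "linear g" "inj g" by (rule embedding_exists)
  define \<psi> where "\<psi> x = \<phi> (inv g x)" for x
  have \<psi>: "\<psi> (g x) = \<phi> x" for x using g(2) by (simp add: \<psi>_def)
  have "enat (\<psi> (g q)) \<le> combinatorial_diameter (g ` P)"
  proof (rule diameter_ge)
    show "g p \<in> polytope_vertices (g ` P)" "g q \<in> polytope_vertices (g ` P)"
      using pq by (simp_all add: transfer(2)[OF g])
    show "\<psi> (g p) = 0" by (simp add: \<psi> pq)
    show "\<psi> y \<le> \<psi> x + 1" if xy: "(x, y) \<in> polytope_adj (g ` P)" for x y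
    proof -
      obtain a b where ab: "x = g a" "y = g b" "(a, b) \<in> polytope_adj P" using transfer(3)[OF g xy] by blast
      then have "\<phi> b \<le> \<phi> a + 1" using adj by auto
      then show ?thesis by (simp add: ab \<psi>)
    qed
  qed
  then show ?thesis
    using P g by (intro exI[of _ "g ` P"]) (simp add: polytope_linear_image_general affine_dim_image transfer(1) \<psi> pq)
qed

section \<open>The counterexamples\<close>

text \<open>The listed vectors \<open>xs\<close> take the positions \<open>None\<close> and
  \<open>Some (Inl c)\<close>, which are not tilted; the surplus \<open>Some (Inr k)\<close>
  receives the rest of \<open>Q\<close>.\<close>

lemma enumeration_exists:
  fixes Q :: "'a set" and TC :: "'c::finite itself" and TK :: "'k::finite itself"
  assumes "finite Q" "card Q = CARD('c) + CARD('k) + 1"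
    and xs: "set xs \<subseteq> Q" "distinct xs" "length xs = CARD('c) + 1"
  obtains av :: "('c + 'k) option \<Rightarrow> 'a" where "bij_betw av UNIV Q" "insert (av None) (range (av \<circ> Some \<circ> Inl)) = set xs"
proof -
  have cx: "card (set xs) = CARD('c) + 1" using xs by (simp add: distinct_card)
  have "xs \<noteq> []" using xs(3) by auto
  then obtain x ys where x: "xs = x # ys" by (cases xs) auto
  have "card (set ys) = CARD('c)" using xs(2,3) by (simp add: x distinct_card)
  then obtain f :: "'c \<Rightarrow> 'a" where f: "bij_betw f UNIV (set ys)"
    by (metis finite finite_set finite_same_card_bij)
  have "card (Q - set xs) = CARD('k)"
    using assms(1,2) xs(1) cx by (simp add: card_Diff_subset)
  then obtain g :: "'k \<Rightarrow> 'a" where g: "bij_betw g UNIV (Q - set xs)"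
    using assms(1) by (metis finite finite_Diff finite_same_card_bij)
  define av where "av i = (case i of None \<Rightarrow> x | Some (Inl c) \<Rightarrow> f c | Some (Inr k) \<Rightarrow> g k)" for i
  have rf: "range f = set ys" and rg: "range g = Q - set xs" and injf: "inj f" and injg: "inj g"
    using f g by (simp_all add: bij_betw_def)
  have xy: "x \<notin> set ys" using xs(2) by (simp add: x)
  have fm: "f c \<in> set ys" for c using rf by blast
  have gm: "g k \<in> Q" "g k \<notin> set xs" for k using rg by blast+
  have "inj av"
  proof (rule injI)
    fix i j assume "av i = av j"
    then show "i = j"
      using xy fm gm injf injg
      by (cases i; cases j; auto simp: av_def x inj_def split: sum.splits) (metis list.set_intros)+
  qed
  moreover have "range av = Q"
  proof (intro equalityI subsetI)
    fix y assume "y \<in> range av"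
    then obtain i where "y = av i" by blast
    then show "y \<in> Q" using xs(1) fm gm by (cases i) (auto simp: av_def x split: sum.splits)
  next
    fix y assume y: "y \<in> Q"
    consider "y = x" | "y \<in> range f" | "y \<in> range g" using y rf rg x by auto
    then show "y \<in> range av"
    proof cases
      case 1 then have "y = av None" by (simp add: av_def)
      then show ?thesis by blast
    next
      case 2 then obtain c where "y = av (Some (Inl c))" by (auto simp: av_def)
      then show ?thesis by blast
    next
      case 3 then obtain k where "y = av (Some (Inr k))" by (auto simp: av_def)
      then show ?thesis by blast
    qed
  qed
  ultimately have "bij_betw av UNIV Q" by (simp add: bij_betw_def)
  moreover have "av \<circ> Some \<circ> Inl = f" by (auto simp: av_def)
  then have "insert (av None) (range (av \<circ> Some \<circ> Inl)) = set xs"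
    using rf by (simp add: av_def x)
  ultimately show ?thesis by (rule that)
qed

lemma card_tie_bij:
  assumes "bij_betw av UNIV Q"
  shows "card {i. av i \<bullet> z = p} = card (tie Q z p)"
proof -
  have "tie Q z p = av ` {i. av i \<bullet> z = p}"
    using assms by (auto simp: tie_def bij_betw_def)
  moreover have "inj_on av {i. av i \<bullet> z = p}" using assms by (meson bij_betw_def inj_on_subset subset_UNIV)
  ultimately show ?thesis by (simp add: card_image)
qed

theorem spindle35:
  "\<exists>(m :: nat \<times> ((4 + 15) + 15 option) \<Rightarrow> (R4, 15) lifted \<Rightarrow> real) g a b. spindle m 36 g a b"
proof -
  \<comment> \<open>Five normals for the hypothesis \<open>basis\<close>: the first two are
    opposite, so equal values force \<open>p = 0\<close>, and the first together with the other
    three then annihilates all four coordinates.\<close>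
  define xsA where "xsA = [(2,0,0,0), (-2,0,0,0), (0,2,0,0), (0,0,9,0), (0,0,0,9) :: R4]"
  define xsB where "xsB = [(9,0,0,0), (-9,0,0,0), (0,9,0,0), (0,0,2,0), (0,0,0,2) :: R4]"
  have xA: "set xsA \<subseteq> QA" "distinct xsA" "length xsA = CARD(4) + 1"
    by (simp_all add: xsA_def QA_def PA_def)
  have xB: "set xsB \<subseteq> QB" "distinct xsB" "length xsB = CARD(4) + 1"
    by (simp_all add: xsB_def QB_def PB_def)
  have "card QA = CARD(4) + CARD(15) + 1" "card QB = CARD(4) + CARD(15) + 1"
    by (simp_all add: card_QA card_QB)
  note cQ = this
  obtain av :: "(4 + 15) option \<Rightarrow> R4" where av: "bij_betw av UNIV QA" "insert (av None) (range (av \<circ> Some \<circ> Inl)) = set xsA"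
    by (rule enumeration_exists[OF finite_QA cQ(1) xA])
  obtain bv :: "(4 + 15) option \<Rightarrow> R4" where bv: "bij_betw bv UNIV QB" "insert (bv None) (range (bv \<circ> Some \<circ> Inl)) = set xsB"
    by (rule enumeration_exists[OF finite_QB cQ(2) xB])
  have rA: "range av = QA" and rB: "range bv = QB" using av(1) bv(1) by (simp_all add: bij_betw_def)
  have allA: "(\<forall>a\<in>QA. P a)" if "\<And>i. P (av i)" for P unfolding rA[symmetric] using that by simp
  have allB: "(\<forall>a\<in>QB. P a)" if "\<And>i. P (bv i)" for P unfolding rB[symmetric] using that by simp
  have mA: "av i \<in> QA" for i using rA by blast
  have mB: "bv i \<in> QB" for i using rB by blast
  have axA: "z = 0" if "\<forall>a\<in>set xsA. a \<bullet> z = p" for z p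
  proof -
    obtain z1 z2 z3 z4 where z: "z = (z1, z2, z3, z4)" by (metis prod_cases4)
    have "2 * z1 = p" "- 2 * z1 = p" "2 * z2 = p" "9 * z3 = p" "9 * z4 = p"
      using that by (simp_all add: xsA_def z)
    then show ?thesis by (simp add: z zero_prod_def)
  qed
  have axB: "z = 0" if "\<forall>a\<in>set xsB. a \<bullet> z = p" for z p
  proof -
    obtain z1 z2 z3 z4 where z: "z = (z1, z2, z3, z4)" by (metis prod_cases4)
    have "9 * z1 = p" "- 9 * z1 = p" "9 * z2 = p" "2 * z3 = p" "2 * z4 = p"
      using that by (simp_all add: xsB_def z)
    then show ?thesis by (simp add: z zero_prod_def)
  qed
  have posA: "z = 0" if "\<forall>a\<in>QA. a \<bullet> z \<le> 0" for z
  proof (rule ccontr)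
    assume "z \<noteq> 0"
    obtain w1 w2 w3 w4 where "absv z = (w1, w2, w3, w4)" by (metis prod_cases4)
    from QA_leD(1)[OF that this \<open>z \<noteq> 0\<close>] show False by simp
  qed
  have posB: "z = 0" if "\<forall>a\<in>QB. a \<bullet> z \<le> 0" for z
  proof (rule ccontr)
    assume "z \<noteq> 0"
    obtain w1 w2 w3 w4 where "absv z = (w1, w2, w3, w4)" by (metis prod_cases4)
    from QB_leD(1)[OF that this \<open>z \<noteq> 0\<close>] show False by simp
  qed
  have "config av bv"
  proof (intro config.intro config_axioms.intro cap_config.intro)
    show "DIM(R4) = CARD(4)" "DIM(R4) = CARD(4)" by simp_all
    show "z = 0" if "av None \<bullet> z = p" "\<And>c. av (Some (Inl c)) \<bullet> z = p" for z p
      using that by (intro axA[of z p]) (auto simp: av(2)[symmetric])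
    show "z = 0" if "bv None \<bullet> z = p" "\<And>c. bv (Some (Inl c)) \<bullet> z = p" for z p
      using that by (intro axB[of z p]) (auto simp: bv(2)[symmetric])
    show "z = 0" if "\<And>i. av i \<bullet> z \<le> 0" for z by (intro posA allA that)
    show "z = 0" if "\<And>i. bv i \<bullet> z \<le> 0" for z by (intro posB allB that)
    show "card {i. av i \<bullet> z = p} + card {i. bv i \<bullet> z = q} \<le> CARD(4) + 1"
      if "z \<noteq> 0" "\<And>i. av i \<bullet> z \<le> p" "\<And>i. bv i \<bullet> z \<le> q" for z p q
    proof -
      have "card (tie QA z p) + card (tie QB z q) \<le> 5"
        by (intro card_tie_le allA allB that)
      then show ?thesis by (simp add: card_tie_bij[OF av(1)] card_tie_bij[OF bv(1)])
    qed
    show False if h: "z \<noteq> 0" "z' \<noteq> 0" "\<And>i. av i \<bullet> z \<le> p" "\<And>i. bv i \<bullet> z \<le> q" "\<And>i. av i \<bullet> z' \<le> p'" "\<And>i. bv i \<bullet> z' \<le> q'"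
      "CARD(4) \<le> card {i. av i \<bullet> z = p}" "CARD(4) \<le> card {i. bv i \<bullet> z' = q'}"
      "av i \<bullet> z = p" "av i \<bullet> z' = p'" "bv j \<bullet> z = q" "bv j \<bullet> z' = q'" for z p q z' p' q' i j
    proof (rule no_short_chain)
      show "z \<noteq> 0" "z' \<noteq> 0" by (rule h)+
      show "\<forall>a\<in>QA. a \<bullet> z \<le> p" "\<forall>a\<in>QA. a \<bullet> z' \<le> p'" by (intro allA h)+
      show "\<forall>b\<in>QB. b \<bullet> z \<le> q" "\<forall>b\<in>QB. b \<bullet> z' \<le> q'" by (intro allB h)+
      show "4 \<le> card (tie QA z p)" "4 \<le> card (tie QB z' q')"
        using h(7,8) by (simp_all add: card_tie_bij[OF av(1)] card_tie_bij[OF bv(1)])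
      show "av i \<in> tie QA z p" "av i \<in> tie QA z' p'" "bv j \<in> tie QB z q" "bv j \<in> tie QB z' q'"
        using h(9-12) mA mB by (simp_all add: tie_def)
    qed
  qed
  from config.spindle_exists[OF this] show ?thesis by simp
qed

text \<open>\<open>K + 1\<close> copies of the product spindle, consecutive ones sharing a layer,
  have \<open>K + 2\<close> layers of 70 facets. A single copy has length 72, and every further one
  adds 71.\<close>

theorem long_polytopes:
  "\<exists>P :: point set. polytope P \<and> affine_dim P = 70 \<and> card {F. is_facet_of F P} = 70 * (K + 2) \<and>
    enat (71 * (K + 1) + 1) \<le> combinatorial_diameter P"
proof -
  obtain m :: "nat \<times> ((4 + 15) + 15 option) \<Rightarrow> (R4, 15) lifted \<Rightarrow> real" and g a b where S: "spindle m 36 g a b"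
    using spindle35 by blast
  interpret spindle m 36 g a b by (rule S)
  have P: "spindle m2 72 g2 ((fst a, fst a), snd a) ((fst b, fst b), snd b)" using product by simp
  have "(1::nat) \<le> 72" "2 \<le> CARD(((4 + 15) + 15 option) + ((4 + 15) + 15 option))" by simp_all
  from long_chain[OF P this, of K]
  obtain l :: "nat \<times> (((4 + 15) + 15 option) + ((4 + 15) + 15 option)) \<Rightarrow>
      ((R4 \<times> real \<times> (real^15) \<times> (real^15)) \<times> (R4 \<times> real \<times> (real^15) \<times> (real^15))) \<times> real \<Rightarrow> real" and f u v
    where l: "chain l (Suc K) (Suc K * (72 - 1) + 1) f u v" by blast
  have c: "CARD(((4 + 15) + 15 option) + ((4 + 15) + 15 option)) = 70" by simp
  from chain.point_polytope_exists[OF l] show ?thesis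
    unfolding c by (simp add: algebra_simps)
qed

theorem theorem1p8:
  shows "\<exists>(d::nat) (\<epsilon>::real) (P :: nat \<Rightarrow> point set) (n :: nat \<Rightarrow> nat).
    \<epsilon> > 0 \<and> strict_mono n \<and>
    (\<forall>k. polytope (P k) \<and> affine_dim (P k) = int d \<and>
         card {F. is_facet_of F (P k)} = n k \<and>
         ereal_of_enat (combinatorial_diameter (P k)) > ereal ((1 + \<epsilon>) * real (n k)))"
proof -
  define good where "good K P \<longleftrightarrow> polytope P \<and> affine_dim P = 70 \<and> card {F. is_facet_of F P} = 70 * (K + 2) \<and>
    enat (71 * (K + 1) + 1) \<le> combinatorial_diameter P" for K and P :: "point set"
  have "\<exists>P. good K P" for K using long_polytopes unfolding good_def .
  then obtain P where P: "\<And>K. good K (P K)" by metis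
  \<comment> \<open>With \<open>\<epsilon> = 1/140\<close> the inequality reads 71 (K + 1) + 1 >
    70.5 (K + 2), which holds from K = 139 on; starting at 200 is a convenient choice.\<close>
  define Q where "Q k = P (k + 200)" for k
  define n where "n k = 70 * ((k + 200) + 2)" for k :: nat
  have "strict_mono n" by (simp add: n_def strict_mono_def)
  moreover have "polytope (Q k) \<and> affine_dim (Q k) = int 70 \<and> card {F. is_facet_of F (Q k)} = n k \<and>
      ereal_of_enat (combinatorial_diameter (Q k)) > ereal ((1 + 1/140) * real (n k))" for k
  proof -
    have g: "good (k + 200) (Q k)" using P by (simp add: Q_def)
    have "ereal ((1 + 1/140) * real (n k)) < ereal (real (71 * (k + 200 + 1) + 1))"
      by (simp add: n_def field_simps)
    also have "\<dots> = ereal_of_enat (enat (71 * (k + 200 + 1) + 1))" by simp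
    also have "\<dots> \<le> ereal_of_enat (combinatorial_diameter (Q k))"
      using g unfolding good_def by (simp only: ereal_of_enat_le_iff)
    finally show ?thesis using g unfolding good_def n_def by simp
  qed
  ultimately show ?thesis
    by (intro exI[of _ 70] exI[of _ "1/140"] exI[of _ Q] exI[of _ n]) simp
qed

end
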